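(* Let $a,d\in\mathbb{R}$ with $|a-d|<2$, let $A_4=\begin{pmatrix} a & -1\\ 1 & d\end{pmatrix}$ and let $b_+=\dfrac{a+d+\sqrt{(a-d)^2-4}}{2}$. (a) If $a^2-ad-1=0$ and $-2<a-d<0$, then $$\mathrm{Spec}(A_4D)=\left\{-\frac{k^2\pi^2}{[\mathrm{Im}(b_+^{-1/2})]^2}\right\}_{k\in\mathbb{Z}}\subset(-\infty,0].$$ (b) If $a^2-ad-1=0$ and $0<a-d<2$, then $$\mathrm{Spec}(A_4D)=\left\{\frac{k^2\pi^2}{[\mathrm{Re}(b_+^{-1/2})]^2}\right\}_{k\in\mathbb{Z}}\subset[0,\infty).$$ (c) If $a^2-ad-1\neq0$, then $\mathrm{Spec}(A_4D)$ is infinite but it only intersects the real line in a finite number of points.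
   Context: Let $W^{2,2}$ be the Sobolev space of all $f\in L^2(0,1)\otimes\mathbb{C}^2$ whose generalized derivative $f''$ lies in $L^2(0,1)\otimes\mathbb{C}^2$, and write $f=\begin{pmatrix}\phi\\ \gamma\end{pmatrix}$. The operator $D$ acts on $L^2(0,1)\otimes\mathbb{C}^2$ by $Df=-f''$ with domain $\mathrm{Dom}(D)=\{f\in W^{2,2}:\phi(0)=\phi(1)=0,\ \gamma'(0)=\gamma'(1)=0\}$. For a constant $2\times2$ matrix $A$, $AD$ is the operator $f\mapsto -Af''$ with domain $\mathrm{Dom}(D)$. $\mathrm{Spec}$ denotes the spectrum. When $|a-d|<2$, $\sqrt{(a-d)^2-4}$ means $i\sqrt{4-(a-d)^2}$, so $b_+$ is a non-real eigenvalue of $A_4$; $b_+^{-1/2}=1/\sqrt{b_+}$ for a choice of square root (the formulas do not depend on the choice). *)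

theory Defs
  imports "HOL-Analysis.Analysis"
begin

abbreviation unit_measure :: "real measure" where
  "unit_measure \<equiv> lebesgue_on {0<..<1}"

text \<open>
  The space \<open>L\<^sup>2(0,1) \<otimes> \<complex>\<^sup>2\<close> is handled through representatives \<open>real \<Rightarrow> complex ^ 2\<close>, whose
  values outside the open unit interval are irrelevant; its elements are the classes modulo
  \<open>ae_eq\<close>. The norm of the type \<open>complex ^ 2\<close> is the Hermitian norm of \<open>\<complex>\<^sup>2\<close>.
\<close>

definition L2 :: "(real \<Rightarrow> complex ^ 2) set" where
  "L2 = {f. f \<in> borel_measurable unit_measure \<and> integrable unit_measure (\<lambda>x. (norm (f x))\<^sup>2)}"

definition ae_eq :: "(real \<Rightarrow> complex ^ 2) \<Rightarrow> (real \<Rightarrow> complex ^ 2) \<Rightarrow> bool" where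
  "ae_eq f g \<longleftrightarrow> (AE x in unit_measure. f x = g x)"

definition L2_norm :: "(real \<Rightarrow> complex ^ 2) \<Rightarrow> real" where
  "L2_norm f = sqrt (\<integral>x. (norm (f x))\<^sup>2 \<partial>unit_measure)"

definition test_function :: "(real \<Rightarrow> real) \<Rightarrow> bool" where
  "test_function \<psi> \<longleftrightarrow>
     (\<forall>n. ((deriv ^^ n) \<psi>) differentiable_on UNIV) \<and>
     compact (closure {x. \<psi> x \<noteq> 0}) \<and> closure {x. \<psi> x \<noteq> 0} \<subseteq> {0<..<1}"

definition is_generalized_deriv2 ::
    "(real \<Rightarrow> complex ^ 2) \<Rightarrow> (real \<Rightarrow> complex ^ 2) \<Rightarrow> bool" where
  "is_generalized_deriv2 f g \<longleftrightarrow>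
     (\<forall>\<psi>. test_function \<psi> \<longrightarrow>
        (\<integral>x. deriv (deriv \<psi>) x *\<^sub>R f x \<partial>unit_measure) = (\<integral>x. \<psi> x *\<^sub>R g x \<partial>unit_measure))"

definition W22 :: "(real \<Rightarrow> complex ^ 2) set" where
  "W22 = {f \<in> L2. \<exists>g \<in> L2. is_generalized_deriv2 f g}"

text \<open>Determined up to a null set for \<open>f \<in> W22\<close>, so the choice is immaterial.\<close>

definition generalized_deriv2 :: "(real \<Rightarrow> complex ^ 2) \<Rightarrow> (real \<Rightarrow> complex ^ 2)" where
  "generalized_deriv2 f = (SOME g. g \<in> L2 \<and> is_generalized_deriv2 f g)"

text \<open>
  Boundary values of a Sobolev function and of its derivative are those of its \<open>C\<^sup>1\<close>
  representative \<open>u\<close> on the closed interval (which is unique there), with one-sided derivatives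
  at the endpoints.
\<close>

definition C1_representative ::
    "(real \<Rightarrow> complex ^ 2) \<Rightarrow> (real \<Rightarrow> complex ^ 2) \<Rightarrow> (real \<Rightarrow> complex ^ 2) \<Rightarrow> bool" where
  "C1_representative f u u' \<longleftrightarrow>
     ae_eq f u \<and>
     (\<forall>x \<in> {0..1}. (u has_vector_derivative u' x) (at x within {0..1})) \<and>
     continuous_on {0..1} u'"

definition Dom_D :: "(real \<Rightarrow> complex ^ 2) set" where
  "Dom_D = {f \<in> W22. \<exists>u u'. C1_representative f u u' \<and>
     u 0 $ 1 = 0 \<and> u 1 $ 1 = 0 \<and> u' 0 $ 2 = 0 \<and> u' 1 $ 2 = 0}"

definition D_op :: "(real \<Rightarrow> complex ^ 2) \<Rightarrow> (real \<Rightarrow> complex ^ 2)" where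
  "D_op f = (\<lambda>x. - generalized_deriv2 f x)"

definition AD_op :: "complex ^ 2 ^ 2 \<Rightarrow> (real \<Rightarrow> complex ^ 2) \<Rightarrow> (real \<Rightarrow> complex ^ 2)" where
  "AD_op A f = (\<lambda>x. A *v D_op f x)"

text \<open>
  \<open>z\<close> is in the resolvent set of an operator \<open>T\<close> with domain \<open>X\<close> iff \<open>T - z : X \<rightarrow> L\<^sup>2\<close> is
  surjective, injective, and has a bounded inverse; all three are read modulo \<open>ae_eq\<close>.
\<close>

definition resolvent_set ::
    "(real \<Rightarrow> complex ^ 2) set \<Rightarrow> ((real \<Rightarrow> complex ^ 2) \<Rightarrow> (real \<Rightarrow> complex ^ 2)) \<Rightarrow> complex set" where
  "resolvent_set X T = {z.
     let S = (\<lambda>f x. T f x - z *s f x) in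
       (\<forall>h \<in> L2. \<exists>f \<in> X. ae_eq (S f) h) \<and>
       (\<forall>f \<in> X. \<forall>g \<in> X. ae_eq (S f) (S g) \<longrightarrow> ae_eq f g) \<and>
       (\<exists>C. \<forall>f \<in> X. L2_norm f \<le> C * L2_norm (S f))}"

definition Spec ::
    "(real \<Rightarrow> complex ^ 2) set \<Rightarrow> ((real \<Rightarrow> complex ^ 2) \<Rightarrow> (real \<Rightarrow> complex ^ 2)) \<Rightarrow> complex set" where
  "Spec X T = - resolvent_set X T"

definition A4 :: "real \<Rightarrow> real \<Rightarrow> complex ^ 2 ^ 2" where
  "A4 a d = vector [vector [of_real a, - 1], vector [1, of_real d]]"

text \<open>For \<open>\<bar>a - d\<bar> < 2\<close> the square root of \<open>(a - d)\<^sup>2 - 4\<close> is \<open>\<i> * sqrt (4 - (a - d)\<^sup>2)\<close>.\<close>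

definition b_plus :: "real \<Rightarrow> real \<Rightarrow> complex" where
  "b_plus a d = (of_real (a + d) + \<i> * of_real (sqrt (4 - (a - d)\<^sup>2))) / 2"

end

theory Submission
  imports Defs "HOL-Complex_Analysis.Great_Picard"
begin

text \<open>
  The eigenvectors of \<open>A\<^sub>4\<close> for \<open>b\<^sub>+\<close> and its conjugate are \<open>(1, p)\<close> and \<open>(1, q)\<close> with \<open>p = a - b\<^sub>+\<close>,
  \<open>q = cnj p\<close> and \<open>p q = 1\<close>. In this basis \<open>A\<^sub>4 D f - z f = h\<close> decouples into two scalar equations
  \<open>y'' + w\<^sup>2 y = k\<close> with \<open>w = \<zeta> / s\<close> and \<open>w = \<zeta> / cnj s\<close>, where \<open>\<zeta>\<^sup>2 = z\<close>; only the boundary conditions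
  couple them. Hence \<open>z \<noteq> 0\<close> is in the spectrum iff the determinant of the boundary conditions at \<open>1\<close>
  vanishes, and writing \<open>1 / s = \<alpha> + \<i> \<beta>\<close> this is
  \<open>(1 - \<kappa>) sin\<^sup>2(\<alpha> \<zeta>) = (1 + \<kappa>) sinh\<^sup>2(\<beta> \<zeta>)\<close> with \<open>\<kappa> = Re (p\<^sup>2 cnj b\<^sub>+) / |b\<^sub>+|\<close>.
  Since \<open>p\<^sup>2 cnj b\<^sub>+ = (a\<^sup>2 - a d - 1) p - a\<close> has modulus \<open>|b\<^sub>+|\<close>, one has \<open>\<kappa> = \<plusminus>1\<close> exactly in the first two
  cases, where one side of the equation drops out. If \<open>|\<kappa>| < 1\<close>, the equation confines its real and
  its purely imaginary solutions to a bounded set, while Hurwitz' theorem yields infinitely many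
  complex solutions along a ray.
\<close>

section \<open>Smooth functions and test functions\<close>

text \<open>The obstacle is that domain and spectrum are given through weak derivatives of L2
  classes, while the decoupling needs boundary values. A vector-valued lemma of du Bois-Reymond
  closes the gap: a weak second derivative \<open>g\<close> in L2 amounts to a representative that
  is a double primitive of \<open>g\<close>. The spectral question becomes a boundary value problem
  on the closed interval, where a sup bound by the L1 norm of the right side already yields a
  bounded inverse. The determinant collapses for two reasons. Taking \<open>s\<close> and
  \<open>cnj s\<close> as roots of \<open>b\<close> and \<open>cnj b\<close> makes the two
  frequencies \<alpha>\<zeta> + i\<beta>\<zeta> and \<alpha>\<zeta> - i\<beta>\<zeta>, so products
  of their sines and cosines separate into sin^2(\<alpha>\<zeta>) and sinh^2(\<beta>\<zeta>); and
  \<open>p * q = 1\<close> supplies the squared sines that complete the squared cosines to 1. The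
  resulting equation is even in \<zeta>, so the choice of the root of z does not matter.\<close>

definition smooth :: "(real \<Rightarrow> real) \<Rightarrow> bool" where
  "smooth f \<longleftrightarrow> (\<forall>n. ((deriv ^^ n) f) differentiable_on UNIV)"

text \<open>Smoothness is the largest class of differentiable functions closed under
  \<open>deriv\<close>; exhibiting such a class replaces inductions on the order of the
  derivative.\<close>

lemma smooth_coinduct:
  assumes "X f" and step: "\<And>f. X f \<Longrightarrow> f differentiable_on UNIV \<and> X (deriv f)"
  shows "smooth f"
proof -
  have "X ((deriv ^^ n) f)" for n
    by (induction n) (use assms in auto)
  then show ?thesis
    using step by (auto simp: smooth_def)
qed

lemma smooth_deriv: "smooth f \<Longrightarrow> smooth (deriv f)"
  unfolding smooth_def by (metis comp_apply funpow_Suc_right)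

lemma smooth_has_derivative:
  assumes "smooth f"
  shows "(f has_real_derivative deriv f x) (at x)"
proof -
  have "(deriv ^^ 0) f differentiable_on UNIV"
    using assms by (auto simp only: smooth_def)
  then show ?thesis
    by (simp add: differentiable_on_def field_differentiable_derivI real_differentiableE
        DERIV_deriv_iff_real_differentiable)
qed

lemma differentiable_on_UNIV_I:
  fixes f :: "real \<Rightarrow> real"
  assumes "\<And>x. (f has_real_derivative f' x) (at x)"
  shows "f differentiable_on UNIV" "deriv f = f'"
  using assms by (auto simp: differentiable_on_def real_differentiable_def DERIV_imp_deriv)

text \<open>The derivative of a product is a sum of products, so the products alone are not closed
  under \<open>deriv\<close>. Generating all operations together gives a closed class and avoids
  formulas for derivatives of higher order.\<close>

inductive smooth_alg :: "(real \<Rightarrow> real) \<Rightarrow> bool" where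
  base: "smooth f \<Longrightarrow> smooth_alg f"
| const: "smooth_alg (\<lambda>x. c)"
| add: "smooth_alg f \<Longrightarrow> smooth_alg g \<Longrightarrow> smooth_alg (\<lambda>x. f x + g x)"
| mult: "smooth_alg f \<Longrightarrow> smooth_alg g \<Longrightarrow> smooth_alg (\<lambda>x. f x * g x)"
| affine: "smooth_alg f \<Longrightarrow> smooth_alg (\<lambda>x. f (c * x + e))"

lemma smooth_alg_deriv:
  "smooth_alg f \<Longrightarrow> (\<forall>x. (f has_real_derivative deriv f x) (at x)) \<and> smooth_alg (deriv f)"
proof (induction rule: smooth_alg.induct)
  case (base f)
  then show ?case
    by (simp add: smooth_has_derivative smooth_deriv smooth_alg.base)
next
  case (const c)
  then show ?case
    by (auto intro: smooth_alg.const)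
next
  case (add f g)
  have D: "((\<lambda>x. f x + g x) has_real_derivative deriv f x + deriv g x) (at x)" for x
    using add.IH by (auto intro!: derivative_intros)
  show ?case
    using D add.IH smooth_alg.add[of "deriv f" "deriv g"]
    by (simp add: differentiable_on_UNIV_I(2)[OF D])
next
  case (mult f g)
  have D: "((\<lambda>x. f x * g x) has_real_derivative f x * deriv g x + deriv f x * g x) (at x)" for x
    using mult.IH by (auto intro!: derivative_eq_intros)
  show ?case
    using D mult by (simp add: differentiable_on_UNIV_I(2)[OF D] smooth_alg.add smooth_alg.mult)
next
  case (affine f c e)
  have D: "((\<lambda>x. f (c * x + e)) has_real_derivative c * deriv f (c * x + e)) (at x)" for x
  proof -
    have 1: "(f has_real_derivative deriv f (c * x + e)) (at (c * x + e))"
      using affine.IH by blast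
    have 2: "((\<lambda>x. c * x + e) has_real_derivative c) (at x)"
      by (auto intro!: derivative_eq_intros)
    show ?thesis using DERIV_chain2[OF 1 2] by (simp only: mult.commute)
  qed
  show ?case
    using D affine
    by (simp add: differentiable_on_UNIV_I(2)[OF D] smooth_alg.mult smooth_alg.const smooth_alg.affine)
qed

lemma smooth_alg_iff: "smooth_alg f \<longleftrightarrow> smooth f"
proof
  assume "smooth_alg f"
  then show "smooth f"
    by (rule smooth_coinduct[of smooth_alg]) (use smooth_alg_deriv differentiable_on_UNIV_I(1) in blast)
qed (rule smooth_alg.base)

lemmas smooth_intros = smooth_alg.const[unfolded smooth_alg_iff] smooth_alg.add[unfolded smooth_alg_iff]
  smooth_alg.mult[unfolded smooth_alg_iff] smooth_alg.affine[unfolded smooth_alg_iff]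

section \<open>A smooth function that is flat at the origin\<close>

definition exp_bump :: "real \<Rightarrow> real" where
  "exp_bump x = (if x > 0 then exp (- inverse x) else 0)"

lemma poly_inverse_exp_tendsto_0:
  fixes P :: "real poly"
  shows "((\<lambda>x. poly P (inverse x) * exp (- inverse x)) \<longlongrightarrow> 0) (at_right 0)"
proof -
  have "((\<lambda>x. poly P x * exp (- x)) \<longlongrightarrow> 0) at_top"
  proof -
    have "((\<lambda>x. \<Sum>i\<le>degree P. coeff P i * (x ^ i / exp x)) \<longlongrightarrow> (\<Sum>i\<le>degree P. coeff P i * 0)) at_top"
      by (intro tendsto_intros tendsto_power_div_exp_0)
    then show ?thesis
      by (simp add: poly_altdef sum_distrib_right exp_minus divide_inverse mult.assoc)
  qed
  from filterlim_compose[OF this filterlim_inverse_at_top_right] show ?thesis .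
qed

text \<open>With t = 1/x the derivative in x is -t^2 times the derivative in t, and P(t) exp(-t) has
  t-derivative (P' - P) exp(-t). So the functions P(1/x) exp(-1/x), extended by 0, form a class
  closed under \<open>deriv\<close>.\<close>

lemma poly_inverse_exp_derivative:
  fixes P :: "real poly"
  defines "f \<equiv> \<lambda>P x. if x > 0 then poly P (inverse x) * exp (- inverse x) else 0"
  shows "(f P has_real_derivative f (monom 1 2 * (P - pderiv P)) x) (at x)"
proof -
  consider "x > 0" | "x < 0" | "x = 0" by linarith
  then show ?thesis
  proof cases
    case 1
    have "((\<lambda>x. poly P (inverse x) * exp (- inverse x)) has_real_derivative
            f (monom 1 2 * (P - pderiv P)) x) (at x)"
      using 1 unfolding f_def
      by (auto intro!: derivative_eq_intros poly_DERIV DERIV_chain2[where f="poly P"]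
          simp: poly_monom field_simps power2_eq_square)
    then show ?thesis
      by (rule has_field_derivative_transform_within_open[where S="{0<..}"]) (use 1 in \<open>auto simp: f_def\<close>)
  next
    case 2
    have "((\<lambda>x. 0) has_real_derivative f (monom 1 2 * (P - pderiv P)) x) (at x)"
      using 2 by (auto simp: f_def)
    then show ?thesis
      by (rule has_field_derivative_transform_within_open[where S="{..<0}"]) (use 2 in \<open>auto simp: f_def\<close>)
  next
    case 3
    have "((\<lambda>y. f P y / y) \<longlongrightarrow> 0) (at 0)"
    proof (rule filterlim_split_at)
      have "\<forall>\<^sub>F y in at_left 0. f P y / y = 0"
        by (auto simp: f_def eventually_at_filter)
      then show "((\<lambda>y. f P y / y) \<longlongrightarrow> 0) (at_left 0)"
        by (rule tendsto_eventually)
      \<comment> \<open>Dividing by y multiplies the polynomial in 1/y by its variable, so the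
        difference quotient at 0 is again of the same kind.\<close>
      have "((\<lambda>y. poly ([:0,1:] * P) (inverse y) * exp (- inverse y)) \<longlongrightarrow> 0) (at_right 0)"
        by (rule poly_inverse_exp_tendsto_0)
      moreover have "\<forall>\<^sub>F y in at_right 0. poly ([:0,1:] * P) (inverse y) * exp (- inverse y) = f P y / y"
        by (auto simp: f_def eventually_at_filter field_simps)
      ultimately show "((\<lambda>y. f P y / y) \<longlongrightarrow> 0) (at_right 0)"
        by (rule Lim_transform_eventually)
    qed
    then show ?thesis
      using 3 by (simp add: f_def has_field_derivative_iff)
  qed
qed

lemma smooth_exp_bump: "smooth exp_bump"
proof -
  let ?f = "\<lambda>P x::real. if x > 0 then poly P (inverse x) * exp (- inverse x) else 0"
  have "\<exists>P. exp_bump = ?f P"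
    by (intro exI[of _ 1]) (auto simp: exp_bump_def)
  then show ?thesis
  proof (rule smooth_coinduct[of "\<lambda>f. \<exists>P. f = ?f P"])
    fix f assume "\<exists>P. f = ?f P"
    then obtain P where "f = ?f P" by blast
    then show "f differentiable_on UNIV \<and> (\<exists>P. deriv f = ?f P)"
      using differentiable_on_UNIV_I[OF poly_inverse_exp_derivative[of P]] by auto
  qed
qed

lemma exp_bump_bounds: "0 \<le> exp_bump x" "exp_bump x \<le> 1"
  by (auto simp: exp_bump_def)

section \<open>Test functions and their primitives\<close>

lemma test_function_iff:
  "test_function \<psi> \<longleftrightarrow> smooth \<psi> \<and> (\<exists>p q. 0 < p \<and> p < q \<and> q < 1 \<and> (\<forall>x. x \<notin> {p..q} \<longrightarrow> \<psi> x = 0))"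
proof safe
  assume T: "test_function \<psi>"
  then show "smooth \<psi>"
    by (simp add: test_function_def smooth_def)
  let ?C = "closure {x. \<psi> x \<noteq> 0}"
  have C: "compact ?C" "?C \<subseteq> {0<..<1}"
    using T by (auto simp: test_function_def)
  obtain p q where pq: "0 < p" "q < 1" "\<forall>x\<in>?C. p \<le> x \<and> x \<le> q"
  proof (cases "?C = {}")
    case True
    then show ?thesis using that[of "1/2" "1/2"] by auto
  next
    case False
    then show ?thesis
      using that C compact_attains_inf[OF C(1)] compact_attains_sup[OF C(1)]
      by (metis greaterThanLessThan_iff subsetD)
  qed
  \<comment> \<open>Widening the range forces p' < q' even if the support is empty.\<close>
  define p' q' where "p' = min p (1/4)" "q' = max q (3/4)"
  have "\<psi> x = 0" if "x \<notin> {p'..q'}" for x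
  proof (rule ccontr)
    assume "\<psi> x \<noteq> 0"
    then have "x \<in> ?C" by (simp add: closure_subset[THEN subsetD])
    with pq that show False by (auto simp: p'_q'_def)
  qed
  then show "\<exists>p q. 0 < p \<and> p < q \<and> q < 1 \<and> (\<forall>x. x \<notin> {p..q} \<longrightarrow> \<psi> x = 0)"
    using pq by (intro exI[of _ p'] exI[of _ q']) (auto simp: p'_q'_def)
next
  fix p q :: real
  assume "smooth \<psi>" and pq: "0 < p" "p < q" "q < 1" and z: "\<forall>x. x \<notin> {p..q} \<longrightarrow> \<psi> x = 0"
  have *: "closure {x. \<psi> x \<noteq> 0} \<subseteq> {p..q}"
    by (rule closure_minimal) (use z in auto)
  have "compact (closure {x. \<psi> x \<noteq> 0})"
    using * by (metis bounded_subset closed_closure compact_eq_bounded_closed bounded_closed_interval)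
  then show "test_function \<psi>"
    using \<open>smooth \<psi>\<close> * pq by (fastforce simp: test_function_def smooth_def)
qed

lemma test_function_deriv:
  assumes "test_function \<psi>"
  shows "test_function (deriv \<psi>)"
proof -
  obtain p q where pq: "0 < p" "p < q" "q < 1" "\<And>x. x \<notin> {p..q} \<Longrightarrow> \<psi> x = 0"
    using assms by (auto simp: test_function_iff)
  have "deriv \<psi> x = 0" if x: "x \<notin> {p..q}" for x
  proof -
    have "((\<lambda>x. 0) has_real_derivative 0) (at x)" by simp
    then have "(\<psi> has_real_derivative 0) (at x)"
      by (rule has_field_derivative_transform_within_open[where S="- {p..q}"])
         (use x pq in \<open>auto simp: open_Compl\<close>)
    then show ?thesis by (rule DERIV_imp_deriv)
  qed
  then show ?thesis
    using pq assms by (auto simp: test_function_iff smooth_deriv)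
qed

lemma test_function_has_derivative:
  "test_function \<psi> \<Longrightarrow> (\<psi> has_real_derivative deriv \<psi> x) (at x)"
  by (auto simp: test_function_iff smooth_has_derivative)

lemma test_function_continuous_on: "test_function \<psi> \<Longrightarrow> continuous_on S \<psi>"
  by (meson DERIV_continuous_on has_field_derivative_at_within test_function_has_derivative)

lemma test_function_eq_0: "test_function \<psi> \<Longrightarrow> x \<le> 0 \<or> 1 \<le> x \<Longrightarrow> \<psi> x = 0"
  by (force simp: test_function_iff)

lemma test_function_bounded:
  assumes "test_function \<psi>"
  obtains B where "\<And>x. \<bar>\<psi> x\<bar> \<le> B"
proof -
  have "compact (\<psi> ` {0..1})"
    by (intro compact_continuous_image test_function_continuous_on assms) auto
  then obtain B where "\<forall>x\<in>{0..1}. \<bar>\<psi> x\<bar> \<le> B"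
    by (auto dest!: compact_imp_bounded simp: bounded_iff)
  then have "\<bar>\<psi> x\<bar> \<le> max B 0" for x
    using test_function_eq_0[OF assms, of x] by (cases "x \<in> {0..1}") (auto simp: le_max_iff_disj)
  then show ?thesis using that by blast
qed

lemma test_function_affine:
  assumes "test_function \<rho>" "test_function \<tau>"
  shows "test_function (\<lambda>x. \<rho> x - c * \<tau> x)"
proof -
  obtain p q where pq: "0 < p" "p < q" "q < 1" "\<And>x. x \<notin> {p..q} \<Longrightarrow> \<rho> x = 0"
    using assms by (auto simp: test_function_iff)
  obtain p' q' where pq': "0 < p'" "p' < q'" "q' < 1" "\<And>x. x \<notin> {p'..q'} \<Longrightarrow> \<tau> x = 0"
    using assms by (auto simp: test_function_iff)
  have "smooth (\<lambda>x. \<rho> x + (- c) * \<tau> x)"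
    using assms by (intro smooth_intros) (auto simp: test_function_iff)
  then have "smooth (\<lambda>x. \<rho> x - c * \<tau> x)" by simp
  then show ?thesis
    unfolding test_function_iff
    using pq pq' by (intro conjI exI[of _ "min p p'"] exI[of _ "max q q'"]) (auto simp: min_def max_def)
qed

text \<open>A primitive starting left of the support is constant to its right, with the total
  integral as value; mean zero is what makes it compactly supported again.\<close>

lemma test_function_antiderivative:
  assumes \<rho>: "test_function \<rho>" and 0: "integral {0..1} \<rho> = 0"
  obtains \<psi> where "test_function \<psi>" "deriv \<psi> = \<rho>"
proof -
  obtain p q where pq: "0 < p" "p < q" "q < 1" and z: "\<And>x. x \<notin> {p..q} \<Longrightarrow> \<rho> x = 0"
    using \<rho> by (auto simp: test_function_iff)
  \<comment> \<open>The lower limit -1 keeps all of \<open>{p..q}\<close> in the interior of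
    \<open>{-1..2}\<close>, so the fundamental theorem gives two-sided derivatives there.\<close>
  define \<psi> where "\<psi> x = integral {-1..x} \<rho>" for x
  have int: "\<rho> integrable_on {u..v}" for u v
    by (intro integrable_continuous_real test_function_continuous_on \<rho>)
  have \<psi>0: "\<psi> x = 0" if "x \<notin> {p..q}" for x
  proof -
    have "\<psi> x = 0" if "x < p"
    proof -
      have "integral {-1..x} \<rho> = integral {-1..x} (\<lambda>_. 0)"
        by (rule integral_cong) (use z that in auto)
      then show ?thesis by (simp add: \<psi>_def)
    qed
    moreover have "\<psi> x = 0" if "q < x"
    proof -
      have "integral {0..1} \<rho> = integral {p..q} \<rho>"
        using pq by (intro integral_unique has_integral_on_superset[OF integrable_integral[OF int]] z) auto
      moreover have "integral {-1..x} \<rho> = integral {p..q} \<rho>"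
        using pq that by (intro integral_unique has_integral_on_superset[OF integrable_integral[OF int]] z) auto
      ultimately show ?thesis using 0 by (simp add: \<psi>_def)
    qed
    ultimately show ?thesis using that by fastforce
  qed
  have D: "(\<psi> has_real_derivative \<rho> x) (at x)" for x
  proof (cases "x \<in> {p..q}")
    case True
    have "(\<psi> has_real_derivative \<rho> x) (at x within {-1..2})"
      unfolding \<psi>_def using True pq
      by (intro integral_has_real_derivative test_function_continuous_on \<rho>) auto
    moreover have "at x within {-1..2} = at x"
      by (rule at_within_interior) (use True pq in auto)
    ultimately show ?thesis by simp
  next
    case False
    have "((\<lambda>x. 0) has_real_derivative \<rho> x) (at x)" using z False by simp
    then show ?thesis
      by (rule has_field_derivative_transform_within_open[where S="- {p..q}"])
         (use False \<psi>0 in \<open>auto simp: open_Compl\<close>)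
  qed
  note d = differentiable_on_UNIV_I[OF D]
  have "smooth \<psi>"
  proof (rule smooth_coinduct[where X="\<lambda>f. f = \<psi> \<or> smooth f"])
    show "f differentiable_on UNIV \<and> (deriv f = \<psi> \<or> smooth (deriv f))" if "f = \<psi> \<or> smooth f" for f
      using that d \<rho> by (auto simp: test_function_iff smooth_deriv intro: differentiable_on_UNIV_I smooth_has_derivative)
  qed simp
  then have "test_function \<psi>"
    using \<psi>0 pq by (auto simp: test_function_iff)
  then show ?thesis using that d by blast
qed

text \<open>Both bumps switch on at fixed points p and q and only get steeper: on (p, q) each factor
  tends to 1, outside the product is 0 for every n. The uniform bound 1 is there for dominated
  convergence.\<close>

lemma test_function_approx:
  assumes "0 < p" "p < q" "q < 1"
  obtains \<psi> :: "nat \<Rightarrow> real \<Rightarrow> real" where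
    "\<And>n. test_function (\<psi> n)" "\<And>n x. \<bar>\<psi> n x\<bar> \<le> 1"
    "\<And>x. (\<lambda>n. \<psi> n x) \<longlonglongrightarrow> indicator {p<..<q} x"
proof -
  define \<psi> where "\<psi> n x = exp_bump (real n * x + (- real n * p)) * exp_bump ((- real n) * x + real n * q)"
    for n :: nat and x
  have 0: "\<psi> n x = 0" if "x \<notin> {p<..<q}" for n x
  proof -
    have "real n * x \<le> real n * p \<or> real n * q \<le> real n * x"
      using that mult_left_mono[of x p "real n"] mult_left_mono[of q x "real n"] by auto
    then show ?thesis by (auto simp: \<psi>_def exp_bump_def)
  qed
  have "test_function (\<psi> n)" for n
    unfolding test_function_iff
  proof
    show "smooth (\<psi> n)"
      unfolding \<psi>_def by (intro smooth_intros smooth_exp_bump)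
    show "\<exists>p q. 0 < p \<and> p < q \<and> q < 1 \<and> (\<forall>x. x \<notin> {p..q} \<longrightarrow> \<psi> n x = 0)"
      using assms 0 by (intro exI[of _ p] exI[of _ q]) auto
  qed
  moreover have "\<bar>\<psi> n x\<bar> \<le> 1" for n x
    using exp_bump_bounds by (auto simp: \<psi>_def abs_mult intro!: mult_le_one)
  moreover have "(\<lambda>n. \<psi> n x) \<longlonglongrightarrow> indicator {p<..<q} x" for x
  proof (cases "x \<in> {p<..<q}")
    case True
    have *: "(\<lambda>n. exp (- inverse (c * real n))) \<longlonglongrightarrow> exp (- 0)" if "c > 0" for c
      by (intro tendsto_intros tendsto_inverse_0_at_top filterlim_tendsto_pos_mult_at_top[where c=c]
        filterlim_real_sequentially tendsto_const) (use that in auto)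
    have "(\<lambda>n. exp (- inverse ((x - p) * real n)) * exp (- inverse ((q - x) * real n))) \<longlonglongrightarrow> exp (-0) * exp (-0)"
      using True by (intro tendsto_mult *) auto
    moreover have "\<forall>\<^sub>F n in sequentially. exp (- inverse ((x - p) * real n)) * exp (- inverse ((q - x) * real n)) = \<psi> n x"
      using eventually_gt_at_top[of 0]
      by eventually_elim (use True in \<open>auto simp: \<psi>_def exp_bump_def algebra_simps\<close>)
    ultimately show ?thesis
      using True by (auto dest: Lim_transform_eventually)
  next
    case False
    then show ?thesis by (simp add: 0)
  qed
  ultimately show ?thesis using that by blast
qed

section \<open>The lemma of du Bois-Reymond\<close>

lemma unit_integrable_iff:
  fixes f :: "real \<Rightarrow> 'a::euclidean_space"
  shows "integrable unit_measure f \<longleftrightarrow> f absolutely_integrable_on {0..1}"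
  using absolutely_integrable_on_open_interval[of "0::real" "1::real" f]
  by (simp add: set_integrable_def integrable_restrict_space)

lemma unit_integral_eq:
  fixes f :: "real \<Rightarrow> 'a::euclidean_space"
  assumes "integrable unit_measure f"
  shows "(\<integral>x. f x \<partial>unit_measure) = integral {0..1} f"
  using assms by (simp add: lebesgue_integral_eq_integral integral_open_interval_real)

lemma finite_measure_unit: "finite_measure unit_measure"
  by (rule finite_measure_lebesgue_on) auto

lemma unit_continuous_integrable:
  fixes f :: "real \<Rightarrow> 'a::euclidean_space"
  assumes "continuous_on {0..1} f"
  shows "integrable unit_measure f"
  using assms by (simp add: unit_integrable_iff absolutely_integrable_continuous_real)

lemma unit_continuous_mult_integrable:
  fixes f :: "real \<Rightarrow> 'a::euclidean_space"
  assumes "integrable unit_measure f" "continuous_on {0..1} \<psi>"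
  shows "integrable unit_measure (\<lambda>x. \<psi> x *\<^sub>R f x)"
  unfolding unit_integrable_iff
proof (rule absolutely_integrable_bounded_measurable_product[of scaleR])
  show "\<psi> \<in> borel_measurable (lebesgue_on {0..1})"
    by (intro continuous_imp_measurable_on_sets_lebesgue assms) auto
  show "bilinear (scaleR :: real \<Rightarrow> 'a \<Rightarrow> 'a)"
    by (simp add: bilinear_conv_bounded_bilinear bounded_bilinear_scaleR)
  show "bounded (\<psi> ` {0..1})"
    by (intro compact_imp_bounded compact_continuous_image assms) auto
qed (use assms in \<open>auto simp: unit_integrable_iff\<close>)

lemma test_mult_integrable:
  fixes f :: "real \<Rightarrow> 'a::euclidean_space"
  assumes "integrable unit_measure f" "test_function \<psi>"
  shows "integrable unit_measure (\<lambda>x. \<psi> x *\<^sub>R f x)"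
  by (intro unit_continuous_mult_integrable assms test_function_continuous_on)

lemma AE_unit_iff:
  "(AE x in unit_measure. P x) \<longleftrightarrow> (\<exists>N. negligible N \<and> (\<forall>x\<in>{0..1} - N. P x))"
proof
  assume "AE x in unit_measure. P x"
  then have "AE x in lebesgue. x \<in> {0<..<1} \<longrightarrow> P x"
    by (simp add: AE_restrict_space_iff)
  then obtain N where N: "N \<in> null_sets lebesgue" "{x. \<not> (x \<in> {0<..<1} \<longrightarrow> P x)} \<subseteq> N"
    by (auto simp: eventually_ae_filter)
  then have "negligible (N \<union> {0,1})"
    by (intro negligible_Un) (auto simp: negligible_iff_null_sets)
  moreover have "P x" if "x \<in> {0..1} - (N \<union> {0,1})" for x
    using N(2) that by (cases "P x") (auto simp: subset_iff less_le)
  ultimately show "\<exists>N. negligible N \<and> (\<forall>x\<in>{0..1} - N. P x)" by blast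
next
  assume "\<exists>N. negligible N \<and> (\<forall>x\<in>{0..1} - N. P x)"
  then obtain N where N: "N \<in> null_sets lebesgue" "\<forall>x\<in>{0..1} - N. P x"
    by (auto simp: negligible_iff_null_sets)
  have "AE x in lebesgue. x \<in> {0<..<1} \<longrightarrow> P x"
    by (rule AE_I'[OF N(1)]) (use N(2) in auto)
  then show "AE x in unit_measure. P x"
    by (simp add: AE_restrict_space_iff)
qed

text \<open>No nonempty open set is negligible, so the points of agreement are dense, and by
  continuity they form a closed set. This is how almost everywhere identities reach the
  endpoints.\<close>

lemma AE_unit_continuous_eq:
  fixes f g :: "real \<Rightarrow> 'a::real_normed_vector"
  assumes "AE x in unit_measure. f x = g x" "continuous_on {0..1} f" "continuous_on {0..1} g" "x \<in> {0..1}"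
  shows "f x = g x"
proof -
  obtain N where N: "negligible N" "\<forall>x\<in>{0..1} - N. f x = g x"
    using assms(1) AE_unit_iff by auto
  have "{0<..<1} \<subseteq> closure ({0<..<1} - N)"
  proof
    fix y :: real assume y: "y \<in> {0<..<1}"
    show "y \<in> closure ({0<..<1} - N)"
      unfolding closure_approachable
    proof (intro allI impI)
      fix e :: real assume "e > 0"
      have "y \<in> ball y e \<inter> {0<..<1}"
        using y \<open>e > 0\<close> by simp
      then have "\<not> negligible (ball y e \<inter> {0<..<1})"
        by (intro open_not_negligible open_Int open_ball open_greaterThanLessThan) blast
      then have "\<not> ball y e \<inter> {0<..<1} \<subseteq> N"
        using N negligible_subset by blast
      then show "\<exists>z\<in>{0<..<1} - N. dist z y < e"
        by (auto simp: dist_commute subset_iff)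
    qed
  qed
  then have "closure {0<..<1} \<subseteq> closure ({0<..<1} - N)"
    by (metis closure_closure closure_mono)
  then have cl: "{0..1} \<subseteq> closure ({0<..<1} - N)" by simp
  have "closed {x\<in>{0..1}. f x - g x = 0}"
    by (intro continuous_closed_preimage_constant continuous_intros assms)
  then have "closure ({0<..<1} - N) \<subseteq> {x\<in>{0..1}. f x - g x = 0}"
    by (intro closure_minimal) (use N in auto)
  with cl assms(4) show ?thesis by auto
qed

text \<open>Approximating indicators by bounded test functions shows that \<open>g\<close> has
  integral 0 over every compact subinterval of (0,1). The pointwise conclusion comes from Lebesgue
  differentiation.\<close>

lemma du_Bois_Reymond_0:
  fixes g :: "real \<Rightarrow> 'a::euclidean_space"
  assumes g: "integrable unit_measure g"
    and 0: "\<And>\<psi>. test_function \<psi> \<Longrightarrow> (\<integral>x. \<psi> x *\<^sub>R g x \<partial>unit_measure) = 0"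
  shows "AE x in unit_measure. g x = 0"
proof -
  define g0 where "g0 x = (if x \<in> {0..1} then g x else 0)" for x
  have g1: "g integrable_on {0..1}"
    using g by (auto simp: unit_integrable_iff absolutely_integrable_on_def)
  then have "g0 integrable_on UNIV"
    unfolding g0_def by (rule integrable_restrict_UNIV[THEN iffD2])
  then have g0: "g0 integrable_on cbox u v" for u v
    by (rule integrable_on_subcbox) auto
  have int0: "integral {p..q} g0 = 0" if pq: "0 < p" "p < q" "q < 1" for p q
  proof -
    obtain \<psi> where \<psi>: "\<And>n::nat. test_function (\<psi> n)" "\<And>n x. \<bar>\<psi> n x\<bar> \<le> 1"
      "\<And>x. (\<lambda>n. \<psi> n x) \<longlonglongrightarrow> indicator {p<..<q} x"
      using test_function_approx[OF pq] by blast
    have [measurable]: "g \<in> borel_measurable unit_measure" using g by auto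
    have [measurable]: "(\<lambda>x. \<psi> n x *\<^sub>R g x) \<in> borel_measurable unit_measure" for n
      using test_mult_integrable[OF g \<psi>(1)] by auto
    have [measurable]: "indicat_real {p<..<q} \<in> borel_measurable unit_measure"
      using pq by (intro borel_measurable_indicator) (auto simp: sets_restrict_space_iff)
    have [measurable]: "(\<lambda>x. indicator {p<..<q} x *\<^sub>R g x) \<in> borel_measurable unit_measure"
      by (intro borel_measurable_scaleR) measurable
    have "(\<lambda>n. \<integral>x. \<psi> n x *\<^sub>R g x \<partial>unit_measure) \<longlonglongrightarrow> (\<integral>x. indicator {p<..<q} x *\<^sub>R g x \<partial>unit_measure)"
    proof (rule integral_dominated_convergence[where w="\<lambda>x. norm (g x)"])
      show "AE x in unit_measure. (\<lambda>n. \<psi> n x *\<^sub>R g x) \<longlonglongrightarrow> indicator {p<..<q} x *\<^sub>R g x"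
        by (intro AE_I2 tendsto_intros \<psi>)
      show "AE x in unit_measure. norm (\<psi> n x *\<^sub>R g x) \<le> norm (g x)" for n
        using \<psi>(2) by (auto intro!: mult_left_le_one_le)
    qed (use g in auto)
    then have "(\<integral>x. indicator {p<..<q} x *\<^sub>R g x \<partial>unit_measure) = 0"
      using 0[OF \<psi>(1)] by (simp add: LIMSEQ_const_iff)
    moreover have "integrable unit_measure (\<lambda>x. indicator {p<..<q} x *\<^sub>R g x)"
      by (rule Bochner_Integration.integrable_bound[OF g]) (measurable, simp add: indicator_def)
    ultimately have "integral {0..1} (\<lambda>x. indicator {p<..<q} x *\<^sub>R g x) = 0"
      by (metis unit_integral_eq)
    also have "integral {0..1} (\<lambda>x. indicator {p<..<q} x *\<^sub>R g x) = integral {0..1} (\<lambda>x. if x \<in> {p<..<q} then g0 x else 0)"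
      by (rule integral_cong) (auto simp: g0_def)
    also have "\<dots> = integral {p<..<q} g0"
      using pq by (subst integral_restrict_Int) (auto intro!: arg_cong[where f="\<lambda>S. integral S g0"])
    finally show ?thesis
      by (simp add: integral_open_interval_real)
  qed
  \<comment> \<open>Lebesgue differentiation: off a null set, \<open>g0 x\<close> is the limit of
    the means of \<open>g0\<close> over \<open>{x..x+h}\<close>, which vanish by
    \<open>int0\<close>.\<close>
  obtain N where N: "negligible N"
    "\<And>x e. \<lbrakk>x \<notin> N; 0 < e\<rbrakk> \<Longrightarrow> \<exists>d>0. \<forall>h. 0 < h \<and> h < d \<longrightarrow>
                         norm(integral (cbox x (x + h *\<^sub>R One)) g0 /\<^sub>R h ^ DIM(real) - g0 x) < e"
    using integrable_ccontinuous_explicit[OF g0] by metis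
  have "g x = 0" if "x \<in> {0..1} - (N \<union> {0,1})" for x
  proof (rule ccontr)
    assume "g x \<noteq> 0"
    then have "0 < norm (g x)" by simp
    then have "\<exists>d>0. \<forall>h. 0 < h \<and> h < d \<longrightarrow> norm(integral {x..x+h} g0 /\<^sub>R h - g0 x) < norm (g x)"
      using N(2)[of x "norm (g x)"] that by simp
    then obtain d where d: "d > 0" "\<And>h. 0 < h \<and> h < d \<Longrightarrow> norm(integral {x..x+h} g0 /\<^sub>R h - g0 x) < norm (g x)"
      by blast
    define h where "h = min (d/2) ((1 - x)/2)"
    have h: "0 < h" "h < d" "x + h < 1" using d that by (auto simp: h_def min_def field_simps)
    with d(2)[of h] int0[of x "x+h"] that show False by (simp add: g0_def)
  qed
  then show ?thesis
    unfolding AE_unit_iff using N(1) by (intro exI[of _ "N \<union> {0,1}"]) auto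
qed

lemma unit_measure_not_AE_False: "\<not> (AE x in unit_measure. False)"
  using AE_unit_continuous_eq[of "\<lambda>_. 0::real" "\<lambda>_. 1" 0] by (auto elim: eventually_mono)

text \<open>If all test functions had mean zero, \<open>du_Bois_Reymond_0\<close> would make the
  constant 1 vanish almost everywhere; so no bump has to be integrated explicitly.\<close>

lemma test_function_normalized:
  obtains \<rho> where "test_function \<rho>" "integral {0..1} \<rho> = 1"
proof -
  have "integrable unit_measure (\<lambda>_. 1::real)"
    by (intro unit_continuous_integrable continuous_intros)
  then obtain \<rho> where \<rho>: "test_function \<rho>" "(\<integral>x. \<rho> x *\<^sub>R 1 \<partial>unit_measure) \<noteq> (0::real)"
    using du_Bois_Reymond_0[of "\<lambda>_. 1::real"] unit_measure_not_AE_False by auto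
  let ?c = "integral {0..1} \<rho>"
  have c: "?c \<noteq> 0"
    using \<rho> unit_integral_eq[of \<rho>] unit_continuous_integrable[of \<rho>] test_function_continuous_on by auto
  \<comment> \<open>This is \<open>\<rho>\<close> divided by \<open>?c\<close>, written in the shape
    that \<open>test_function_affine\<close> covers.\<close>
  have "test_function (\<lambda>x. \<rho> x - (1 - 1 / ?c) * \<rho> x)"
    using \<rho> by (intro test_function_affine)
  then have "test_function (\<lambda>x. 1 / ?c * \<rho> x)" by (simp add: algebra_simps)
  moreover have "integral {0..1} (\<lambda>x. 1 / ?c * \<rho> x) = 1"
    using c by (subst integral_mult_right) simp
  ultimately show ?thesis using that by blast
qed

lemma test_function_unit_integral:
  "test_function \<rho> \<Longrightarrow> integrable unit_measure \<rho> \<and> (\<integral>x. \<rho> x \<partial>unit_measure) = integral {0..1} \<rho>"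
  using unit_integral_eq[of \<rho>] unit_continuous_integrable[of \<rho>] test_function_continuous_on by auto

text \<open>Derivatives of test functions are the test functions of mean zero, a subspace of
  codimension one; \<open>\<rho>0\<close> spans a complement.\<close>

lemma test_function_decompose:
  assumes \<rho>0: "test_function \<rho>0" "integral {0..1} \<rho>0 = 1" and \<rho>: "test_function \<rho>"
  obtains \<psi> where "test_function \<psi>" "deriv \<psi> = (\<lambda>x. \<rho> x - integral {0..1} \<rho> * \<rho>0 x)"
proof -
  let ?m = "integral {0..1} \<rho>"
  have int: "\<rho> integrable_on {0..1}" "(\<lambda>x. ?m * \<rho>0 x) integrable_on {0..1}"
    by (intro integrable_continuous_real continuous_on_mult_left test_function_continuous_on \<rho> \<rho>0(1))+
  have "integral {0..1} (\<lambda>x. \<rho> x - ?m * \<rho>0 x) = 0"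
    using \<rho>0(2) by (simp add: integral_diff[OF int])
  then show ?thesis
    using that by (rule test_function_antiderivative[OF test_function_affine[OF \<rho> \<rho>0(1)]])
qed

text \<open>Subtract from \<open>g\<close> its pairing with \<open>\<rho>0\<close>. Against any test
  function only the derivative part of the decomposition survives, and that pairs to 0 with
  \<open>g\<close>.\<close>

lemma du_Bois_Reymond_1:
  fixes g :: "real \<Rightarrow> 'a::euclidean_space"
  assumes g: "integrable unit_measure g" and \<rho>0: "test_function \<rho>0" "integral {0..1} \<rho>0 = 1"
    and 0: "\<And>\<psi>. test_function \<psi> \<Longrightarrow> (\<integral>x. deriv \<psi> x *\<^sub>R g x \<partial>unit_measure) = 0"
  shows "AE x in unit_measure. g x = (\<integral>x. \<rho>0 x *\<^sub>R g x \<partial>unit_measure)"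
proof -
  let ?c = "\<integral>x. \<rho>0 x *\<^sub>R g x \<partial>unit_measure"
  have "AE x in unit_measure. g x - ?c = 0"
  proof (rule du_Bois_Reymond_0)
    interpret finite_measure unit_measure by (rule finite_measure_unit)
    show "integrable unit_measure (\<lambda>x. g x - ?c)" using g by simp
    fix \<rho> assume \<rho>: "test_function \<rho>"
    let ?m = "integral {0..1} \<rho>"
    obtain \<psi> where \<psi>: "test_function \<psi>" "deriv \<psi> = (\<lambda>x. \<rho> x - ?m * \<rho>0 x)"
      by (rule test_function_decompose[OF \<rho>0 \<rho>])
    have "(\<integral>x. \<rho> x *\<^sub>R (g x - ?c) \<partial>unit_measure) = (\<integral>x. \<rho> x *\<^sub>R g x \<partial>unit_measure) - ?m *\<^sub>R ?c"
      using test_mult_integrable[OF g \<rho>] test_function_unit_integral[OF \<rho>]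
      by (simp add: scaleR_diff_right)
    also have "\<dots> = (\<integral>x. deriv \<psi> x *\<^sub>R g x \<partial>unit_measure)"
      using test_mult_integrable[OF g \<rho>] test_mult_integrable[OF g \<rho>0(1)]
      by (simp add: \<psi>(2) scaleR_diff_left flip: scaleR_scaleR)
    finally show "(\<integral>x. \<rho> x *\<^sub>R (g x - ?c) \<partial>unit_measure) = 0"
      by (simp only: 0[OF \<psi>(1)])
  qed
  then show ?thesis by simp
qed

lemma integral_deriv_test_function:
  assumes "test_function \<psi>"
  shows "integral {0..1} (deriv \<psi>) = 0"
proof -
  have "(deriv \<psi> has_integral \<psi> 1 - \<psi> 0) {0..1}"
    by (intro fundamental_theorem_of_calculus)
       (auto intro!: has_vector_derivative_at_within has_field_derivative_at_within test_function_has_derivative[OF assms]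
         simp flip: has_real_derivative_iff_has_vector_derivative)
  then show ?thesis
    using test_function_eq_0[OF assms] by (auto dest: integral_unique)
qed

text \<open>Reduction to first order: if \<open>c\<close> is the pairing of \<open>g\<close> with
  the derivative of \<open>\<rho>0\<close>, then \<open>g x + x *\<^sub>R c\<close> pairs to 0 with
  every first derivative, hence is constant.\<close>

lemma du_Bois_Reymond_2:
  fixes g :: "real \<Rightarrow> 'a::euclidean_space"
  assumes g: "integrable unit_measure g"
    and 0: "\<And>\<psi>. test_function \<psi> \<Longrightarrow> (\<integral>x. deriv (deriv \<psi>) x *\<^sub>R g x \<partial>unit_measure) = 0"
  obtains c e where "AE x in unit_measure. g x = e + x *\<^sub>R c"
proof -
  obtain \<rho>0 where \<rho>0: "test_function \<rho>0" "integral {0..1} \<rho>0 = 1"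
    using test_function_normalized .
  define c where "c = (\<integral>x. deriv \<rho>0 x *\<^sub>R g x \<partial>unit_measure)"
  have xc: "integrable unit_measure (\<lambda>x. x *\<^sub>R c)"
    by (intro unit_continuous_integrable continuous_intros)
  have "(\<integral>x. deriv \<rho> x *\<^sub>R (g x + x *\<^sub>R c) \<partial>unit_measure) = 0" if \<rho>: "test_function \<rho>" for \<rho>
  proof -
    let ?m = "integral {0..1} \<rho>"
    obtain \<psi> where \<psi>: "test_function \<psi>" "deriv \<psi> = (\<lambda>x. \<rho> x - ?m * \<rho>0 x)"
      by (rule test_function_decompose[OF \<rho>0 \<rho>])
    have dd: "deriv (deriv \<psi>) = (\<lambda>x. deriv \<rho> x - ?m * deriv \<rho>0 x)"
      unfolding \<psi>(2)
      by (rule differentiable_on_UNIV_I(2)) (auto intro!: derivative_eq_intros test_function_has_derivative \<rho> \<rho>0)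
    have 1: "(\<integral>x. deriv (deriv \<psi>) x *\<^sub>R g x \<partial>unit_measure) = (\<integral>x. deriv \<rho> x *\<^sub>R g x \<partial>unit_measure) - ?m *\<^sub>R c"
      using test_mult_integrable[OF g test_function_deriv[OF \<rho>]] test_mult_integrable[OF g test_function_deriv[OF \<rho>0(1)]]
      by (simp add: dd scaleR_diff_left c_def flip: scaleR_scaleR)
    \<comment> \<open>Integrating the derivative of x \<rho>(x) shows that x \<rho>'(x) has integral
      \<open>- ?m\<close>; this produces the term that cancels
      \<open>?m *\<^sub>R c\<close>.\<close>
    have "((\<lambda>x. \<rho> x + x * deriv \<rho> x) has_integral 1 * \<rho> 1 - 0 * \<rho> 0) {0..1}"
      by (intro fundamental_theorem_of_calculus)
         (auto intro!: has_vector_derivative_at_within derivative_eq_intros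
             has_field_derivative_at_within[OF test_function_has_derivative[OF \<rho>]]
           simp flip: has_real_derivative_iff_has_vector_derivative)
    then have 2: "((\<lambda>x. \<rho> x + x * deriv \<rho> x) has_integral 0) {0..1}"
      using test_function_eq_0[OF \<rho>] by simp
    have "(\<rho> has_integral ?m) {0..1}"
      by (intro integrable_integral integrable_continuous_real test_function_continuous_on \<rho>)
    from has_integral_diff[OF 2 this] have "((\<lambda>x. deriv \<rho> x * x) has_integral - ?m) {0..1}"
      by (simp add: mult.commute)
    then have "((\<lambda>x. deriv \<rho> x *\<^sub>R x *\<^sub>R c) has_integral - ?m *\<^sub>R c) {0..1}"
      by (drule_tac has_integral_scaleR_left[of _ _ _ c]) simp
    moreover have ir: "integrable unit_measure (\<lambda>x. deriv \<rho> x *\<^sub>R x *\<^sub>R c)"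
      using test_mult_integrable[OF xc test_function_deriv[OF \<rho>]] by simp
    ultimately have "(\<integral>x. deriv \<rho> x *\<^sub>R x *\<^sub>R c \<partial>unit_measure) = - ?m *\<^sub>R c"
      by (simp add: unit_integral_eq integral_unique)
    then show ?thesis
      using 1 0[OF \<psi>(1)] ir test_mult_integrable[OF g test_function_deriv[OF \<rho>]]
      by (simp add: scaleR_add_right)
  qed
  from du_Bois_Reymond_1[OF Bochner_Integration.integrable_add[OF g xc] \<rho>0 this]
  have "AE x in unit_measure. g x + x *\<^sub>R c = (\<integral>x. \<rho>0 x *\<^sub>R (g x + x *\<^sub>R c) \<partial>unit_measure)" .
  then have "AE x in unit_measure. g x = (\<integral>x. \<rho>0 x *\<^sub>R (g x + x *\<^sub>R c) \<partial>unit_measure) + x *\<^sub>R (- c)"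
    by (rule eventually_mono) (metis add_diff_cancel_right' diff_conv_add_uminus scaleR_minus_right)
  then show ?thesis by (rule that)
qed

section \<open>Generalized second derivatives as second primitives\<close>

lemma unit_integrable_imp_integrable_on:
  fixes g :: "real \<Rightarrow> 'a::euclidean_space"
  assumes "integrable unit_measure g" "0 \<le> u" "v \<le> 1"
  shows "g integrable_on {u..v}"
proof -
  have "g integrable_on {0..1}"
    using assms by (auto simp: unit_integrable_iff absolutely_integrable_on_def)
  then show ?thesis
    by (rule integrable_on_subinterval) (use assms in auto)
qed

lemma unit_integrable_truncate:
  fixes g :: "real \<Rightarrow> 'a::euclidean_space"
  assumes g: "integrable unit_measure g"
  shows "integrable unit_measure (\<lambda>t. if t < x then g t else 0)"
    and "integrable unit_measure (\<lambda>t. if x < t then g t else 0)"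
proof -
  have [measurable]: "g \<in> borel_measurable unit_measure" using g by auto
  have id[measurable]: "(\<lambda>x. x) \<in> borel_measurable unit_measure"
    by (intro continuous_imp_measurable_on_sets_lebesgue continuous_intros) auto
  have "(\<lambda>t. if t < x then g t else 0) \<in> borel_measurable unit_measure"
       "(\<lambda>t. if x < t then g t else 0) \<in> borel_measurable unit_measure"
    by measurable
  then show "integrable unit_measure (\<lambda>t. if t < x then g t else 0)"
     "integrable unit_measure (\<lambda>t. if x < t then g t else 0)"
    by (auto intro!: Bochner_Integration.integrable_bound[OF g])
qed

lemma unit_integral_truncate:
  fixes g :: "real \<Rightarrow> 'a::euclidean_space"
  assumes g: "integrable unit_measure g" and x: "x \<in> {0..1}"
  shows "(\<integral>t. (if t < x then g t else 0) \<partial>unit_measure) = integral {0..x} g"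
    and "(\<integral>t. (if x < t then g t else 0) \<partial>unit_measure) = integral {x..1} g"
proof -
  have "(\<integral>t. (if t < x then g t else 0) \<partial>unit_measure) = integral {0..1} (\<lambda>t. if t \<in> {..<x} then g t else 0)"
    using unit_integral_eq[OF unit_integrable_truncate(1)[OF g]] by simp
  also have "\<dots> = integral ({0..1} \<inter> {..<x}) g"
    by (subst integral_restrict_Int) (simp add: Int_commute)
  also have "\<dots> = integral {0..x} g"
    by (rule integral_subset_negligible) (use x in \<open>auto intro: negligible_subset[OF negligible_sing[of x]]\<close>)
  finally show "(\<integral>t. (if t < x then g t else 0) \<partial>unit_measure) = integral {0..x} g" .
  have "(\<integral>t. (if x < t then g t else 0) \<partial>unit_measure) = integral {0..1} (\<lambda>t. if t \<in> {x<..} then g t else 0)"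
    using unit_integral_eq[OF unit_integrable_truncate(2)[OF g]] by simp
  also have "\<dots> = integral ({0..1} \<inter> {x<..}) g"
    by (subst integral_restrict_Int) (simp add: Int_commute)
  also have "\<dots> = integral {x..1} g"
    by (rule integral_subset_negligible) (use x in \<open>auto intro: negligible_subset[OF negligible_sing[of x]]\<close>)
  finally show "(\<integral>t. (if x < t then g t else 0) \<partial>unit_measure) = integral {x..1} g" .
qed

lemma integral_deriv_test_function_from:
  assumes "test_function \<psi>" "t \<in> {0..1}"
  shows "integral {t..1} (deriv \<psi>) = - \<psi> t"
proof -
  have "(deriv \<psi> has_integral \<psi> 1 - \<psi> t) {t..1}"
    using assms(2) by (intro fundamental_theorem_of_calculus)
       (auto intro!: has_vector_derivative_at_within has_field_derivative_at_within test_function_has_derivative[OF assms(1)]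
         simp flip: has_real_derivative_iff_has_vector_derivative)
  then show ?thesis
    using test_function_eq_0[OF assms(1)] by (auto dest: integral_unique)
qed

text \<open>As \<open>g\<close> is only integrable, its indefinite integral need not be
  differentiable everywhere. Fubini on the triangle t < x takes the place of the product rule: the
  inner integral of \<open>deriv \<psi>\<close> from t to 1 is \<open>- \<psi> t\<close>.\<close>

lemma integral_test_function_by_parts:
  fixes g :: "real \<Rightarrow> 'a::euclidean_space"
  assumes g: "integrable unit_measure g" and \<psi>: "test_function \<psi>"
  shows "(\<integral>x. deriv \<psi> x *\<^sub>R integral {0..x} g \<partial>unit_measure) = - (\<integral>x. \<psi> x *\<^sub>R g x \<partial>unit_measure)"
proof -
  let ?U = unit_measure
  interpret finite_measure ?U by (rule finite_measure_unit)
  interpret pair_sigma_finite ?U ?U ..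
  define F where "F x t = (if t < x then deriv \<psi> x *\<^sub>R g t else 0)" for x t
  have \<psi>': "test_function (deriv \<psi>)" by (rule test_function_deriv[OF \<psi>])
  obtain B where B: "\<And>x. \<bar>deriv \<psi> x\<bar> \<le> B" by (rule test_function_bounded[OF \<psi>']) blast
  have [measurable]: "g \<in> borel_measurable ?U" using g by auto
  have [measurable]: "(\<lambda>x. x) \<in> borel_measurable ?U" "deriv \<psi> \<in> borel_measurable ?U"
    by (intro continuous_imp_measurable_on_sets_lebesgue continuous_intros test_function_continuous_on \<psi>'; simp)+
  have meas: "case_prod F \<in> borel_measurable (?U \<Otimes>\<^sub>M ?U)"
    unfolding F_def by measurable
  have "integrable (?U \<Otimes>\<^sub>M ?U) (\<lambda>z. B *\<^sub>R g (snd z))"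
    by (rule Fubini_integrable) (use g in auto)
  then have int: "integrable (?U \<Otimes>\<^sub>M ?U) (case_prod F)"
  proof (rule Bochner_Integration.integrable_bound[OF _ meas])
    have "\<bar>deriv \<psi> x\<bar> * norm (g t) \<le> \<bar>B\<bar> * norm (g t)" for x t
      using B[of x] by (intro mult_right_mono) auto
    then show "AE z in ?U \<Otimes>\<^sub>M ?U. norm (case_prod F z) \<le> norm (B *\<^sub>R g (snd z))"
      by (intro AE_I2) (auto simp: F_def)
  qed
  have "(\<integral>x. deriv \<psi> x *\<^sub>R integral {0..x} g \<partial>?U) = (\<integral>x. (\<integral>t. F x t \<partial>?U) \<partial>?U)"
  proof (rule Bochner_Integration.integral_cong[OF refl])
    fix x assume "x \<in> space ?U"
    then have "x \<in> {0..1}" by auto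
    have "(\<integral>t. F x t \<partial>?U) = (\<integral>t. deriv \<psi> x *\<^sub>R (if t < x then g t else 0) \<partial>?U)"
      by (rule Bochner_Integration.integral_cong[OF refl]) (simp add: F_def)
    then show "deriv \<psi> x *\<^sub>R integral {0..x} g = (\<integral>t. F x t \<partial>?U)"
      using unit_integral_truncate(1)[OF g \<open>x \<in> {0..1}\<close>] by simp
  qed
  also have "\<dots> = (\<integral>t. (\<integral>x. F x t \<partial>?U) \<partial>?U)"
    by (rule Fubini_integral[OF int, symmetric])
  also have "\<dots> = (\<integral>t. - (\<psi> t *\<^sub>R g t) \<partial>?U)"
  proof (rule Bochner_Integration.integral_cong[OF refl])
    fix t assume "t \<in> space ?U"
    then have t: "t \<in> {0..1}" by auto
    have i: "integrable ?U (deriv \<psi>)"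
      by (intro unit_continuous_integrable test_function_continuous_on \<psi>')
    have "(\<integral>x. F x t \<partial>?U) = (\<integral>x. (if t < x then deriv \<psi> x else 0) *\<^sub>R g t \<partial>?U)"
      by (rule Bochner_Integration.integral_cong[OF refl]) (simp add: F_def)
    also have "\<dots> = (\<integral>x. (if t < x then deriv \<psi> x else 0) \<partial>?U) *\<^sub>R g t"
      by (rule integral_scaleR_left) (rule unit_integrable_truncate(2)[OF i])
    also have "\<dots> = - (\<psi> t *\<^sub>R g t)"
      using unit_integral_truncate(2)[OF i t] integral_deriv_test_function_from[OF \<psi> t] by simp
    finally show "(\<integral>x. F x t \<partial>?U) = - (\<psi> t *\<^sub>R g t)" .
  qed
  finally show ?thesis by simp
qed

text \<open>Both \<open>u\<close> and \<open>u'\<close> are absolutely continuous and \<open>u'' = g\<close> almost everywhere.\<close>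

definition second_primitive :: "(real \<Rightarrow> 'a::euclidean_space) \<Rightarrow> (real \<Rightarrow> 'a) \<Rightarrow> (real \<Rightarrow> 'a) \<Rightarrow> bool" where
  "second_primitive u u' g \<longleftrightarrow>
     (\<forall>x\<in>{0..1}. (u has_vector_derivative u' x) (at x within {0..1}) \<and> u' x = u' 0 + integral {0..x} g)"

lemma second_primitiveD:
  assumes "second_primitive u u' g" "x \<in> {0..1}"
  shows "(u has_vector_derivative u' x) (at x within {0..1})" "u' x = u' 0 + integral {0..x} g"
  using assms unfolding second_primitive_def by blast+

lemma second_primitive_continuous:
  assumes "second_primitive u u' g" "integrable unit_measure g"
  shows "continuous_on {0..1} u" "continuous_on {0..1} u'"
proof -
  show "continuous_on {0..1} u"
    using second_primitiveD(1)[OF assms(1)] by (rule continuous_on_vector_derivative)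
  have "continuous_on {0..1} (\<lambda>x. u' 0 + integral {0..x} g)"
    by (intro continuous_intros indefinite_integral_continuous_1 unit_integrable_imp_integrable_on assms) auto
  then show "continuous_on {0..1} u'"
    by (rule continuous_on_eq) (rule second_primitiveD(2)[OF assms(1), symmetric])
qed

lemma second_primitive_exists:
  fixes g :: "real \<Rightarrow> 'a::euclidean_space"
  assumes "integrable unit_measure g"
  shows "second_primitive (\<lambda>x. e + x *\<^sub>R c + integral {0..x} (\<lambda>s. integral {0..s} g)) (\<lambda>x. c + integral {0..x} g) g"
proof -
  have "continuous_on {0..1} (\<lambda>x. integral {0..x} g)"
    by (intro indefinite_integral_continuous_1 unit_integrable_imp_integrable_on assms) auto
  then show ?thesis
    unfolding second_primitive_def
    by (auto intro!: derivative_eq_intros integral_has_vector_derivative)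
qed

text \<open>Two integrations by parts: the first is classical since \<open>u\<close> has the
  continuous derivative \<open>u'\<close>, the second is the Fubini version. The constant
  \<open>u' 0\<close> drops out because \<open>deriv \<psi>\<close> has mean zero.\<close>

lemma second_primitive_weak:
  fixes u :: "real \<Rightarrow> 'a::euclidean_space"
  assumes u: "second_primitive u u' g" and g: "integrable unit_measure g" and \<psi>: "test_function \<psi>"
  shows "(\<integral>x. deriv (deriv \<psi>) x *\<^sub>R u x \<partial>unit_measure) = (\<integral>x. \<psi> x *\<^sub>R g x \<partial>unit_measure)"
proof -
  let ?U = unit_measure
  note \<psi>' = test_function_deriv[OF \<psi>] and \<psi>'' = test_function_deriv[OF test_function_deriv[OF \<psi>]]
  have c: "integrable ?U u" "integrable ?U u'"
    using second_primitive_continuous[OF u g] unit_continuous_integrable by auto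
  have i1: "integrable ?U (\<lambda>x. deriv \<psi> x *\<^sub>R u' x)" and i2: "integrable ?U (\<lambda>x. deriv (deriv \<psi>) x *\<^sub>R u x)"
    by (intro test_mult_integrable c \<psi>' \<psi>'')+
  have G: "integrable ?U (\<lambda>x. integral {0..x} g)"
    by (intro unit_continuous_integrable indefinite_integral_continuous_1 unit_integrable_imp_integrable_on g) auto
  have "((\<lambda>x. deriv \<psi> x *\<^sub>R u' x + deriv (deriv \<psi>) x *\<^sub>R u x) has_integral
      deriv \<psi> 1 *\<^sub>R u 1 - deriv \<psi> 0 *\<^sub>R u 0) {0..1}"
    by (intro fundamental_theorem_of_calculus has_vector_derivative_scaleR second_primitiveD(1)[OF u]
        has_field_derivative_at_within[OF test_function_has_derivative[OF \<psi>']]) auto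
  then have "integral {0..1} (\<lambda>x. deriv \<psi> x *\<^sub>R u' x + deriv (deriv \<psi>) x *\<^sub>R u x) = 0"
    using test_function_eq_0[OF \<psi>'] by (simp add: integral_unique)
  then have "(\<integral>x. deriv \<psi> x *\<^sub>R u' x + deriv (deriv \<psi>) x *\<^sub>R u x \<partial>?U) = 0"
    using unit_integral_eq[OF Bochner_Integration.integrable_add[OF i1 i2]] by simp
  then have 1: "(\<integral>x. deriv (deriv \<psi>) x *\<^sub>R u x \<partial>?U) = - (\<integral>x. deriv \<psi> x *\<^sub>R u' x \<partial>?U)"
    using i1 i2 by (simp add: add_eq_0_iff)
  have "(\<integral>x. deriv \<psi> x *\<^sub>R u' x \<partial>?U) = (\<integral>x. deriv \<psi> x *\<^sub>R u' 0 + deriv \<psi> x *\<^sub>R integral {0..x} g \<partial>?U)"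
  proof (rule Bochner_Integration.integral_cong[OF refl])
    fix x assume "x \<in> space ?U"
    then show "deriv \<psi> x *\<^sub>R u' x = deriv \<psi> x *\<^sub>R u' 0 + deriv \<psi> x *\<^sub>R integral {0..x} g"
      by (subst second_primitiveD(2)[OF u]) (auto simp: scaleR_add_right)
  qed
  also have "\<dots> = (\<integral>x. deriv \<psi> x *\<^sub>R u' 0 \<partial>?U) + (\<integral>x. deriv \<psi> x *\<^sub>R integral {0..x} g \<partial>?U)"
    using test_mult_integrable[OF G \<psi>'] test_function_unit_integral[OF \<psi>']
    by (intro Bochner_Integration.integral_add integrable_scaleR_left) auto
  also have "(\<integral>x. deriv \<psi> x *\<^sub>R u' 0 \<partial>?U) = 0"
    using test_function_unit_integral[OF \<psi>'] integral_deriv_test_function[OF \<psi>] by simp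
  finally show ?thesis
    using 1 integral_test_function_by_parts[OF g \<psi>] by simp
qed

text \<open>For the converse, \<open>f\<close> minus the double primitive \<open>w\<close> of
  \<open>g\<close> has weak second derivative 0, so it is affine almost everywhere; adding this
  affine function to \<open>w\<close> gives the regular representative.\<close>

lemma is_generalized_deriv2_iff:
  assumes f: "integrable unit_measure f" and g: "integrable unit_measure g"
  shows "is_generalized_deriv2 f g \<longleftrightarrow> (\<exists>u u'. ae_eq f u \<and> second_primitive u u' g)"
proof
  assume "\<exists>u u'. ae_eq f u \<and> second_primitive u u' g"
  then obtain u u' where u: "AE x in unit_measure. f x = u x" "second_primitive u u' g"
    by (auto simp: ae_eq_def)
  have iu: "integrable unit_measure u"
    using second_primitive_continuous[OF u(2) g] unit_continuous_integrable by auto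
  have "(\<integral>x. deriv (deriv \<psi>) x *\<^sub>R f x \<partial>unit_measure) = (\<integral>x. deriv (deriv \<psi>) x *\<^sub>R u x \<partial>unit_measure)"
    if \<psi>: "test_function \<psi>" for \<psi>
  proof (rule integral_cong_AE)
    have \<psi>'': "test_function (deriv (deriv \<psi>))" using \<psi> by (intro test_function_deriv)
    show "(\<lambda>x. deriv (deriv \<psi>) x *\<^sub>R f x) \<in> borel_measurable unit_measure"
       "(\<lambda>x. deriv (deriv \<psi>) x *\<^sub>R u x) \<in> borel_measurable unit_measure"
      by (intro borel_measurable_integrable test_mult_integrable f iu \<psi>'')+
    show "AE x in unit_measure. deriv (deriv \<psi>) x *\<^sub>R f x = deriv (deriv \<psi>) x *\<^sub>R u x"
      using u(1) by (rule eventually_mono) simp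
  qed
  then show "is_generalized_deriv2 f g"
    using second_primitive_weak[OF u(2) g] by (simp add: is_generalized_deriv2_def)
next
  assume gen: "is_generalized_deriv2 f g"
  define w where "w = (\<lambda>x. integral {0..x} (\<lambda>s. integral {0..s} g))"
  have w: "second_primitive w (\<lambda>x. integral {0..x} g) g"
    using second_primitive_exists[OF g, of 0 0] by (simp add: w_def)
  have iw: "integrable unit_measure w"
    using second_primitive_continuous[OF w g] unit_continuous_integrable by auto
  have "(\<integral>x. deriv (deriv \<psi>) x *\<^sub>R (f x - w x) \<partial>unit_measure) = 0" if \<psi>: "test_function \<psi>" for \<psi>
  proof -
    have "test_function (deriv (deriv \<psi>))" using \<psi> by (intro test_function_deriv)
    then show ?thesis
      using gen \<psi> second_primitive_weak[OF w g \<psi>] test_mult_integrable[OF f] test_mult_integrable[OF iw]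
      by (simp add: scaleR_diff_right is_generalized_deriv2_def)
  qed
  then obtain c e where "AE x in unit_measure. f x - w x = e + x *\<^sub>R c"
    by (rule du_Bois_Reymond_2[OF Bochner_Integration.integrable_diff[OF f iw]])
  then have "ae_eq f (\<lambda>x. e + x *\<^sub>R c + w x)"
    unfolding ae_eq_def by (rule eventually_mono) (simp add: algebra_simps)
  then show "\<exists>u u'. ae_eq f u \<and> second_primitive u u' g"
    using second_primitive_exists[OF g, of e c] unfolding w_def by blast
qed

section \<open>Linear operations on square integrable functions and on second primitives\<close>

lemma L2_integrable:
  assumes "f \<in> L2"
  shows "integrable unit_measure f"
proof -
  interpret finite_measure unit_measure by (rule finite_measure_unit)
  show ?thesis
  proof (rule Bochner_Integration.integrable_bound)
    show "integrable unit_measure (\<lambda>x. 1 + (norm (f x))\<^sup>2)"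
      using assms by (auto simp: L2_def)
    show "f \<in> borel_measurable unit_measure" using assms by (auto simp: L2_def)
    have "norm (f x) \<le> 1 + (norm (f x))\<^sup>2" for x
      using sum_squares_bound[of "norm (f x)" 1] zero_le_power2[of "norm (f x)"] norm_ge_zero[of "f x"]
      by (simp del: norm_ge_zero)
    then show "AE x in unit_measure. norm (f x) \<le> norm (1 + (norm (f x))\<^sup>2)"
      by auto
  qed
qed

lemma L2_continuous: "continuous_on {0..1} f \<Longrightarrow> f \<in> L2"
  using unit_continuous_integrable[of f] unit_continuous_integrable[of "\<lambda>x. (norm (f x))\<^sup>2"]
  by (auto simp: L2_def continuous_on_norm continuous_on_power)

lemma L2_dominated:
  assumes "f \<in> L2" "g \<in> L2" "\<And>x. norm (k x) \<le> C * (norm (f x) + norm (g x))" "k \<in> borel_measurable unit_measure"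
  shows "k \<in> L2"
proof -
  have "integrable unit_measure (\<lambda>x. (norm (k x))\<^sup>2)"
  proof (rule Bochner_Integration.integrable_bound)
    show "integrable unit_measure (\<lambda>x. 2 * C\<^sup>2 * ((norm (f x))\<^sup>2 + (norm (g x))\<^sup>2))"
      using assms by (auto simp: L2_def)
    show "(\<lambda>x. (norm (k x))\<^sup>2) \<in> borel_measurable unit_measure" using assms by measurable
    have "(norm (k x))\<^sup>2 \<le> 2 * C\<^sup>2 * ((norm (f x))\<^sup>2 + (norm (g x))\<^sup>2)" for x
    proof -
      have "(norm (k x))\<^sup>2 \<le> (C * (norm (f x) + norm (g x)))\<^sup>2"
        using assms(3) by (intro power_mono) auto
      also have "\<dots> = C\<^sup>2 * (norm (f x) + norm (g x))\<^sup>2" by (simp add: power_mult_distrib)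
      also have "\<dots> \<le> C\<^sup>2 * (2 * ((norm (f x))\<^sup>2 + (norm (g x))\<^sup>2))"
        using sum_squares_bound[of "norm (f x)" "norm (g x)"]
        by (intro mult_left_mono) (auto simp: power2_sum)
      finally show ?thesis by (simp only: mult_ac)
    qed
    then show "AE x in unit_measure. norm ((norm (k x))\<^sup>2) \<le> norm (2 * C\<^sup>2 * ((norm (f x))\<^sup>2 + (norm (g x))\<^sup>2))"
      by (intro AE_I2) (simp add: abs_of_nonneg)
  qed
  with assms show ?thesis by (auto simp: L2_def)
qed

lemma second_primitive_linear:
  fixes T :: "'a::euclidean_space \<Rightarrow> 'b::euclidean_space"
  assumes "linear T" "second_primitive u u' g" "integrable unit_measure g"
  shows "second_primitive (\<lambda>x. T (u x)) (\<lambda>x. T (u' x)) (\<lambda>x. T (g x))"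
proof -
  have T: "bounded_linear T" using assms(1) by (simp add: linear_conv_bounded_linear)
  have "T (u' x) = T (u' 0) + integral {0..x} (\<lambda>x. T (g x))" if x: "x \<in> {0..1}" for x
  proof -
    have "integral {0..x} (T \<circ> g) = T (integral {0..x} g)"
      by (intro integral_linear T unit_integrable_imp_integrable_on assms) (use x in auto)
    then show ?thesis
      by (subst second_primitiveD(2)[OF assms(2) x]) (simp add: o_def linear_add[OF assms(1)])
  qed
  then show ?thesis
    unfolding second_primitive_def
    using second_primitiveD(1)[OF assms(2)] bounded_linear.has_vector_derivative[OF T] by blast
qed

lemma second_primitive_add:
  fixes u :: "real \<Rightarrow> 'a::euclidean_space"
  assumes "second_primitive u u' g" "second_primitive v v' h"
    and "integrable unit_measure g" "integrable unit_measure h"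
  shows "second_primitive (\<lambda>x. u x + v x) (\<lambda>x. u' x + v' x) (\<lambda>x. g x + h x)"
proof -
  have "u' x + v' x = u' 0 + v' 0 + integral {0..x} (\<lambda>x. g x + h x)" if x: "x \<in> {0..1}" for x
  proof -
    have "integral {0..x} (\<lambda>x. g x + h x) = integral {0..x} g + integral {0..x} h"
      by (intro Henstock_Kurzweil_Integration.integral_add unit_integrable_imp_integrable_on assms) (use x in auto)
    then show ?thesis
      by (subst second_primitiveD(2)[OF assms(1) x], subst second_primitiveD(2)[OF assms(2) x]) simp
  qed
  then show ?thesis
    unfolding second_primitive_def
    using second_primitiveD(1)[OF assms(1)] second_primitiveD(1)[OF assms(2)]
    by (blast intro: has_vector_derivative_add)
qed

section \<open>Spectrum and boundary value problems\<close>

lemma L2_linear: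
  assumes "linear T" "f \<in> L2"
  shows "(\<lambda>x. T (f x)) \<in> L2"
proof -
  obtain K where K: "\<And>v. norm (T v) \<le> norm v * K"
    using assms(1) by (metis bounded_linear.bounded linear_conv_bounded_linear)
  have [measurable]: "T \<in> borel_measurable borel"
    using assms(1) by (intro borel_measurable_continuous_onI linear_continuous_on) (simp add: linear_conv_bounded_linear)
  have [measurable]: "f \<in> borel_measurable unit_measure"
    using assms(2) by (auto simp: L2_def)
  show ?thesis
  proof (rule L2_dominated[OF assms(2,2), where C="\<bar>K\<bar>"])
    fix x
    have "norm (T (f x)) \<le> norm (f x) * K" by (rule K)
    also have "\<dots> \<le> norm (f x) * \<bar>K\<bar>" by (intro mult_left_mono) auto
    also have "\<dots> \<le> \<bar>K\<bar> * (norm (f x) + norm (f x))" by (simp add: algebra_simps)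
    finally show "norm (T (f x)) \<le> \<bar>K\<bar> * (norm (f x) + norm (f x))" .
  qed measurable
qed

lemma L2_add:
  assumes "f \<in> L2" "g \<in> L2"
  shows "(\<lambda>x. f x + g x) \<in> L2"
proof (rule L2_dominated[OF assms, where C=1])
  show "norm (f x + g x) \<le> 1 * (norm (f x) + norm (g x))" for x
    by (simp add: norm_triangle_ineq)
  show "(\<lambda>x. f x + g x) \<in> borel_measurable unit_measure"
    using assms by (auto simp: L2_def)
qed

lemma linear_vector_scalar_mult: "linear ((*s) (z::complex) :: complex ^ 'n \<Rightarrow> complex ^ 'n)"
  by (rule linearI) (simp_all add: vector_scalar_mult_def vec_eq_iff algebra_simps)

lemma linear_matrix_vector_mult: "linear ((*v) (A :: complex ^ 'n ^ 'm))"
  by (rule linearI)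
     (simp_all add: matrix_vector_mult_def vec_eq_iff algebra_simps sum.distrib scaleR_sum_right)

text \<open>The resolvent equation for a regular representative: boundary values are plain
  evaluations of \<open>u\<close> and \<open>u'\<close>, while the second derivative is an
  existential witness because it is fixed only up to a null set.\<close>

definition bvp_solution ::
    "complex ^ 2 ^ 2 \<Rightarrow> complex \<Rightarrow> (real \<Rightarrow> complex ^ 2) \<Rightarrow> (real \<Rightarrow> complex ^ 2) \<Rightarrow> (real \<Rightarrow> complex ^ 2) \<Rightarrow> bool" where
  "bvp_solution A z h u u' \<longleftrightarrow>
     (\<exists>g \<in> L2. second_primitive u u' g \<and> ae_eq (\<lambda>x. A *v (- g x) - z *s u x) h) \<and>
     u 0 $ 1 = 0 \<and> u 1 $ 1 = 0 \<and> u' 0 $ 2 = 0 \<and> u' 1 $ 2 = 0"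

lemma bvp_solution_continuous:
  assumes "bvp_solution A z h u u'"
  shows "continuous_on {0..1} u" "continuous_on {0..1} u'" "u \<in> L2"
  using assms second_primitive_continuous[of u u'] L2_integrable L2_continuous
  unfolding bvp_solution_def by blast+

lemma ae_eq_sym: "ae_eq f g \<Longrightarrow> ae_eq g f"
  unfolding ae_eq_def by (auto elim: eventually_mono)

lemma ae_eq_trans: "ae_eq f g \<Longrightarrow> ae_eq g h \<Longrightarrow> ae_eq f h"
  unfolding ae_eq_def by (erule (1) eventually_elim2) simp

lemma bvp_solution_diff:
  assumes "bvp_solution A z h u u'" "bvp_solution A z k v v'"
  shows "bvp_solution A z (\<lambda>x. h x - k x) (\<lambda>x. u x - v x) (\<lambda>x. u' x - v' x)"
proof -
  obtain g1 where g1: "g1 \<in> L2" "second_primitive u u' g1" "ae_eq (\<lambda>x. A *v (- g1 x) - z *s u x) h"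
    using assms(1) unfolding bvp_solution_def by blast
  obtain g2 where g2: "g2 \<in> L2" "second_primitive v v' g2" "ae_eq (\<lambda>x. A *v (- g2 x) - z *s v x) k"
    using assms(2) unfolding bvp_solution_def by blast
  have lin: "linear (uminus :: complex ^ 2 \<Rightarrow> complex ^ 2)"
    by (simp add: linear_iff)
  have g2': "(\<lambda>x. - g2 x) \<in> L2" by (rule L2_linear[OF lin g2(1)])
  have "second_primitive (\<lambda>x. u x + - v x) (\<lambda>x. u' x + - v' x) (\<lambda>x. g1 x + - g2 x)"
    by (intro second_primitive_add second_primitive_linear[OF lin] g1 g2 L2_integrable g2')
  moreover have "(\<lambda>x. g1 x + - g2 x) \<in> L2"
    by (intro L2_add g1 g2')
  moreover have "ae_eq (\<lambda>x. A *v (- (g1 x + - g2 x)) - z *s (u x + - v x)) (\<lambda>x. h x - k x)"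
    using g1(3) g2(3) unfolding ae_eq_def
  proof eventually_elim
    case (elim x)
    show ?case
      unfolding elim[symmetric]
      by (simp add: linear_diff[OF linear_matrix_vector_mult] linear_diff[OF linear_vector_scalar_mult]
        linear_neg[OF linear_matrix_vector_mult] algebra_simps del: matrix_vector_mult_diff_distrib)
  qed
  ultimately have "\<exists>g\<in>L2. second_primitive (\<lambda>x. u x - v x) (\<lambda>x. u' x - v' x) g \<and>
      ae_eq (\<lambda>x. A *v (- g x) - z *s (u x - v x)) (\<lambda>x. h x - k x)"
    by auto
  then show ?thesis
    using assms unfolding bvp_solution_def by simp
qed

lemma generalized_deriv2_works:
  assumes "f \<in> W22"
  shows "generalized_deriv2 f \<in> L2" "is_generalized_deriv2 f (generalized_deriv2 f)"
  using assms someI_ex[of "\<lambda>g. g \<in> L2 \<and> is_generalized_deriv2 f g"]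
  unfolding W22_def generalized_deriv2_def by blast+

text \<open>Two weak second derivatives have equal pairings with all test functions. This makes the
  arbitrary choice in \<open>generalized_deriv2\<close> harmless.\<close>

lemma generalized_deriv2_unique:
  assumes "g \<in> L2" "k \<in> L2" "is_generalized_deriv2 f g" "is_generalized_deriv2 f k"
  shows "ae_eq g k"
proof -
  note g = L2_integrable[OF assms(1)] and k = L2_integrable[OF assms(2)]
  have "AE x in unit_measure. g x - k x = 0"
  proof (rule du_Bois_Reymond_0)
    show "integrable unit_measure (\<lambda>x. g x - k x)" using g k by simp
    show "(\<integral>x. \<psi> x *\<^sub>R (g x - k x) \<partial>unit_measure) = 0" if "test_function \<psi>" for \<psi>
      using assms that test_mult_integrable[OF g that] test_mult_integrable[OF k that]
      by (simp add: scaleR_diff_right is_generalized_deriv2_def)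
  qed
  then show ?thesis by (simp add: ae_eq_def)
qed

text \<open>Two functions represent \<open>f\<close>: the one carrying the boundary conditions and
  the double primitive of the chosen weak derivative. Both are continuous, so they agree on the
  closed interval, and so do their one-sided derivatives at the endpoints.\<close>

lemma Dom_D_bvp_solution:
  assumes "f \<in> Dom_D" "ae_eq (\<lambda>x. AD_op A f x - z *s f x) h"
  obtains u u' where "ae_eq f u" "bvp_solution A z h u u'"
proof -
  let ?g = "generalized_deriv2 f"
  have f: "f \<in> W22" "f \<in> L2" using assms(1) by (auto simp: Dom_D_def W22_def)
  note g = generalized_deriv2_works[OF f(1)]
  note gi = L2_integrable[OF g(1)]
  obtain u u' where u: "ae_eq f u" "second_primitive u u' ?g"
    using is_generalized_deriv2_iff[OF L2_integrable[OF f(2)] gi] g(2) by blast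
  obtain v v' where v: "C1_representative f v v'" "v 0 $ 1 = 0" "v 1 $ 1 = 0" "v' 0 $ 2 = 0" "v' 1 $ 2 = 0"
    using assms(1) by (auto simp: Dom_D_def)
  have vd: "(v has_vector_derivative v' x) (at x within {0..1})" if "x \<in> {0..1}" for x
    using v(1) that by (auto simp: C1_representative_def)
  have "ae_eq u v" using u(1) v(1) by (auto simp: C1_representative_def intro: ae_eq_trans ae_eq_sym)
  then have uv: "u x = v x" if "x \<in> {0..1}" for x
    unfolding ae_eq_def
    by (rule AE_unit_continuous_eq[OF _ second_primitive_continuous(1)[OF u(2) gi] continuous_on_vector_derivative[OF vd] that])
  have uv': "u' x = v' x" if x: "x \<in> {0..1}" for x
  proof (rule vector_derivative_unique_within)
    show "at x within {0..1} \<noteq> bot" using x by (simp add: trivial_limit_within islimpt_Icc)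
    show "(u has_vector_derivative u' x) (at x within {0..1})" by (rule second_primitiveD[OF u(2) x])
    show "(u has_vector_derivative v' x) (at x within {0..1})"
      using vd[OF x] by (rule has_vector_derivative_transform[rotated 2]) (use uv x in auto)
  qed
  have "ae_eq (\<lambda>x. A *v (- ?g x) - z *s u x) h"
    using u(1) assms(2) unfolding ae_eq_def
    by eventually_elim (simp add: AD_op_def D_op_def)
  then have "bvp_solution A z h u u'"
    unfolding bvp_solution_def using g u v uv uv' by auto
  then show ?thesis using u(1) that by blast
qed

lemma bvp_solution_Dom_D:
  assumes "bvp_solution A z h u u'"
  shows "u \<in> Dom_D" "ae_eq (\<lambda>x. AD_op A u x - z *s u x) h"
proof -
  obtain g where g: "g \<in> L2" "second_primitive u u' g" "ae_eq (\<lambda>x. A *v (- g x) - z *s u x) h"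
    using assms unfolding bvp_solution_def by blast
  note gi = L2_integrable[OF g(1)] and u = bvp_solution_continuous[OF assms]
  have refl: "ae_eq u u" by (simp add: ae_eq_def)
  have gen: "is_generalized_deriv2 u g"
    using is_generalized_deriv2_iff[OF L2_integrable[OF u(3)] gi] g(2) refl by blast
  then have W: "u \<in> W22" using u(3) g(1) by (auto simp: W22_def)
  have "C1_representative u u u'"
    using refl second_primitiveD(1)[OF g(2)] u by (simp add: C1_representative_def)
  then show "u \<in> Dom_D"
    using W assms unfolding Dom_D_def bvp_solution_def by blast
  have "ae_eq g (generalized_deriv2 u)"
    using generalized_deriv2_unique gen g(1) generalized_deriv2_works[OF W] by blast
  then show "ae_eq (\<lambda>x. AD_op A u x - z *s u x) h"
    using g(3) unfolding ae_eq_def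
    by eventually_elim (simp add: AD_op_def D_op_def)
qed

lemma bvp_solution_zero: "bvp_solution A z (\<lambda>x. 0) (\<lambda>x. 0) (\<lambda>x. 0)"
  unfolding bvp_solution_def
proof (intro conjI bexI[of _ "\<lambda>x. 0"])
  show "second_primitive (\<lambda>x. 0) (\<lambda>x. 0) (\<lambda>x. 0 :: complex ^ 2)"
    by (simp add: second_primitive_def)
qed (auto simp: ae_eq_def L2_def linear_0[OF linear_vector_scalar_mult])

lemma in_Spec_if_eigenfunction:
  assumes "bvp_solution A z (\<lambda>x. 0) u u'" "x \<in> {0..1}" "u x \<noteq> 0"
  shows "z \<in> Spec Dom_D (AD_op A)"
proof (rule ccontr)
  assume "z \<notin> Spec Dom_D (AD_op A)"
  then have inj: "\<And>f g. f \<in> Dom_D \<Longrightarrow> g \<in> Dom_D \<Longrightarrow>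
     ae_eq (\<lambda>x. AD_op A f x - z *s f x) (\<lambda>x. AD_op A g x - z *s g x) \<Longrightarrow> ae_eq f g"
    by (auto simp: Spec_def resolvent_set_def Let_def)
  have "ae_eq u (\<lambda>x. 0)"
    using inj[OF bvp_solution_Dom_D(1)[OF assms(1)] bvp_solution_Dom_D(1)[OF bvp_solution_zero]]
      ae_eq_trans[OF bvp_solution_Dom_D(2)[OF assms(1)] ae_eq_sym[OF bvp_solution_Dom_D(2)[OF bvp_solution_zero]]]
    by blast
  then have "u x = 0"
    unfolding ae_eq_def
    by (rule AE_unit_continuous_eq) (use assms bvp_solution_continuous in auto)
  with assms(3) show False by simp
qed

section \<open>Norm estimates and the resolvent criterion\<close>

lemma integral_norm_le_L2_norm:
  assumes "f \<in> L2"
  shows "(\<integral>x. norm (f x) \<partial>unit_measure) \<le> L2_norm f"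
proof -
  let ?m = "\<integral>x. norm (f x) \<partial>unit_measure"
  interpret finite_measure unit_measure by (rule finite_measure_unit)
  have m1: "measure unit_measure {0<..<1} = 1"
    by (simp add: measure_restrict_space)
  have i: "integrable unit_measure (\<lambda>x. norm (f x))" "integrable unit_measure (\<lambda>x. (norm (f x))\<^sup>2)"
    using L2_integrable[OF assms] assms by (auto simp: L2_def)
  \<comment> \<open>Nonnegativity of the variance; the unit interval has total mass 1.\<close>
  have "0 \<le> (\<integral>x. (norm (f x) - ?m)\<^sup>2 \<partial>unit_measure)" by simp
  also have "\<dots> = (\<integral>x. (norm (f x))\<^sup>2 - 2 * ?m * norm (f x) + ?m\<^sup>2 \<partial>unit_measure)"
    by (simp add: power2_diff algebra_simps)
  also have "\<dots> = (\<integral>x. (norm (f x))\<^sup>2 \<partial>unit_measure) - ?m\<^sup>2"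
    using i m1 by (simp add: power2_eq_square)
  finally show ?thesis
    unfolding L2_norm_def by (intro real_le_rsqrt) simp
qed

lemma L2_norm_le_sup:
  assumes "continuous_on {0..1} u" "\<And>x. x \<in> {0..1} \<Longrightarrow> norm (u x) \<le> C"
  shows "L2_norm u \<le> C"
proof -
  interpret finite_measure unit_measure by (rule finite_measure_unit)
  have m1: "measure unit_measure {0<..<1} = 1"
    by (simp add: measure_restrict_space)
  have C: "0 \<le> C" using order_trans[OF norm_ge_zero assms(2)[of 0]] by simp
  have "(\<integral>x. (norm (u x))\<^sup>2 \<partial>unit_measure) \<le> (\<integral>x. C\<^sup>2 \<partial>unit_measure)"
    using assms by (intro integral_mono unit_continuous_integrable continuous_intros power_mono) auto
  also have "\<dots> = C\<^sup>2" using m1 by simp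
  finally show ?thesis
    unfolding L2_norm_def using C by (intro real_le_lsqrt) auto
qed

lemma L2_norm_cong: 
  assumes "ae_eq f g" "f \<in> L2" "g \<in> L2" 
  shows "L2_norm f = L2_norm g"
proof -
  have "(\<integral>x. (norm (f x))\<^sup>2 \<partial>unit_measure) = (\<integral>x. (norm (g x))\<^sup>2 \<partial>unit_measure)"
    by (rule integral_cong_AE) (use assms in \<open>auto simp: L2_def ae_eq_def elim: eventually_mono\<close>)
  then show ?thesis by (simp add: L2_norm_def)
qed

lemma AD_op_in_L2:
  assumes "f \<in> Dom_D"
  shows "(\<lambda>x. AD_op A f x - z *s f x) \<in> L2"
proof -
  have f: "f \<in> W22" "f \<in> L2" using assms by (auto simp: Dom_D_def W22_def)
  have "(\<lambda>x. A *v ((- 1) *s generalized_deriv2 f x) + (- z) *s f x) \<in> L2"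
    by (intro L2_add L2_linear[OF linear_matrix_vector_mult] L2_linear[OF linear_vector_scalar_mult]
        f generalized_deriv2_works)
  then show ?thesis by (simp add: AD_op_def D_op_def)
qed

text \<open>On a space of mass 1 the L2 norm is at most the supremum and at least the L1 norm, so a
  sup bound by the L1 norm gives a bounded inverse. Uniqueness identifies an arbitrary
  \<open>f\<close> in the domain with the solution constructed for its image, and so transfers the
  bound to \<open>f\<close>.\<close>

lemma notin_Spec_if_bvp_solvable:
  assumes ex: "\<And>h. h \<in> L2 \<Longrightarrow> \<exists>u u'. bvp_solution A z h u u' \<and>
        (\<forall>x\<in>{0..1}. norm (u x) \<le> C * (\<integral>x. norm (h x) \<partial>unit_measure))"
    and un: "\<And>u u' x. bvp_solution A z (\<lambda>x. 0) u u' \<Longrightarrow> x \<in> {0..1} \<Longrightarrow> u x = 0"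
  shows "z \<notin> Spec Dom_D (AD_op A)"
proof -
  let ?S = "\<lambda>f x. AD_op A f x - z *s f x"
  have inj: "ae_eq f g" if fg: "f \<in> Dom_D" "g \<in> Dom_D" "ae_eq (?S f) (?S g)" for f g
  proof -
    obtain u u' where u: "ae_eq f u" "bvp_solution A z (?S g) u u'"
      using Dom_D_bvp_solution fg by blast
    have "ae_eq (?S g) (?S g)" by (simp add: ae_eq_def)
    then obtain v v' where v: "ae_eq g v" "bvp_solution A z (?S g) v v'"
      using Dom_D_bvp_solution fg by blast
    have "u x - v x = 0" if "x \<in> {0..1}" for x
      using un[OF _ that, of "\<lambda>x. u x - v x"] bvp_solution_diff[OF u(2) v(2)] by auto
    then have "ae_eq u v" by (auto simp: ae_eq_def)
    then show ?thesis using u(1) v(1) ae_eq_trans ae_eq_sym by metis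
  qed
  have surj: "\<exists>f\<in>Dom_D. ae_eq (?S f) h" if "h \<in> L2" for h
    using ex[OF that] bvp_solution_Dom_D by blast
  have "L2_norm f \<le> \<bar>C\<bar> * L2_norm (?S f)" if f: "f \<in> Dom_D" for f
  proof -
    let ?h = "?S f"
    let ?m = "\<integral>x. norm (?h x) \<partial>unit_measure"
    have h: "?h \<in> L2" by (rule AD_op_in_L2[OF f])
    obtain u u' where u: "bvp_solution A z ?h u u'" "\<And>x. x\<in>{0..1} \<Longrightarrow> norm (u x) \<le> C * ?m"
      using ex[OF h] by blast
    have "ae_eq f u"
      using inj f bvp_solution_Dom_D[OF u(1)] ae_eq_sym by blast
    then have "L2_norm f = L2_norm u"
      using f bvp_solution_continuous(3)[OF u(1)] by (intro L2_norm_cong) (auto simp: Dom_D_def W22_def)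
    also have "\<dots> \<le> C * ?m"
      by (intro L2_norm_le_sup bvp_solution_continuous(1)[OF u(1)] u(2))
    also have "\<dots> \<le> \<bar>C\<bar> * ?m" by (intro mult_right_mono) auto
    also have "\<dots> \<le> \<bar>C\<bar> * L2_norm ?h" by (intro mult_left_mono integral_norm_le_L2_norm h) auto
    finally show ?thesis .
  qed
  then show ?thesis
    using inj surj unfolding Spec_def resolvent_set_def Let_def by blast
qed

section \<open>The scalar equation\<close>

lemma has_vector_derivative_sin_cos:
  fixes w :: complex
  shows "((\<lambda>x. sin (w * of_real x)) has_vector_derivative w * cos (w * of_real x)) (at x within S)"
    and "((\<lambda>x. cos (w * of_real x)) has_vector_derivative - w * sin (w * of_real x)) (at x within S)"
  by (rule has_vector_derivative_real_field; auto intro!: derivative_eq_intros)+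

lemma zero_vector_derivative_imp_const:
  fixes f :: "real \<Rightarrow> 'a::euclidean_space"
  assumes "\<And>x. x \<in> {0..1} \<Longrightarrow> (f has_vector_derivative 0) (at x within {0..1})" and x: "x \<in> {0..1}"
  shows "f x = f 0"
proof -
  have "((\<lambda>x. 0) has_integral f x - f 0) {0..x}"
    using x by (intro fundamental_theorem_of_calculus) (auto intro: has_vector_derivative_within_subset[OF assms(1)])
  then show ?thesis using has_integral_0_eq by fastforce
qed

text \<open>Cauchy data at 0 determine the solution. No Picard theorem is invoked: two explicit
  first integrals do the work.\<close>

lemma helmholtz_unique:
  fixes w :: complex
  assumes y: "second_primitive y y' g" and g: "integrable unit_measure g" and "w \<noteq> 0"
    and eq: "AE x in unit_measure. g x = - w\<^sup>2 * y x" and x: "x \<in> {0..1}"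
  shows "y x = y 0 * cos (w * of_real x) + y' 0 / w * sin (w * of_real x)"
    and "y' x = y' 0 * cos (w * of_real x) - w * y 0 * sin (w * of_real x)"
proof -
  let ?S = "\<lambda>x. sin (w * of_real x)" and ?C = "\<lambda>x. cos (w * of_real x)"
  obtain N where N: "negligible N" "\<And>x. x \<in> {0..1} - N \<Longrightarrow> g x = - w\<^sup>2 * y x"
    using eq unfolding AE_unit_iff by blast
  \<comment> \<open>Regularity gain: \<open>g\<close> agrees almost everywhere with a continuous
    multiple of \<open>y\<close>, so \<open>y'\<close> is differentiable at every point.\<close>
  have D': "(y' has_vector_derivative - w\<^sup>2 * y x) (at x within {0..1})" if x: "x \<in> {0..1}" for x
  proof -
    have "((\<lambda>x. y' 0 + integral {0..x} (\<lambda>t. - w\<^sup>2 * y t)) has_vector_derivative 0 + (- w\<^sup>2 * y x)) (at x within {0..1})"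
      by (intro has_vector_derivative_add has_vector_derivative_const integral_has_vector_derivative x
          continuous_on_mult_left second_primitive_continuous[OF y g])
    then have "((\<lambda>x. y' 0 + integral {0..x} (\<lambda>t. - w\<^sup>2 * y t)) has_vector_derivative - w\<^sup>2 * y x) (at x within {0..1})"
      by simp
    then show ?thesis
    proof (rule has_vector_derivative_transform[rotated 2])
      fix t :: real assume t: "t \<in> {0..1}"
      have "integral {0..t} g = integral {0..t} (\<lambda>t. - w\<^sup>2 * y t)"
        by (rule integral_spike[OF N(1)]) (use N(2) t in auto)
      then show "y' t = y' 0 + integral {0..t} (\<lambda>t. - w\<^sup>2 * y t)"
        by (metis second_primitiveD(2)[OF y t])
    qed (rule x)
  qed
  have D: "(y has_vector_derivative y' x) (at x within {0..1})" if x: "x \<in> {0..1}" for x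
    by (rule second_primitiveD[OF y x])
  \<comment> \<open>Applying the inverse of the fundamental matrix to (y, y') transports it back to
    0; \<open>P\<close> and \<open>Q\<close> are therefore constant, with values \<open>y 0\<close>
    and \<open>y' 0\<close>.\<close>
  define P where "P x = y x * ?C x - y' x * ?S x / w" for x
  define Q where "Q x = w * y x * ?S x + y' x * ?C x" for x
  have P: "P x = P 0"
  proof (rule zero_vector_derivative_imp_const[OF _ x])
    fix x :: real assume x: "x \<in> {0..1}"
    show "(P has_vector_derivative 0) (at x within {0..1})"
      unfolding P_def using \<open>w \<noteq> 0\<close>
      by (auto intro!: derivative_eq_intros has_vector_derivative_sin_cos D[OF x] D'[OF x]
          has_vector_derivative_divide simp: field_simps power2_eq_square)
  qed
  have Q: "Q x = Q 0"
  proof (rule zero_vector_derivative_imp_const[OF _ x])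
    fix x :: real assume x: "x \<in> {0..1}"
    show "(Q has_vector_derivative 0) (at x within {0..1})"
      unfolding Q_def
      by (auto intro!: derivative_eq_intros has_vector_derivative_sin_cos D[OF x] D'[OF x]
          simp: field_simps power2_eq_square)
  qed
  have sc: "?C x * ?C x = 1 - ?S x * ?S x"
    using sin_cos_squared_add[of "w * of_real x"] by (simp add: power2_eq_square algebra_simps)
  have "P x * ?C x + Q x / w * ?S x = y x * (?C x * ?C x) + y x * (?S x * ?S x)"
    using \<open>w \<noteq> 0\<close> by (simp add: P_def Q_def field_simps)
  then have "y x = P x * ?C x + Q x / w * ?S x"
    by (simp add: sc algebra_simps)
  then show "y x = y 0 * ?C x + y' 0 / w * ?S x"
    unfolding P Q by (simp add: P_def Q_def)
  have "Q x * ?C x - w * P x * ?S x = y' x * (?C x * ?C x) + y' x * (?S x * ?S x)"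
    using \<open>w \<noteq> 0\<close> by (simp add: P_def Q_def field_simps)
  then have "y' x = Q x * ?C x - w * P x * ?S x"
    by (simp add: sc algebra_simps)
  then show "y' x = y' 0 * ?C x - w * y 0 * ?S x"
    unfolding P Q by (simp add: P_def Q_def)
qed

lemma second_primitive_C2:
  fixes y :: "real \<Rightarrow> 'a::euclidean_space"
  assumes "\<And>x. x \<in> {0..1} \<Longrightarrow> (y has_vector_derivative y' x) (at x within {0..1})"
    and "\<And>x. x \<in> {0..1} \<Longrightarrow> (y' has_vector_derivative g x) (at x within {0..1})"
  shows "second_primitive y y' g"
proof -
  have "y' x = y' 0 + integral {0..x} g" if x: "x \<in> {0..1}" for x
  proof -
    have "(g has_integral y' x - y' 0) {0..x}"
      using x by (intro fundamental_theorem_of_calculus) (auto intro: has_vector_derivative_within_subset[OF assms(2)])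
    then show ?thesis by (simp add: integral_unique)
  qed
  then show ?thesis
    using assms(1) unfolding second_primitive_def by blast
qed

lemma second_primitive_sin_cos:
  fixes w :: complex
  shows "second_primitive (\<lambda>x. A * cos (w * of_real x) + B * sin (w * of_real x))
     (\<lambda>x. - A * w * sin (w * of_real x) + B * w * cos (w * of_real x))
     (\<lambda>x. - w\<^sup>2 * (A * cos (w * of_real x) + B * sin (w * of_real x)))"
  by (rule second_primitive_C2)
     (auto intro!: derivative_eq_intros has_vector_derivative_sin_cos simp: algebra_simps power2_eq_square)

lemma norm_integral_le:
  fixes g :: "real \<Rightarrow> 'a::euclidean_space"
  assumes g: "integrable unit_measure g" and x: "x \<in> {0..1}"
  shows "norm (integral {0..x} g) \<le> (\<integral>t. norm (g t) \<partial>unit_measure)"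
proof -
  have "norm (integral {0..x} g) = norm (\<integral>t. (if t < x then g t else 0) \<partial>unit_measure)"
    by (simp add: unit_integral_truncate(1)[OF g x])
  also have "\<dots> \<le> (\<integral>t. norm (if t < x then g t else 0) \<partial>unit_measure)"
    by (rule integral_norm_bound)
  also have "\<dots> \<le> (\<integral>t. norm (g t) \<partial>unit_measure)"
    using unit_integrable_truncate(1)[OF g, of x] g by (intro integral_mono) auto
  finally show ?thesis .
qed

lemma norm_integral_le_sup:
  fixes g :: "real \<Rightarrow> 'a::euclidean_space"
  assumes "continuous_on {0..1} g" "\<And>t. t \<in> {0..1} \<Longrightarrow> norm (g t) \<le> B" and x: "x \<in> {0..1}"
  shows "norm (integral {0..x} g) \<le> B"
proof -
  have "norm (integral {0..x} g) \<le> B * (x - 0)"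
    using x assms by (intro integral_bound) (auto intro: continuous_on_subset)
  also have "\<dots> \<le> B"
    using x order_trans[OF norm_ge_zero assms(2)[of 0]] by (auto intro: mult_left_le)
  finally show ?thesis .
qed

lemma sin_cos_mult_bounded:
  fixes w :: complex
  obtains E where "E > 0" "\<And>x. x \<in> {0..1} \<Longrightarrow> norm (sin (w * of_real x)) \<le> E"
    "\<And>x. x \<in> {0..1} \<Longrightarrow> norm (cos (w * of_real x)) \<le> E"
proof -
  have "compact ((\<lambda>x::real. (sin (w * of_real x), cos (w * of_real x))) ` {0..1})"
    by (intro compact_continuous_image continuous_intros) auto
  then obtain E where E: "\<forall>x\<in>{0..1}. norm (sin (w * of_real x), cos (w * of_real x)) \<le> E"
    by (auto dest!: compact_imp_bounded simp: bounded_iff)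
  have "norm (sin (w * of_real x)) \<le> \<bar>E\<bar> + 1" "norm (cos (w * of_real x)) \<le> \<bar>E\<bar> + 1"
    if "x \<in> {0..1}" for x
    using E that norm_fst_le[of "sin (w * of_real x)" "cos (w * of_real x)"]
      norm_snd_le[of "cos (w * of_real x)" "sin (w * of_real x)"] by fastforce+
  then show ?thesis using that[of "\<bar>E\<bar> + 1"] by force
qed

text \<open>Variation of constants with an integrable \<open>k\<close> would not be differentiable
  at every point. So the double primitive \<open>H2\<close> of \<open>k\<close> is split off first;
  the remainder \<open>Q\<close> solves the equation with the continuous right side - w^2
  \<open>H2\<close>, where the classical formula applies.\<close>

lemma helmholtz_particular:
  fixes w :: complex
  assumes "w \<noteq> 0"
  obtains C where "\<And>k :: real \<Rightarrow> complex. integrable unit_measure k \<Longrightarrow>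
    \<exists>y y'. second_primitive y y' (\<lambda>x. k x - w\<^sup>2 * y x) \<and> y 0 = 0 \<and> y' 0 = 0 \<and>
      (\<forall>x\<in>{0..1}. norm (y x) \<le> C * (\<integral>t. norm (k t) \<partial>unit_measure) \<and>
                  norm (y' x) \<le> C * (\<integral>t. norm (k t) \<partial>unit_measure))"
proof -
  let ?S = "\<lambda>x. sin (w * of_real x)" and ?C = "\<lambda>x. cos (w * of_real x)"
  obtain E where E: "E > 0" "\<And>x. x \<in> {0..1} \<Longrightarrow> norm (?S x) \<le> E" "\<And>x. x \<in> {0..1} \<Longrightarrow> norm (?C x) \<le> E"
    using sin_cos_mult_bounded[of w] by blast
  \<comment> \<open>\<open>IC\<close> and \<open>IS\<close> will be at most E |w|^2 times the L1
    norm of \<open>k\<close>, and each enters \<open>Q'\<close> with a factor at most E.\<close>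
  define W where "W = 2 * (E * (E * (norm w)\<^sup>2))"
  have W0: "W \<ge> 0" using E by (auto simp: W_def)
  define C where "C = 1 + W / norm w + W"
  have "\<exists>y y'. second_primitive y y' (\<lambda>x. k x - w\<^sup>2 * y x) \<and> y 0 = 0 \<and> y' 0 = 0 \<and>
      (\<forall>x\<in>{0..1}. norm (y x) \<le> C * (\<integral>t. norm (k t) \<partial>unit_measure) \<and>
                  norm (y' x) \<le> C * (\<integral>t. norm (k t) \<partial>unit_measure))"
    if k: "integrable unit_measure k" for k :: "real \<Rightarrow> complex"
  proof -
    let ?m = "\<integral>t. norm (k t) \<partial>unit_measure"
    have m0: "?m \<ge> 0" by simp
    define H1 where "H1 x = integral {0..x} k" for x
    define H2 where "H2 x = integral {0..x} H1" for x
    have H: "second_primitive H2 H1 k"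
      using second_primitive_exists[OF k, of 0 0] by (simp add: H1_def[abs_def] H2_def[abs_def])
    note Hc = second_primitive_continuous[OF H k]
    have H1: "norm (H1 x) \<le> ?m" if "x \<in> {0..1}" for x
      unfolding H1_def by (rule norm_integral_le[OF k that])
    have H2: "norm (H2 x) \<le> ?m" if "x \<in> {0..1}" for x
      unfolding H2_def by (rule norm_integral_le_sup[OF Hc(2) H1 that])
    define q where "q x = - w\<^sup>2 * H2 x" for x
    have qc: "continuous_on {0..1} q" unfolding q_def by (intro continuous_intros Hc)
    have q: "norm (q x) \<le> (norm w)\<^sup>2 * ?m" if "x \<in> {0..1}" for x
      using H2[OF that] by (auto simp: q_def norm_mult norm_power intro!: mult_left_mono)
    define IC where "IC x = integral {0..x} (\<lambda>t. ?C t * q t)" for x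
    define IS where "IS x = integral {0..x} (\<lambda>t. ?S t * q t)" for x
    have Cc: "continuous_on {0..1} (\<lambda>t. ?C t * q t)" and Sc: "continuous_on {0..1} (\<lambda>t. ?S t * q t)"
      by (intro continuous_intros qc)+
    let ?B = "E * ((norm w)\<^sup>2 * ?m)"
    have IC: "norm (IC x) \<le> ?B" if "x \<in> {0..1}" for x
      unfolding IC_def using E(1) by (intro norm_integral_le_sup Cc that)
         (auto simp: norm_mult intro!: mult_mono E q)
    have IS: "norm (IS x) \<le> ?B" if "x \<in> {0..1}" for x
      unfolding IS_def using E(1) by (intro norm_integral_le_sup Sc that)
         (auto simp: norm_mult intro!: mult_mono E q)
    have DC: "(IC has_vector_derivative ?C x * q x) (at x within {0..1})" if "x \<in> {0..1}" for x
      unfolding IC_def by (rule integral_has_vector_derivative[OF Cc that])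
    have DS: "(IS has_vector_derivative ?S x * q x) (at x within {0..1})" if "x \<in> {0..1}" for x
      unfolding IS_def by (rule integral_has_vector_derivative[OF Sc that])
    \<comment> \<open>The integral of sin(w (x - t)) q(t) / w over t from 0 to x, expanded by the
      addition theorem so that x leaves the integrand.\<close>
    define Q where "Q x = 1 / w * (?S x * IC x - ?C x * IS x)" for x
    define Q' where "Q' x = ?C x * IC x + ?S x * IS x" for x
    have sc: "?C x * ?C x = 1 - ?S x * ?S x" for x
      using sin_cos_squared_add[of "w * of_real x"] by (simp add: power2_eq_square algebra_simps)
    have Q: "second_primitive Q Q' (\<lambda>x. q x - w\<^sup>2 * Q x)"
    proof (rule second_primitive_C2)
      fix x :: real assume x: "x \<in> {0..1}"
      have 1: "1 / w * ((?S x * (?C x * q x) + w * ?C x * IC x) - (?C x * (?S x * q x) + - w * ?S x * IS x)) = Q' x"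
        using assms by (simp add: Q'_def field_simps)
      show "(Q has_vector_derivative Q' x) (at x within {0..1})"
        unfolding Q_def 1[symmetric]
        by (intro has_vector_derivative_mult_right has_vector_derivative_diff has_vector_derivative_mult
            has_vector_derivative_sin_cos DC DS x)
      have "(?C x * (?C x * q x) + - w * ?S x * IC x) + (?S x * (?S x * q x) + w * ?C x * IS x)
          = (?C x * ?C x) * q x + (?S x * ?S x) * q x - w\<^sup>2 * Q x"
        using assms by (simp add: Q_def field_simps power2_eq_square)
      then have 2: "(?C x * (?C x * q x) + - w * ?S x * IC x) + (?S x * (?S x * q x) + w * ?C x * IS x) = q x - w\<^sup>2 * Q x"
        by (simp add: sc algebra_simps)
      show "(Q' has_vector_derivative q x - w\<^sup>2 * Q x) (at x within {0..1})"
        unfolding Q'_def 2[symmetric]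
        by (intro has_vector_derivative_add has_vector_derivative_mult
            has_vector_derivative_sin_cos DC DS x)
    qed
    have 2: "norm (Q' x) \<le> W * ?m" if x: "x \<in> {0..1}" for x
    proof -
      have "norm (Q' x) \<le> norm (?C x) * norm (IC x) + norm (?S x) * norm (IS x)"
        unfolding Q'_def by (metis norm_mult norm_triangle_ineq)
      also have "\<dots> \<le> E * ?B + E * ?B"
        using E(1) by (intro add_mono mult_mono E x IC IS) auto
      also have "\<dots> = W * ?m" by (simp add: W_def)
      finally show ?thesis .
    qed
    have 1: "norm (Q x) \<le> W / norm w * ?m" if x: "x \<in> {0..1}" for x
    proof -
      have "norm (Q x) = 1 / norm w * norm (?S x * IC x - ?C x * IS x)"
        unfolding Q_def by (simp add: norm_mult norm_divide)
      also have "\<dots> \<le> 1 / norm w * (norm (?S x) * norm (IC x) + norm (?C x) * norm (IS x))"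
        by (intro mult_left_mono) (metis norm_mult norm_triangle_ineq4, simp)
      also have "\<dots> \<le> 1 / norm w * (E * ?B + E * ?B)"
        using E(1) by (intro mult_left_mono add_mono mult_mono E x IC IS) auto
      also have "\<dots> = W / norm w * ?m" by (simp add: W_def)
      finally show ?thesis .
    qed
    define y where "y x = H2 x + Q x" for x
    define y' where "y' x = H1 x + Q' x" for x
    have "integrable unit_measure (\<lambda>x. q x - w\<^sup>2 * Q x)"
      using second_primitiveD(1)[OF Q]
      by (intro unit_continuous_integrable continuous_on_diff qc continuous_on_mult_left continuous_on_vector_derivative)
    then have "second_primitive y y' (\<lambda>x. k x + (q x - w\<^sup>2 * Q x))"
      unfolding y_def y'_def by (intro second_primitive_add H Q k)
    moreover have "(\<lambda>x. k x + (q x - w\<^sup>2 * Q x)) = (\<lambda>x. k x - w\<^sup>2 * y x)"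
      by (simp add: q_def y_def algebra_simps)
    moreover have "y 0 = 0" "y' 0 = 0"
      by (simp_all add: y_def y'_def H1_def H2_def Q_def Q'_def IC_def IS_def)
    moreover have "norm (y x) \<le> C * ?m \<and> norm (y' x) \<le> C * ?m" if x: "x \<in> {0..1}" for x
    proof
      have "norm (y x) \<le> ?m + W / norm w * ?m"
        unfolding y_def by (rule norm_triangle_le) (use H2 1 x in \<open>auto intro: add_mono\<close>)
      also have "\<dots> \<le> C * ?m"
        using W0 m0 by (simp add: C_def algebra_simps)
      finally show "norm (y x) \<le> C * ?m" .
      have "norm (y' x) \<le> ?m + W * ?m"
        unfolding y'_def by (rule norm_triangle_le) (use H1 2 x in \<open>auto intro: add_mono\<close>)
      also have "\<dots> \<le> C * ?m"
        using W0 m0 by (simp add: C_def algebra_simps)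
      finally show "norm (y' x) \<le> C * ?m" .
    qed
    ultimately show ?thesis by (intro exI[of _ y] exI[of _ y']) simp
  qed
  then show ?thesis by (rule that)
qed

section \<open>Zeros of a trigonometric equation\<close>

lemma exp_mult_real_tendsto_0:
  fixes u :: complex
  assumes "Re u < 0"
  shows "(\<lambda>n. exp (of_nat n * u)) \<longlonglongrightarrow> 0"
proof -
  have "(\<lambda>n. exp u ^ n) \<longlonglongrightarrow> 0"
    using assms by (intro LIMSEQ_power_zero) simp
  then show ?thesis by (simp add: exp_of_nat_mult)
qed

lemma uniform_limit_exp_perturbation:
  fixes \<alpha> \<beta> c :: complex and K :: "complex set"
  assumes "Re u < 0" "Re v < 0" "compact K"
  shows "uniform_limit K (\<lambda>n z. c * exp (\<alpha> * z) * exp (of_nat n * u) + d * exp (\<beta> * z) * exp (of_nat n * v) + L z)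
     L sequentially"
proof -
  have b: "bounded ((\<lambda>z. e * exp (\<gamma> * z)) ` K)" for e \<gamma>
    by (intro compact_imp_bounded compact_continuous_image continuous_intros assms)
  have mult: "uniform_limit K (\<lambda>n z. (e * exp (\<gamma> * z)) * exp (of_nat n * w)) (\<lambda>z. (e * exp (\<gamma> * z)) * 0) sequentially"
    if "Re w < 0" for e \<gamma> w :: complex
  proof (rule uniform_lim_mult[OF uniform_limit_const _ b])
    show "uniform_limit K (\<lambda>n z. exp (of_nat n * w)) (\<lambda>z. 0) sequentially"
      by (rule uniform_limitI) (use tendstoD[OF exp_mult_real_tendsto_0[OF that]] in auto)
  qed (auto intro: bounded_subset[of "{0}"])
  moreover have "uniform_limit K (\<lambda>n. L) L sequentially" by (rule uniform_limit_const)
  ultimately have "uniform_limit K (\<lambda>n z. c * exp (\<alpha> * z) * exp (of_nat n * u) + d * exp (\<beta> * z) * exp (of_nat n * v) + L z)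
     (\<lambda>z. c * exp (\<alpha> * z) * 0 + d * exp (\<beta> * z) * 0 + L z) sequentially"
    by (intro uniform_limit_add mult assms)
  then show ?thesis by simp
qed

text \<open>
  For large \<open>z\<close> in the open first quadrant, \<open>c sin(\<alpha>z) = sinh(\<beta>z)\<close> is a small perturbation of
  \<open>\<i>c exp(-\<i>\<alpha>z) = exp(\<beta>z)\<close>, whose solutions form an arithmetic progression in that quadrant.
  Hurwitz' theorem transfers its zeros.
\<close>

lemma infinite_zeros_sin_sinh:
  fixes \<alpha> \<beta> c :: real
  assumes pos: "\<alpha> > 0" "\<beta> > 0" "c > 0"
  shows "infinite {z :: complex. of_real c * sin (of_real \<alpha> * z) = sinh (of_real \<beta> * z)}"
proof
  define G where "G z = of_real c * sin (of_real \<alpha> * z) - sinh (of_real \<beta> * z)" for z :: complex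
  define \<omega> where "\<omega> = Complex \<beta> \<alpha>"
  define r where "r = 2 * pi / (\<alpha> * \<alpha> + \<beta> * \<beta>)"
  \<comment> \<open>T = 2 pi i / \<omega> is a period of exp(-\<omega>z), and it points into the
    open first quadrant.\<close>
  define T where "T = Complex (r * \<alpha>) (r * \<beta>)"
  have "\<alpha> * \<alpha> + \<beta> * \<beta> > 0" using pos by (intro add_pos_pos mult_pos_pos)
  then have r: "r * (\<alpha> * \<alpha> + \<beta> * \<beta>) = 2 * pi" "r > 0"
    using pos by (simp_all add: r_def)
  have T: "\<omega> * T = 2 * of_real pi * \<i>"
    using r(1) by (simp add: \<omega>_def T_def complex_eq_iff algebra_simps)
  \<comment> \<open>After division by exp(\<beta>z), translation by T multiplies the two subordinate
    exponentials by exp(u) and exp(v), both of modulus below 1.\<close>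
  define u where "u = (\<i> * of_real \<alpha> - of_real \<beta>) * T"
  define v where "v = - 2 * of_real \<beta> * T"
  have uv: "Re u < 0" "Re v < 0"
    using pos r(2) by (simp_all add: u_def v_def T_def)
  \<comment> \<open>The part of G(z) exp(-\<beta>z) that is invariant under translation by T, hence
    the limit of the translates \<open>F n\<close>.\<close>
  define L where "L z = \<i> * of_real c / 2 * exp (- \<omega> * z) - 1 / 2" for z :: complex
  define F where "F n z = G (z + of_nat n * T) * exp (- of_real \<beta> * (z + of_nat n * T))" for n z
  have F: "F n z = - \<i> * of_real c / 2 * exp ((\<i> * of_real \<alpha> - of_real \<beta>) * z) * exp (of_nat n * u)
      + 1 / 2 * exp (- 2 * of_real \<beta> * z) * exp (of_nat n * v) + L z" for n z
  proof -
    let ?z = "z + of_nat n * T"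
    have i: "1 / (2 * \<i>) = - \<i> / 2" by (simp add: field_simps)
    have "F n z = - \<i> * of_real c / 2 * (exp (\<i> * (of_real \<alpha> * ?z)) * exp (- of_real \<beta> * ?z))
        + \<i> * of_real c / 2 * (exp (- (\<i> * (of_real \<alpha> * ?z))) * exp (- of_real \<beta> * ?z))
        - (exp (of_real \<beta> * ?z) * exp (- of_real \<beta> * ?z)) / 2 + (exp (- (of_real \<beta> * ?z)) * exp (- of_real \<beta> * ?z)) / 2"
      unfolding F_def G_def by (simp add: sin_exp_eq sinh_field_def field_simps)
    also have "\<dots> = - \<i> * of_real c / 2 * exp (\<i> * (of_real \<alpha> * ?z) + (- of_real \<beta> * ?z))
        + \<i> * of_real c / 2 * exp (- (\<i> * (of_real \<alpha> * ?z)) + (- of_real \<beta> * ?z))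
        - exp (of_real \<beta> * ?z + (- of_real \<beta> * ?z)) / 2 + exp (- (of_real \<beta> * ?z) + (- of_real \<beta> * ?z)) / 2"
      by (simp only: exp_add)
    also have "\<i> * (of_real \<alpha> * ?z) + (- of_real \<beta> * ?z) = (\<i> * of_real \<alpha> - of_real \<beta>) * z + of_nat n * u"
      by (simp add: u_def algebra_simps)
    also have "- (\<i> * (of_real \<alpha> * ?z)) + (- of_real \<beta> * ?z) = - \<omega> * z - of_nat n * (\<omega> * T)"
      by (simp add: \<omega>_def Complex_eq algebra_simps)
    also have "- (of_real \<beta> * ?z) + (- of_real \<beta> * ?z) = - 2 * of_real \<beta> * z + of_nat n * v"
      by (simp add: v_def algebra_simps)
    also have "of_real \<beta> * ?z + (- of_real \<beta> * ?z) = 0" by simp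
    also have "exp (- \<omega> * z - of_nat n * (\<omega> * T)) = exp (- \<omega> * z)"
    proof -
      have "exp (of_nat n * (2 * of_real pi * \<i>)) = (1::complex)"
        by (simp add: exp_of_nat_mult)
      then show ?thesis by (simp add: exp_diff T)
    qed
    finally show ?thesis
      by (simp only: L_def exp_add) (simp add: algebra_simps)
  qed
  assume "finite {z :: complex. of_real c * sin (of_real \<alpha> * z) = sinh (of_real \<beta> * z)}"
  then have "finite {z. G z = 0}" by (simp add: G_def)
  then obtain R where R: "\<And>z. G z = 0 \<Longrightarrow> norm z \<le> R"
    by (meson bounded_iff finite_imp_bounded mem_Collect_eq)
  have \<omega>0: "\<omega> \<noteq> 0" using pos by (simp add: \<omega>_def complex_eq_iff)
  have T0: "norm T > 0" using T by auto
  \<comment> \<open>A zero of \<open>L\<close>: here exp(-\<omega>z0) = 1/(ic).\<close>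
  define z0 where "z0 = - Ln (1 / (\<i> * of_real c)) / \<omega>"
  \<comment> \<open>From the m-th translate on, the unit ball about \<open>z0\<close> has left the
    disc of radius R that holds all zeros of G.\<close>
  obtain m where m: "real m * norm T > R + norm z0 + 1"
    using reals_Archimedean3[OF T0] by blast
  have nz: "F (n + m) z \<noteq> 0" if z: "z \<in> ball z0 1" for n z
  proof
    assume "F (n + m) z = 0"
    then have "norm (z + of_nat (n + m) * T) \<le> R" using R by (simp add: F_def)
    moreover have "real m * norm T \<le> norm (of_nat (n + m) * T)"
      by (simp only: norm_mult norm_of_nat) (auto intro: mult_right_mono)
    moreover have "norm (of_nat (n + m) * T) \<le> norm (z + of_nat (n + m) * T) + norm z"
      by (metis add_diff_cancel_left' norm_triangle_ineq4)
    moreover have "norm z \<le> norm z0 + 1"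
      using z norm_triangle_sub[of z z0] by (simp add: dist_norm norm_minus_commute)
    ultimately show False using m by linarith
  qed
  \<comment> \<open>A nonconstant locally uniform limit of zero-free functions is zero-free, which
    contradicts the choice of \<open>z0\<close>.\<close>
  have "L z0 \<noteq> 0"
  proof (rule Hurwitz_no_zeros[where S="ball z0 1" and \<F>="\<lambda>n. F (n + m)" and g=L and ?z0.0=z0])
    show "F (n + m) holomorphic_on ball z0 1" for n
      unfolding F L_def by (intro holomorphic_intros)
    show "L holomorphic_on ball z0 1"
      unfolding L_def by (intro holomorphic_intros) auto
    show "uniform_limit K (\<lambda>n. F (n + m)) L sequentially" if "compact K" "K \<subseteq> ball z0 1" for K
    proof -
      have "uniform_limit K F L sequentially"
        using uniform_limit_exp_perturbation[OF uv that(1), of "- \<i> * of_real c / 2" "\<i> * of_real \<alpha> - of_real \<beta>" "1/2" "- 2 * of_real \<beta>" L]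
        unfolding F[abs_def] .
      then show ?thesis
        by (rule filterlim_compose) (rule filterlim_add_const_nat_at_top)
    qed
    show "\<not> L constant_on ball z0 1"
    proof
      assume "L constant_on ball z0 1"
      then obtain k where k: "\<And>z. z \<in> ball z0 1 \<Longrightarrow> L z = k" by (auto simp: constant_on_def)
      have "((\<lambda>_. k) has_field_derivative 0) (at z0)" by simp
      then have "(L has_field_derivative 0) (at z0)"
        by (rule has_field_derivative_transform_within_open[where S="ball z0 1"]) (use k in auto)
      then have "(deriv L) z0 = 0" by (rule DERIV_imp_deriv)
      moreover have "(L has_field_derivative - \<omega> * (\<i> * of_real c / 2 * exp (- \<omega> * z0))) (at z0)"
        unfolding L_def by (auto intro!: derivative_eq_intros)
      ultimately show False
        using DERIV_imp_deriv \<omega>0 pos by fastforce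
    qed
  qed (use nz in auto)
  moreover have "L z0 = 0"
    using \<omega>0 pos by (simp add: L_def z0_def exp_Ln field_simps)
  ultimately show False by simp
qed

lemma sinh_complex_of_real: "sinh (complex_of_real x) = of_real (sinh x)"
  by (simp add: sinh_field_def flip: exp_of_real of_real_minus)

text \<open>A nonconstant entire function has finitely many zeros in a compact set. It is
  nonconstant because at pi/\<alpha> the sine vanishes as it does at 0, whereas the hyperbolic sine
  does not.\<close>

lemma finite_bounded_zeros_sin_sinh:
  fixes \<alpha> \<beta> :: real and a b :: complex
  assumes "\<alpha> \<noteq> 0" "\<beta> \<noteq> 0" "b \<noteq> 0" "bounded S"
  shows "finite {z\<in>S. a * (sin (of_real \<alpha> * z))\<^sup>2 = b * (sinh (of_real \<beta> * z))\<^sup>2}"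
proof -
  let ?f = "\<lambda>z. a * (sin (of_real \<alpha> * z))\<^sup>2 - b * (sinh (of_real \<beta> * z))\<^sup>2"
  have D: "(?f has_field_derivative a * (2 * sin (of_real \<alpha> * z) * (cos (of_real \<alpha> * z) * of_real \<alpha>))
      - b * (2 * sinh (of_real \<beta> * z) * (cosh (of_real \<beta> * z) * of_real \<beta>))) (at z)" for z
    by (auto intro!: derivative_eq_intros)
  have "\<not> ?f constant_on UNIV"
  proof
    assume "?f constant_on UNIV"
    then obtain k where "\<And>z. ?f z = k" by (auto simp: constant_on_def)
    then have "?f (of_real (pi / \<alpha>)) = ?f 0" by metis
    moreover have "sin (of_real \<alpha> * of_real (pi / \<alpha>)) = (0::complex)"
      unfolding of_real_mult[symmetric] sin_of_real using assms(1) by simp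
    moreover have "sinh (of_real \<beta> * of_real (pi / \<alpha>)) = complex_of_real (sinh (\<beta> * (pi / \<alpha>)))"
      unfolding of_real_mult[symmetric] by (rule sinh_complex_of_real)
    ultimately show False using assms by simp
  qed
  then have "finite {z\<in>closure S. ?f z = 0}"
    using assms(4) by (intro holomorphic_compact_finite_zeros[where S=UNIV])
       (use D in \<open>auto simp: holomorphic_on_def field_differentiable_def\<close>)
  then show ?thesis
    by (rule rev_finite_subset) (use closure_subset in auto)
qed

lemma square_le_sinh_square: "(x::real)\<^sup>2 \<le> (sinh x)\<^sup>2"
proof -
  have pos: "t \<le> sinh t" if "t \<ge> 0" for t :: real
  proof -
    have "sinh 0 - 0 \<le> sinh t - t"
    proof (rule DERIV_nonneg_imp_nondecreasing[OF that])
      fix u :: real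
      show "\<exists>y. ((\<lambda>u. sinh u - u) has_real_derivative y) (at u) \<and> 0 \<le> y"
        by (intro exI[of _ "cosh u - 1"] conjI) (auto intro!: derivative_eq_intros simp: cosh_real_ge_1)
    qed
    then show ?thesis by simp
  qed
  have "\<bar>x\<bar> \<le> \<bar>sinh x\<bar>"
    using pos[of x] pos[of "- x"] by (cases "x \<ge> 0") auto
  then show ?thesis by (rule abs_le_square_iff[THEN iffD1])
qed

text \<open>On the real line the sine side is at most u, while the sinh side is at least v \<beta>^2
  x^2.\<close>

lemma real_zero_bound_sin_sinh:
  fixes u v \<alpha> \<beta> x :: real
  assumes "u > 0" "v > 0" "\<beta> \<noteq> 0" and eq: "u * (sin (\<alpha> * x))\<^sup>2 = v * (sinh (\<beta> * x))\<^sup>2"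
  shows "x\<^sup>2 \<le> u / (v * \<beta>\<^sup>2)"
proof -
  have "v * (\<beta> * x)\<^sup>2 \<le> v * (sinh (\<beta> * x))\<^sup>2"
    using assms by (intro mult_left_mono square_le_sinh_square) auto
  also have "\<dots> \<le> u"
    unfolding eq[symmetric] using assms by (intro mult_left_le) (auto simp: abs_square_le_1)
  finally show ?thesis
    using assms by (simp add: field_simps power_mult_distrib)
qed

text \<open>A real value \<open>z\<^sup>2\<close> forces \<open>z\<close> to lie on one of the axes, where one side of the equation is bounded.\<close>

lemma finite_real_squares_sin_sinh:
  fixes u v \<alpha> \<beta> :: real
  assumes "u > 0" "v > 0" "\<alpha> \<noteq> 0" "\<beta> \<noteq> 0"
  defines "Z \<equiv> {z :: complex. of_real u * (sin (of_real \<alpha> * z))\<^sup>2 = of_real v * (sinh (of_real \<beta> * z))\<^sup>2}"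
  shows "finite {z\<in>Z. z\<^sup>2 \<in> \<real>}"
proof -
  define R where "R = u / (v * \<beta>\<^sup>2) + v / (u * \<alpha>\<^sup>2)"
  have pos: "u / (v * \<beta>\<^sup>2) \<ge> 0" "v / (u * \<alpha>\<^sup>2) \<ge> 0" using assms by auto
  have "(norm z)\<^sup>2 \<le> R" if z: "z \<in> Z" "z\<^sup>2 \<in> \<real>" for z
  proof -
    have "Im z = 0 \<or> Re z = 0"
      using z(2) by (auto simp: complex_is_Real_iff power2_eq_square)
    then show ?thesis
    proof
      assume "Im z = 0"
      then obtain x where x: "z = of_real x" by (metis complex_is_Real_iff Reals_cases)
      have "complex_of_real (u * (sin (\<alpha> * x))\<^sup>2) = complex_of_real (v * (sinh (\<beta> * x))\<^sup>2)"
        using z(1) by (simp add: Z_def x flip: sin_of_real sinh_complex_of_real)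
      then have "x\<^sup>2 \<le> u / (v * \<beta>\<^sup>2)"
        unfolding of_real_eq_iff by (rule real_zero_bound_sin_sinh[OF assms(1,2,4)])
      then show ?thesis using pos by (simp add: R_def x)
    next
      assume "Re z = 0"
      then obtain x where x: "z = \<i> * of_real x"
        by (metis complex_eq mult_zero_left add_0 of_real_0)
      \<comment> \<open>On the imaginary axis \<open>sin\<close> and \<open>sinh\<close> trade
        places, so the real bound applies with u, v and \<alpha>, \<beta> exchanged.\<close>
      have "sin (of_real \<alpha> * z) = \<i> * sinh (of_real \<alpha> * of_real x)"
        by (simp add: x sinh_conv_sin mult_ac)
      moreover have "sinh (of_real \<beta> * z) = \<i> * sin (of_real \<beta> * of_real x)"
        by (simp add: x sinh_conv_sin mult_ac)
      ultimately have "of_real u * (sinh (of_real \<alpha> * of_real x))\<^sup>2 = of_real v * (sin (of_real \<beta> * complex_of_real x))\<^sup>2"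
        using z(1) by (simp add: Z_def power_mult_distrib)
      then have "complex_of_real (v * (sin (\<beta> * x))\<^sup>2) = complex_of_real (u * (sinh (\<alpha> * x))\<^sup>2)"
        by (simp flip: sin_of_real sinh_complex_of_real)
      then have "x\<^sup>2 \<le> v / (u * \<alpha>\<^sup>2)"
        unfolding of_real_eq_iff by (rule real_zero_bound_sin_sinh[OF assms(2,1,3)])
      then show ?thesis using pos by (simp add: R_def x norm_mult)
    qed
  qed
  then have "norm z \<le> sqrt R" if "z \<in> {z\<in>Z. z\<^sup>2 \<in> \<real>}" for z
    using that real_le_rsqrt by blast
  then have "bounded {z\<in>Z. z\<^sup>2 \<in> \<real>}"
    by (auto simp: bounded_iff)
  moreover have "of_real v \<noteq> (0::complex)" using assms by simp
  ultimately have "finite {z \<in> {z\<in>Z. z\<^sup>2 \<in> \<real>}. of_real u * (sin (of_real \<alpha> * z))\<^sup>2 = of_real v * (sinh (of_real \<beta> * z))\<^sup>2}"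
    by (intro finite_bounded_zeros_sin_sinh assms)
  then show ?thesis
    by (rule rev_finite_subset) (auto simp: Z_def)
qed

text \<open>Squaring is at most two-to-one, so an infinite zero set suffices. With c the square root
  of u/v, every solution of c sin = sinh solves the squared equation, and evenness allows \<alpha>
  and \<beta> to be replaced by their absolute values.\<close>

lemma infinite_squares_sin_sinh:
  fixes u v \<alpha> \<beta> :: real
  assumes "u > 0" "v > 0" "\<alpha> \<noteq> 0" "\<beta> \<noteq> 0"
  shows "infinite ((\<lambda>z. z\<^sup>2) ` {z :: complex. of_real u * (sin (of_real \<alpha> * z))\<^sup>2 = of_real v * (sinh (of_real \<beta> * z))\<^sup>2})"
    (is "infinite (_ ` ?Z)")
proof
  assume fin: "finite ((\<lambda>z. z\<^sup>2) ` ?Z)"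
  have "finite {z::complex. z\<^sup>2 = w}" for w
    by (rule finite_subset[of _ "{csqrt w, - csqrt w}"]) (auto simp: power2_eq_iff intro!: csqrt_unique, metis power2_csqrt power2_eq_iff)
  then have "finite (\<Union>w\<in>(\<lambda>z. z\<^sup>2) ` ?Z. {z. z\<^sup>2 = w})"
    using fin by blast
  moreover have "?Z \<subseteq> (\<Union>w\<in>(\<lambda>z. z\<^sup>2) ` ?Z. {z. z\<^sup>2 = w})" by blast
  ultimately have finZ: "finite ?Z" by (rule rev_finite_subset)
  define c where "c = sqrt (u / v)"
  have c: "c > 0" "c\<^sup>2 = u / v" using assms by (simp_all add: c_def)
  have sq: "(sin (of_real \<bar>t\<bar> * z))\<^sup>2 = (sin (of_real t * z))\<^sup>2" "(sinh (of_real \<bar>t\<bar> * z))\<^sup>2 = (sinh (of_real t * z))\<^sup>2"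
    for t and z :: complex by (cases "t \<ge> 0"; simp)+
  have "z \<in> ?Z" if "of_real c * sin (of_real \<bar>\<alpha>\<bar> * z) = sinh (of_real \<bar>\<beta>\<bar> * z)" for z
  proof -
    have "(of_real c * sin (of_real \<bar>\<alpha>\<bar> * z))\<^sup>2 = (sinh (of_real \<bar>\<beta>\<bar> * z))\<^sup>2"
      using that by simp
    then have "of_real (c\<^sup>2) * (sin (of_real \<alpha> * z))\<^sup>2 = (sinh (of_real \<beta> * z))\<^sup>2"
      by (simp only: power_mult_distrib sq of_real_power)
    then show ?thesis using assms(2) by (simp add: c(2) field_simps)
  qed
  then have "{z :: complex. of_real c * sin (of_real \<bar>\<alpha>\<bar> * z) = sinh (of_real \<bar>\<beta>\<bar> * z)} \<subseteq> ?Z"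
    by blast
  with finZ show False
    using infinite_zeros_sin_sinh[of "\<bar>\<alpha>\<bar>" "\<bar>\<beta>\<bar>" c] assms c(1) finite_subset by auto
qed

section \<open>The spectrum in terms of a characteristic determinant\<close>

locale elliptic_matrix =
  fixes a d :: real and s :: complex
  assumes ad: "\<bar>a - d\<bar> < 2" and s: "s\<^sup>2 = b_plus a d"
begin

definition "b = b_plus a d"
definition "p = of_real a - b"
definition "q = cnj p"

lemma b_Im: "Im b > 0"
proof -
  have "(a - d)\<^sup>2 < 2\<^sup>2" using ad by (intro power2_strict_mono) auto
  then show ?thesis by (simp add: b_def b_plus_def)
qed

lemma b_sum: "b + cnj b = of_real (a + d)"
  by (simp add: b_def b_plus_def complex_eq_iff)

lemma b_prod: "b * cnj b = of_real (a * d + 1)"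
proof -
  have "(a - d)\<^sup>2 < 2\<^sup>2" using ad by (intro power2_strict_mono) auto
  then have "(sqrt (4 - (a - d)\<^sup>2))\<^sup>2 = 4 - (a - d)\<^sup>2" by simp
  then show ?thesis
    by (simp add: b_def b_plus_def complex_eq_iff power2_eq_square algebra_simps)
qed

lemma b_nz: "b \<noteq> 0" "cnj b \<noteq> 0" "s \<noteq> 0" "cnj s \<noteq> 0"
  using b_Im s by (auto simp: b_def)

lemma q_eq: "q = of_real a - cnj b" "q = b - of_real d" "p = cnj b - of_real d"
  using b_sum by (auto simp: q_def p_def algebra_simps)

text \<open>The product is the characteristic polynomial of \<open>A4 a d\<close> evaluated at
  \<open>a\<close>, expressed by trace and determinant.\<close>

lemma pq: "p * q = 1"
proof -
  have "p * q = of_real (a * a) - of_real a * (b + cnj b) + b * cnj b"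
    unfolding q_eq(1) p_def by (simp add: algebra_simps)
  then show ?thesis unfolding b_sum b_prod by (simp add: algebra_simps)
qed

lemma p_neq_q: "q - p \<noteq> 0"
  using b_Im by (simp add: q_eq(1) p_def complex_eq_iff)

text \<open>
  Embeddings of \<open>\<complex>\<close> onto the eigenlines of \<open>A4 a d\<close> for \<open>b\<close> and \<open>cnj b\<close>, and the coordinates
  with respect to them.
\<close>

definition "T1 y = (vector [y, p * y] :: complex ^ 2)"
definition "T2 y = (vector [y, q * y] :: complex ^ 2)"
definition "P1 v = (q * v $ 1 - v $ 2) / (q - p)" for v :: "complex ^ 2"
definition "P2 v = (v $ 2 - p * v $ 1) / (q - p)" for v :: "complex ^ 2"

lemma linear_T: "linear T1" "linear T2" and linear_P: "linear P1" "linear P2"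
proof -
  show "linear T1" "linear T2"
    by (rule linearI; simp add: T1_def T2_def vec_eq_iff forall_2 algebra_simps)+
  show "linear P1" "linear P2"
    by (rule linearI; simp add: P1_def P2_def algebra_simps add_divide_distrib diff_divide_distrib scaleR_conv_of_real[where 'a=complex])+
qed

lemma T_P: "T1 (P1 v) + T2 (P2 v) = v"
proof -
  have "P1 v + P2 v = v $ 1" "p * P1 v + q * P2 v = v $ 2"
    using p_neq_q by (simp_all add: P1_def P2_def divide_simps) (simp_all add: algebra_simps)
  then show ?thesis by (simp add: T1_def T2_def vec_eq_iff forall_2)
qed

lemma P_T: "P1 (T1 x) = x" "P1 (T2 x) = 0" "P2 (T1 x) = 0" "P2 (T2 x) = x"
  using p_neq_q by (simp_all add: P1_def P2_def T1_def T2_def field_simps)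

lemma A4_mult: "A4 a d *v v = vector [of_real a * v $ 1 - v $ 2, v $ 1 + of_real d * v $ 2]"
  by (simp add: A4_def matrix_vector_mult_def vec_eq_iff forall_2 sum_2)

lemma A4_T: "A4 a d *v T1 x = T1 (b * x)" "A4 a d *v T2 x = T2 (cnj b * x)"
proof -
  have "of_real a - p = b" "of_real a - q = cnj b" by (simp_all add: p_def q_eq(1))
  moreover have "1 + of_real d * p = b * p"
    using pq by (simp add: q_eq(2) algebra_simps)
  moreover have "1 + of_real d * q = cnj b * q"
    using pq unfolding q_eq(3) by (simp add: algebra_simps)
  ultimately show "A4 a d *v T1 x = T1 (b * x)" "A4 a d *v T2 x = T2 (cnj b * x)"
    by (simp_all add: A4_mult T1_def T2_def vec_eq_iff forall_2 left_diff_distrib[symmetric] distrib_right[symmetric] mult.assoc[symmetric]) (metis (no_types) distrib_right mult.commute mult.left_commute mult_1 left_diff_distrib)+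
qed


text \<open>Recombination of scalar solutions along the eigenlines. Square integrability of the
  second derivative is seen by splitting each component into a linear image of \<open>h\<close>
  (\<open>k1\<close>, \<open>k2\<close>) and a continuous rest (\<open>r1\<close>,
  \<open>r2\<close>).\<close>

lemma bvp_solution_of_components:
  assumes h: "h \<in> L2"
    and y1: "second_primitive y1 y1' (\<lambda>x. - P1 (h x) / b - z / b * y1 x)"
    and y2: "second_primitive y2 y2' (\<lambda>x. - P2 (h x) / cnj b - z / cnj b * y2 x)"
    and bc: "y1 0 + y2 0 = 0" "y1 1 + y2 1 = 0" "p * y1' 0 + q * y2' 0 = 0" "p * y1' 1 + q * y2' 1 = 0"
  shows "bvp_solution (A4 a d) z h (\<lambda>x. T1 (y1 x) + T2 (y2 x)) (\<lambda>x. T1 (y1' x) + T2 (y2' x))"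
proof -
  define k1 where "k1 x = T1 (- P1 (h x) / b)" for x
  define k2 where "k2 x = T2 (- P2 (h x) / cnj b)" for x
  have linc: "linear (\<lambda>x. c * x)" for c :: complex
    by (rule linearI) (simp_all add: algebra_simps)
  have k1L: "k1 \<in> L2"
    using L2_linear[OF linear_compose[OF linear_P(1) linear_compose[OF linc[of "- 1 / b"] linear_T(1)]] h]
    by (simp add: k1_def[abs_def] o_def)
  have k2L: "k2 \<in> L2"
    using L2_linear[OF linear_compose[OF linear_P(2) linear_compose[OF linc[of "- 1 / cnj b"] linear_T(2)]] h]
    by (simp add: k2_def[abs_def] o_def)
  have y1c: "continuous_on {0..1} y1" and y2c: "continuous_on {0..1} y2"
    using continuous_on_vector_derivative[OF second_primitiveD(1)[OF y1]]
      continuous_on_vector_derivative[OF second_primitiveD(1)[OF y2]] by blast+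
  have T1c: "continuous_on S T1" and T2c: "continuous_on S T2" for S
    using linear_T by (auto intro: linear_continuous_on simp: linear_conv_bounded_linear)
  define r1 where "r1 x = T1 (- (z / b) * y1 x)" for x
  define r2 where "r2 x = T2 (- (z / cnj b) * y2 x)" for x
  have r1L: "r1 \<in> L2" and r2L: "r2 \<in> L2"
    unfolding r1_def r2_def
    by (intro L2_continuous continuous_on_compose2[OF T1c[of UNIV]] continuous_on_compose2[OF T2c[of UNIV]]
        continuous_on_mult_left y1c y2c subset_UNIV)+
  define g1 where "g1 x = - P1 (h x) / b - z / b * y1 x" for x
  define g2 where "g2 x = - P2 (h x) / cnj b - z / cnj b * y2 x" for x
  have Tg: "T1 (g1 x) = k1 x + r1 x" "T2 (g2 x) = k2 x + r2 x" for x
    by (simp_all add: g1_def g2_def k1_def k2_def r1_def r2_def flip: linear_add[OF linear_T(1)] linear_add[OF linear_T(2)])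
  have TgL: "(\<lambda>x. T1 (g1 x)) \<in> L2" "(\<lambda>x. T2 (g2 x)) \<in> L2"
    unfolding Tg by (intro L2_add k1L k2L r1L r2L)+
  have gi: "integrable unit_measure g1" "integrable unit_measure g2"
  proof -
    have "integrable unit_measure (\<lambda>x. P1 (T1 (g1 x)))" "integrable unit_measure (\<lambda>x. P2 (T2 (g2 x)))"
      using L2_integrable[OF TgL(1)] L2_integrable[OF TgL(2)] linear_P
      by (auto intro: integrable_bounded_linear simp: linear_conv_bounded_linear)
    then show "integrable unit_measure g1" "integrable unit_measure g2" by (simp_all add: P_T)
  qed
  have "second_primitive y1 y1' g1" "second_primitive y2 y2' g2"
    unfolding g1_def g2_def by (rule y1 y2)+
  then have "second_primitive (\<lambda>x. T1 (y1 x) + T2 (y2 x)) (\<lambda>x. T1 (y1' x) + T2 (y2' x)) (\<lambda>x. T1 (g1 x) + T2 (g2 x))"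
    by (rule second_primitive_add[OF second_primitive_linear[OF linear_T(1) _ gi(1)]
        second_primitive_linear[OF linear_T(2) _ gi(2)] L2_integrable[OF TgL(1)] L2_integrable[OF TgL(2)]])
  moreover have "(\<lambda>x. T1 (g1 x) + T2 (g2 x)) \<in> L2"
    by (intro L2_add TgL)
  moreover have "A4 a d *v (- (T1 (g1 x) + T2 (g2 x))) - z *s (T1 (y1 x) + T2 (y2 x)) = h x" for x
  proof -
    have "A4 a d *v (- (T1 (g1 x) + T2 (g2 x))) = - (T1 (b * g1 x) + T2 (cnj b * g2 x))"
      by (simp only: linear_neg[OF linear_matrix_vector_mult] linear_add[OF linear_matrix_vector_mult] A4_T)
    also have "b * g1 x = - (P1 (h x) + z * y1 x)"
      using b_nz by (simp add: g1_def field_simps)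
    also have "cnj b * g2 x = - (P2 (h x) + z * y2 x)"
      using b_nz by (simp add: g2_def field_simps)
    also have "- (T1 (- (P1 (h x) + z * y1 x)) + T2 (- (P2 (h x) + z * y2 x)))
       = (T1 (P1 (h x)) + T2 (P2 (h x))) + (T1 (z * y1 x) + T2 (z * y2 x))"
      by (simp add: linear_neg[OF linear_T(1)] linear_neg[OF linear_T(2)] linear_add[OF linear_T(1)] linear_add[OF linear_T(2)]
         linear_diff[OF linear_T(1)] linear_diff[OF linear_T(2)])
    also have "T1 (z * y1 x) + T2 (z * y2 x) = z *s (T1 (y1 x) + T2 (y2 x))"
      by (simp add: T1_def T2_def vec_eq_iff forall_2 algebra_simps)
    finally show ?thesis by (simp add: T_P)
  qed
  ultimately show ?thesis
    unfolding bvp_solution_def using bc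
    by (intro conjI bexI[of _ "\<lambda>x. T1 (g1 x) + T2 (g2 x)"]) (simp_all add: ae_eq_def, simp_all add: T1_def T2_def)
qed

text \<open>
  Determinant of the boundary conditions at \<open>1\<close> in the unknowns \<open>e\<close>, \<open>c\<close> of
  \<open>y\<^sub>1 = e cos(w\<^sub>1 x) + c q w\<^sub>2 sin(w\<^sub>1 x)\<close>, \<open>y\<^sub>2 = - e cos(w\<^sub>2 x) - c p w\<^sub>1 sin(w\<^sub>2 x)\<close>, the
  general pair that satisfies the conditions at \<open>0\<close>.
\<close>

definition char_det :: "complex \<Rightarrow> complex \<Rightarrow> complex" where
  "char_det w1 w2 = (cos w1 - cos w2) * (w1 * w2 * (cos w1 - cos w2))
     - (q * w2 * sin w1 - p * w1 * sin w2) * (q * w2 * sin w2 - p * w1 * sin w1)"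

text \<open>Uniqueness: the eigencoordinates of \<open>u\<close> solve homogeneous scalar equations,
  the conditions at 0 leave two free parameters, and the conditions at 1 are a homogeneous linear
  system for them with determinant \<open>char_det\<close>.\<close>

lemma bvp_solution_components:
  assumes u: "bvp_solution (A4 a d) z (\<lambda>x. 0) u u'"
    and w: "w1\<^sup>2 = z / b" "w2\<^sup>2 = z / cnj b" "w1 \<noteq> 0" "w2 \<noteq> 0"
    and D: "char_det w1 w2 \<noteq> 0" and x: "x \<in> {0..1}"
  shows "u x = 0"
proof -
  obtain g where g: "g \<in> L2" "second_primitive u u' g" "ae_eq (\<lambda>x. A4 a d *v (- g x) - z *s u x) (\<lambda>x. 0)"
    and bc: "u 0 $ 1 = 0" "u 1 $ 1 = 0" "u' 0 $ 2 = 0" "u' 1 $ 2 = 0"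
    using u unfolding bvp_solution_def by blast
  note gi = L2_integrable[OF g(1)]
  have Pgi: "integrable unit_measure (\<lambda>x. P1 (g x))" "integrable unit_measure (\<lambda>x. P2 (g x))"
    using gi linear_P by (auto intro: integrable_bounded_linear simp: linear_conv_bounded_linear)
  have PA: "P1 (A4 a d *v (- v) - z *s v') = - b * P1 v - z * P1 v'"
           "P2 (A4 a d *v (- v) - z *s v') = - cnj b * P2 v - z * P2 v'" for v v'
  proof -
    have v: "A4 a d *v (- v) = - (T1 (b * P1 v) + T2 (cnj b * P2 v))"
      by (subst T_P[of v, symmetric])
        (simp only: linear_neg[OF linear_matrix_vector_mult] linear_add[OF linear_matrix_vector_mult] A4_T)
    have "P1 (z *s v') = z * P1 v'" "P2 (z *s v') = z * P2 v'"
      by (simp_all add: P1_def P2_def algebra_simps)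
    then show "P1 (A4 a d *v (- v) - z *s v') = - b * P1 v - z * P1 v'"
           "P2 (A4 a d *v (- v) - z *s v') = - cnj b * P2 v - z * P2 v'"
      unfolding v by (simp_all add: linear_diff[OF linear_P(1)] linear_diff[OF linear_P(2)]
        linear_neg[OF linear_P(1)] linear_neg[OF linear_P(2)] linear_add[OF linear_P(1)] linear_add[OF linear_P(2)] P_T)
  qed
  have e1: "AE x in unit_measure. P1 (g x) = - w1\<^sup>2 * P1 (u x)"
    using g(3) unfolding ae_eq_def
  proof eventually_elim
    case (elim x)
    have "- b * P1 (g x) - z * P1 (u x) = 0"
      using PA(1)[of "g x" "u x"] elim linear_0[OF linear_P(1)] by simp
    then have "z * P1 (u x) = - b * P1 (g x)" by (metis eq_iff_diff_eq_0)
    then show ?case unfolding w using b_nz by (simp add: field_simps)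
  qed
  have e2: "AE x in unit_measure. P2 (g x) = - w2\<^sup>2 * P2 (u x)"
    using g(3) unfolding ae_eq_def
  proof eventually_elim
    case (elim x)
    have "- cnj b * P2 (g x) - z * P2 (u x) = 0"
      using PA(2)[of "g x" "u x"] elim linear_0[OF linear_P(2)] by simp
    then have "z * P2 (u x) = - cnj b * P2 (g x)" by (metis eq_iff_diff_eq_0)
    then show ?case unfolding w using b_nz by (simp add: field_simps)
  qed
  note y1 = helmholtz_unique[OF second_primitive_linear[OF linear_P(1) g(2) gi] Pgi(1) w(3) e1]
  note y2 = helmholtz_unique[OF second_primitive_linear[OF linear_P(2) g(2) gi] Pgi(2) w(4) e2]
  have c1: "v $ 1 = P1 v + P2 v" and c2: "v $ 2 = p * P1 v + q * P2 v" for v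
    using arg_cong[OF T_P[of v], of "\<lambda>v. v $ 1"] arg_cong[OF T_P[of v], of "\<lambda>v. v $ 2"]
    by (simp_all add: T1_def T2_def)
  define e where "e = P1 (u 0)"
  \<comment> \<open>Scaled so that, by \<open>p * q = 1\<close>, the Neumann condition at 0 gives
    \<open>P2 (u' 0)\<close> the matching form \<open>- p * w1 * w2 * c\<close>.\<close>
  define c where "c = P1 (u' 0) / (q * w1 * w2)"
  have q0: "q \<noteq> 0" "p \<noteq> 0" using pq by auto
  have i1: "P1 (u 0) = e" "P2 (u 0) = - e"
    using bc(1) by (simp_all add: e_def c1 add_eq_0_iff)
  have i2: "P1 (u' 0) = q * w1 * w2 * c"
    using q0 w by (simp add: c_def)
  have "q * (P2 (u' 0) + p * w1 * w2 * c) = 0"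
    using bc(3) pq by (simp add: c2 i2 algebra_simps)
  then have i3: "P2 (u' 0) = - p * w1 * w2 * c"
    using q0 by (simp add: add_eq_0_iff)
  have 1: "e * (cos w1 - cos w2) + c * (q * w2 * sin w1 - p * w1 * sin w2) = 0"
    using bc(2) y1(1)[of 1] y2(1)[of 1] w(3,4)
    by (simp add: c1 i1 i2 i3 algebra_simps)
  have "p * (q * w1 * w2 * c * cos w1 - w1 * e * sin w1) + q * (- p * w1 * w2 * c * cos w2 + w2 * e * sin w2) = 0"
    using bc(4) y1(2)[of 1] y2(2)[of 1]
    by (simp add: c2 i1 i2 i3)
  moreover have "p * (q * w1 * w2 * c * cos w1 - w1 * e * sin w1) + q * (- p * w1 * w2 * c * cos w2 + w2 * e * sin w2)
      = e * (q * w2 * sin w2 - p * w1 * sin w1) + c * ((p * q) * (w1 * w2 * (cos w1 - cos w2)))"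
    by (simp add: algebra_simps)
  ultimately have 2: "e * (q * w2 * sin w2 - p * w1 * sin w1) + c * (w1 * w2 * (cos w1 - cos w2)) = 0"
    by (simp add: pq)
  \<comment> \<open>Cramer's rule in polynomial form: the determinant times each unknown is a
    combination of the two equations.\<close>
  have "e * char_det w1 w2 = (e * (cos w1 - cos w2) + c * (q * w2 * sin w1 - p * w1 * sin w2)) * (w1 * w2 * (cos w1 - cos w2))
      - (e * (q * w2 * sin w2 - p * w1 * sin w1) + c * (w1 * w2 * (cos w1 - cos w2))) * (q * w2 * sin w1 - p * w1 * sin w2)"
    by (simp add: char_det_def algebra_simps)
  then have "e = 0" using 1 2 D by simp
  have "c * char_det w1 w2 = (e * (q * w2 * sin w2 - p * w1 * sin w1) + c * (w1 * w2 * (cos w1 - cos w2))) * (cos w1 - cos w2)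
      - (e * (cos w1 - cos w2) + c * (q * w2 * sin w1 - p * w1 * sin w2)) * (q * w2 * sin w2 - p * w1 * sin w1)"
    by (simp add: char_det_def algebra_simps)
  then have "c = 0" using 1 2 D by simp
  have "P1 (u x) = 0" "P2 (u x) = 0"
    using y1(1)[OF x] y2(1)[OF x] by (simp_all add: i1 i2 i3 \<open>e = 0\<close> \<open>c = 0\<close>)
  then show "u x = 0"
    using T_P[of "u x"] linear_0[OF linear_T(1)] linear_0[OF linear_T(2)] by simp
qed

text \<open>Particular solutions with zero Cauchy data at 0 are corrected by the two-parameter
  homogeneous family so that the conditions at 1 hold. Each quantity involved is bounded linearly by
  the L1 norm of \<open>h\<close>, so C does not depend on \<open>h\<close>.\<close>

lemma bvp_solution_exists:
  assumes w: "w1\<^sup>2 = z / b" "w2\<^sup>2 = z / cnj b" "w1 \<noteq> 0" "w2 \<noteq> 0"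
    and D: "char_det w1 w2 \<noteq> 0"
  obtains C where "\<And>h. h \<in> L2 \<Longrightarrow> \<exists>u u'. bvp_solution (A4 a d) z h u u' \<and>
        (\<forall>x\<in>{0..1}. norm (u x) \<le> C * (\<integral>x. norm (h x) \<partial>unit_measure))"
proof -
  obtain C1 where C1: "\<And>k :: real \<Rightarrow> complex. integrable unit_measure k \<Longrightarrow>
    \<exists>y y'. second_primitive y y' (\<lambda>x. k x - w1\<^sup>2 * y x) \<and> y 0 = 0 \<and> y' 0 = 0 \<and>
      (\<forall>x\<in>{0..1}. norm (y x) \<le> C1 * (\<integral>t. norm (k t) \<partial>unit_measure) \<and>
                  norm (y' x) \<le> C1 * (\<integral>t. norm (k t) \<partial>unit_measure))"
    by (rule helmholtz_particular[OF w(3)]) blast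
  obtain C2 where C2: "\<And>k :: real \<Rightarrow> complex. integrable unit_measure k \<Longrightarrow>
    \<exists>y y'. second_primitive y y' (\<lambda>x. k x - w2\<^sup>2 * y x) \<and> y 0 = 0 \<and> y' 0 = 0 \<and>
      (\<forall>x\<in>{0..1}. norm (y x) \<le> C2 * (\<integral>t. norm (k t) \<partial>unit_measure) \<and>
                  norm (y' x) \<le> C2 * (\<integral>t. norm (k t) \<partial>unit_measure))"
    by (rule helmholtz_particular[OF w(4)]) blast
  obtain E1 where E1: "E1 > 0" "\<And>x. x \<in> {0..1} \<Longrightarrow> norm (sin (w1 * of_real x)) \<le> E1"
      "\<And>x. x \<in> {0..1} \<Longrightarrow> norm (cos (w1 * of_real x)) \<le> E1"
    using sin_cos_mult_bounded[of w1] by blast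
  obtain E2 where E2: "E2 > 0" "\<And>x. x \<in> {0..1} \<Longrightarrow> norm (sin (w2 * of_real x)) \<le> E2"
      "\<And>x. x \<in> {0..1} \<Longrightarrow> norm (cos (w2 * of_real x)) \<le> E2"
    using sin_cos_mult_bounded[of w2] by blast
  obtain K1 where K1: "K1 > 0" "\<And>v. norm (P1 v) \<le> norm v * K1"
    using bounded_linear.pos_bounded linear_P(1) linear_conv_bounded_linear by blast
  obtain K2 where K2: "K2 > 0" "\<And>v. norm (P2 v) \<le> norm v * K2"
    using bounded_linear.pos_bounded linear_P(2) linear_conv_bounded_linear by blast
  obtain J1 where J1: "J1 > 0" "\<And>v. norm (T1 v) \<le> norm v * J1"
    using bounded_linear.pos_bounded linear_T(1) linear_conv_bounded_linear by blast
  obtain J2 where J2: "J2 > 0" "\<And>v. norm (T2 v) \<le> norm v * J2"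
    using bounded_linear.pos_bounded linear_T(2) linear_conv_bounded_linear by blast
  let ?D = "char_det w1 w2"
  \<comment> \<open>Entries of the boundary matrix divided by its determinant, that is, up to
    position and sign, those of the inverse matrix.\<close>
  define m11 where "m11 = (cos w1 - cos w2) / ?D"
  define m12 where "m12 = (q * w2 * sin w1 - p * w1 * sin w2) / ?D"
  define m21 where "m21 = (q * w2 * sin w2 - p * w1 * sin w1) / ?D"
  define m22 where "m22 = w1 * w2 * (cos w1 - cos w2) / ?D"
  have m: "?D * (m11 * m22 - m12 * m21) = 1"
  proof -
    have "\<delta> * ((x1 / \<delta>) * (x2 / \<delta>) - (x3 / \<delta>) * (x4 / \<delta>)) = 1"
      if "\<delta> \<noteq> 0" "\<delta> = x1 * x2 - x3 * x4" for \<delta> x1 x2 x3 x4 :: complex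
    proof -
      have "\<delta> * ((x1 / \<delta>) * (x2 / \<delta>) - (x3 / \<delta>) * (x4 / \<delta>)) = (x1 * x2 - x3 * x4) / \<delta>"
        using that(1) by (simp add: field_simps)
      then show ?thesis using that by simp
    qed
    from this[OF D char_det_def] show ?thesis
      unfolding m11_def m12_def m21_def m22_def .
  qed
  have comb: "norm (x * a + y * b) \<le> (norm a + norm b) * R" if "norm x \<le> R" "norm y \<le> R" for x y a b :: complex and R
  proof -
    have "norm (x * a + y * b) \<le> norm x * norm a + norm y * norm b"
      by (metis norm_mult norm_triangle_ineq)
    also have "\<dots> \<le> R * norm a + R * norm b"
      using that by (intro add_mono mult_right_mono) auto
    finally show ?thesis by (simp add: algebra_simps)
  qed
  define B where "B = \<bar>C1\<bar> * (K1 / norm b) + \<bar>C2\<bar> * (K2 / norm b)"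
  have B0: "B \<ge> 0" using K1(1) K2(1) by (simp add: B_def)
  define N1 where "N1 = 2 + norm p + norm q"
  define N2 where "N2 = norm m11 + norm m12 + norm m21 + norm m22"
  define N3 where "N3 = (E1 + norm (q * w2) * E1) + (E2 + norm (p * w1) * E2)"
  \<comment> \<open>B bounds the particular solutions, N1 their boundary residuals, N2 the
    coefficients e and c, N3 the homogeneous solutions, and J1 + J2 the passage back to
    vectors.\<close>
  define C where "C = (J1 + J2) * (B + N3 * (N2 * (N1 * B)))"
  have "\<exists>u u'. bvp_solution (A4 a d) z h u u' \<and>
        (\<forall>x\<in>{0..1}. norm (u x) \<le> C * (\<integral>x. norm (h x) \<partial>unit_measure))" if h: "h \<in> L2" for h
  proof -
    let ?m = "\<integral>x. norm (h x) \<partial>unit_measure"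
    have m0: "?m \<ge> 0" by simp
    note hi = L2_integrable[OF h]
    define k1 where "k1 x = - P1 (h x) / b" for x
    define k2 where "k2 x = - P2 (h x) / cnj b" for x
    have "integrable unit_measure (\<lambda>x. P1 (h x))" "integrable unit_measure (\<lambda>x. P2 (h x))"
      using hi linear_P by (auto intro: integrable_bounded_linear simp: linear_conv_bounded_linear)
    then have ki: "integrable unit_measure k1" "integrable unit_measure k2"
      by (simp_all add: k1_def[abs_def] k2_def[abs_def])
    have k1m: "(\<integral>x. norm (k1 x) \<partial>unit_measure) \<le> K1 / norm b * ?m"
    proof -
      have "(\<integral>x. norm (k1 x) \<partial>unit_measure) \<le> (\<integral>x. K1 / norm b * norm (h x) \<partial>unit_measure)"
      proof (rule integral_mono)
        show "integrable unit_measure (\<lambda>x. norm (k1 x))" using ki(1) by (rule integrable_norm)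
        show "integrable unit_measure (\<lambda>x. K1 / norm b * norm (h x))" using hi by simp
        show "norm (k1 x) \<le> K1 / norm b * norm (h x)" for x
          using K1(2)[of "h x"] by (simp add: k1_def norm_divide divide_right_mono mult.commute)
      qed
      then show ?thesis by simp
    qed
    have k2m: "(\<integral>x. norm (k2 x) \<partial>unit_measure) \<le> K2 / norm b * ?m"
    proof -
      have "(\<integral>x. norm (k2 x) \<partial>unit_measure) \<le> (\<integral>x. K2 / norm b * norm (h x) \<partial>unit_measure)"
      proof (rule integral_mono)
        show "integrable unit_measure (\<lambda>x. norm (k2 x))" using ki(2) by (rule integrable_norm)
        show "integrable unit_measure (\<lambda>x. K2 / norm b * norm (h x))" using hi by simp
        show "norm (k2 x) \<le> K2 / norm b * norm (h x)" for x
          using K2(2)[of "h x"] by (simp add: k2_def norm_divide divide_right_mono mult.commute)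
      qed
      then show ?thesis by simp
    qed
    obtain Y1 Y1' where Y1: "second_primitive Y1 Y1' (\<lambda>x. k1 x - w1\<^sup>2 * Y1 x)" "Y1 0 = 0" "Y1' 0 = 0"
      "\<And>x. x\<in>{0..1} \<Longrightarrow> norm (Y1 x) \<le> C1 * (\<integral>t. norm (k1 t) \<partial>unit_measure)"
      "\<And>x. x\<in>{0..1} \<Longrightarrow> norm (Y1' x) \<le> C1 * (\<integral>t. norm (k1 t) \<partial>unit_measure)"
      using C1[OF ki(1)] by blast
    obtain Y2 Y2' where Y2: "second_primitive Y2 Y2' (\<lambda>x. k2 x - w2\<^sup>2 * Y2 x)" "Y2 0 = 0" "Y2' 0 = 0"
      "\<And>x. x\<in>{0..1} \<Longrightarrow> norm (Y2 x) \<le> C2 * (\<integral>t. norm (k2 t) \<partial>unit_measure)"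
      "\<And>x. x\<in>{0..1} \<Longrightarrow> norm (Y2' x) \<le> C2 * (\<integral>t. norm (k2 t) \<partial>unit_measure)"
      using C2[OF ki(2)] by blast
    have le1: "C1 * (\<integral>t. norm (k1 t) \<partial>unit_measure) \<le> B * ?m"
    proof -
      have "C1 * (\<integral>t. norm (k1 t) \<partial>unit_measure) \<le> \<bar>C1\<bar> * (\<integral>t. norm (k1 t) \<partial>unit_measure)"
        by (intro mult_right_mono) auto
      also have "\<dots> \<le> \<bar>C1\<bar> * (K1 / norm b * ?m)" using k1m by (intro mult_left_mono) auto
      also have "\<dots> \<le> B * ?m"
        unfolding mult.assoc[symmetric] using m0 K2(1) by (intro mult_right_mono) (auto simp: B_def)
      finally show ?thesis .
    qed
    have le2: "C2 * (\<integral>t. norm (k2 t) \<partial>unit_measure) \<le> B * ?m"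
    proof -
      have "C2 * (\<integral>t. norm (k2 t) \<partial>unit_measure) \<le> \<bar>C2\<bar> * (\<integral>t. norm (k2 t) \<partial>unit_measure)"
        by (intro mult_right_mono) auto
      also have "\<dots> \<le> \<bar>C2\<bar> * (K2 / norm b * ?m)" using k2m by (intro mult_left_mono) auto
      also have "\<dots> \<le> B * ?m"
        unfolding mult.assoc[symmetric] using m0 K1(1) by (intro mult_right_mono) (auto simp: B_def)
      finally show ?thesis .
    qed
    have Yb: "norm (Y1 x) \<le> B * ?m" "norm (Y1' x) \<le> B * ?m" "norm (Y2 x) \<le> B * ?m" "norm (Y2' x) \<le> B * ?m"
      if "x \<in> {0..1}" for x
      using order_trans[OF Y1(4)[OF that] le1] order_trans[OF Y1(5)[OF that] le1]
        order_trans[OF Y2(4)[OF that] le2] order_trans[OF Y2(5)[OF that] le2] by blast+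
    have Bm: "B * ?m \<ge> 0" using B0 m0 by simp
    \<comment> \<open>Negated boundary values at 1 of the particular solutions, to be matched by the
      homogeneous part; the shape of a sum of products fits \<open>comb\<close>.\<close>
    define r1 where "r1 = Y1 1 * (- 1) + Y2 1 * (- 1)"
    define r2 where "r2 = Y1' 1 * (- p) + Y2' 1 * (- q)"
    have "norm r1 \<le> (norm (- 1 :: complex) + norm (- 1 :: complex)) * (B * ?m)"
      unfolding r1_def by (intro comb Yb) auto
    also have "\<dots> \<le> N1 * (B * ?m)"
      using Bm by (intro mult_right_mono) (auto simp: N1_def)
    finally have r1: "norm r1 \<le> N1 * (B * ?m)" .
    have "norm r2 \<le> (norm (- p) + norm (- q)) * (B * ?m)"
      unfolding r2_def by (intro comb Yb) auto
    also have "\<dots> \<le> N1 * (B * ?m)"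
      using Bm by (intro mult_right_mono) (auto simp: N1_def)
    finally have r2: "norm r2 \<le> N1 * (B * ?m)" .
    have N1m: "N1 * (B * ?m) \<ge> 0" using r1 norm_ge_zero order_trans by blast
    define e where "e = r1 * m22 + r2 * (- m12)"
    define c where "c = r1 * (- m21) + r2 * m11"
    have "norm e \<le> (norm m22 + norm (- m12)) * (N1 * (B * ?m))"
      unfolding e_def by (intro comb r1 r2)
    also have "\<dots> \<le> N2 * (N1 * (B * ?m))"
      using N1m by (intro mult_right_mono) (auto simp: N2_def)
    finally have e: "norm e \<le> N2 * (N1 * (B * ?m))" .
    have "norm c \<le> (norm (- m21) + norm m11) * (N1 * (B * ?m))"
      unfolding c_def by (intro comb r1 r2)
    also have "\<dots> \<le> N2 * (N1 * (B * ?m))"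
      using N1m by (intro mult_right_mono) (auto simp: N2_def)
    finally have c: "norm c \<le> N2 * (N1 * (B * ?m))" .
    have N2m: "N2 * (N1 * (B * ?m)) \<ge> 0" using c norm_ge_zero order_trans by blast
    have "e * (?D * m11) + c * (?D * m12) = r1 * (?D * (m11 * m22 - m12 * m21))"
      by (simp add: e_def c_def algebra_simps)
    then have s1: "e * (cos w1 - cos w2) + c * (q * w2 * sin w1 - p * w1 * sin w2) = r1"
      using D m by (simp add: m11_def m12_def)
    have "e * (?D * m21) + c * (?D * m22) = r2 * (?D * (m11 * m22 - m12 * m21))"
      by (simp add: e_def c_def algebra_simps)
    then have s2: "e * (q * w2 * sin w2 - p * w1 * sin w1) + c * (w1 * w2 * (cos w1 - cos w2)) = r2"
      using D m by (simp add: m21_def m22_def)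
    define y1 where "y1 x = Y1 x + (e * cos (w1 * of_real x) + c * (q * w2) * sin (w1 * of_real x))" for x
    define y1' where "y1' x = Y1' x + (- e * w1 * sin (w1 * of_real x) + c * (q * w2) * w1 * cos (w1 * of_real x))" for x
    define y2 where "y2 x = Y2 x + (- e * cos (w2 * of_real x) + - c * (p * w1) * sin (w2 * of_real x))" for x
    define y2' where "y2' x = Y2' x + (- (- e) * w2 * sin (w2 * of_real x) + - c * (p * w1) * w2 * cos (w2 * of_real x))" for x
    have Yc: "continuous_on {0..1} Y1" "continuous_on {0..1} Y2"
      using continuous_on_vector_derivative[OF second_primitiveD(1)[OF Y1(1)]]
        continuous_on_vector_derivative[OF second_primitiveD(1)[OF Y2(1)]] by blast+
    have "second_primitive y1 y1' (\<lambda>x. (k1 x - w1\<^sup>2 * Y1 x) + (- w1\<^sup>2 * (e * cos (w1 * of_real x) + c * (q * w2) * sin (w1 * of_real x))))"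
      unfolding y1_def y1'_def
      by (intro second_primitive_add Y1(1) second_primitive_sin_cos Bochner_Integration.integrable_diff ki
          unit_continuous_integrable continuous_intros Yc)
    then have p1: "second_primitive y1 y1' (\<lambda>x. - P1 (h x) / b - z / b * y1 x)"
      by (simp add: y1_def[abs_def] k1_def[abs_def] w algebra_simps)
    have "second_primitive y2 y2' (\<lambda>x. (k2 x - w2\<^sup>2 * Y2 x) + (- w2\<^sup>2 * (- e * cos (w2 * of_real x) + - c * (p * w1) * sin (w2 * of_real x))))"
      unfolding y2_def y2'_def
      by (intro second_primitive_add Y2(1) second_primitive_sin_cos Bochner_Integration.integrable_diff ki
          unit_continuous_integrable continuous_intros Yc)
    then have p2: "second_primitive y2 y2' (\<lambda>x. - P2 (h x) / cnj b - z / cnj b * y2 x)"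
      by (simp add: y2_def[abs_def] k2_def[abs_def] w algebra_simps)
    have "bvp_solution (A4 a d) z h (\<lambda>x. T1 (y1 x) + T2 (y2 x)) (\<lambda>x. T1 (y1' x) + T2 (y2' x))"
    proof (rule bvp_solution_of_components[OF h p1 p2])
      show "y1 0 + y2 0 = 0" using Y1(2) Y2(2) by (simp add: y1_def y2_def)
      show "p * y1' 0 + q * y2' 0 = 0" using Y1(3) Y2(3) by (simp add: y1'_def y2'_def)
      have "y1 1 + y2 1 = (e * (cos w1 - cos w2) + c * (q * w2 * sin w1 - p * w1 * sin w2)) - r1"
        by (simp add: y1_def y2_def r1_def algebra_simps)
      then show "y1 1 + y2 1 = 0" by (simp add: s1)
      have "p * y1' 1 + q * y2' 1 = e * (q * w2 * sin w2 - p * w1 * sin w1) + c * ((p * q) * (w1 * w2 * (cos w1 - cos w2))) - r2"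
        by (simp add: y1'_def y2'_def r2_def algebra_simps)
      then show "p * y1' 1 + q * y2' 1 = 0" using s2 by (simp add: pq)
    qed
    moreover have "norm (T1 (y1 x) + T2 (y2 x)) \<le> C * ?m" if x: "x \<in> {0..1}" for x
    proof -
      let ?R = "B * ?m + N3 * (N2 * (N1 * (B * ?m)))"
      have E12: "0 \<le> norm (q * w2) * E1" "0 \<le> norm (p * w1) * E2" using E1(1) E2(1) by auto
      have "norm (e * cos (w1 * of_real x) + c * ((q * w2) * sin (w1 * of_real x)))
         \<le> (norm (cos (w1 * of_real x)) + norm ((q * w2) * sin (w1 * of_real x))) * (N2 * (N1 * (B * ?m)))"
        by (intro comb e c)
      also have "\<dots> \<le> N3 * (N2 * (N1 * (B * ?m)))"
      proof (intro mult_right_mono N2m)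
        have "norm (cos (w1 * of_real x)) + norm ((q * w2) * sin (w1 * of_real x)) \<le> E1 + norm (q * w2) * E1"
          unfolding norm_mult[of "q * w2"] by (intro add_mono mult_left_mono E1 x) auto
        then show "norm (cos (w1 * of_real x)) + norm ((q * w2) * sin (w1 * of_real x)) \<le> N3"
          unfolding N3_def using E12 E2(1) by linarith
      qed
      finally have "norm (e * cos (w1 * of_real x) + c * (q * w2) * sin (w1 * of_real x)) \<le> N3 * (N2 * (N1 * (B * ?m)))"
        by (simp only: mult.assoc)
      then have y1b: "norm (y1 x) \<le> ?R"
        unfolding y1_def by (rule order_trans[OF norm_triangle_ineq add_mono[OF Yb(1)[OF x]]])
      have "norm (- e * cos (w2 * of_real x) + - c * ((p * w1) * sin (w2 * of_real x)))
         \<le> (norm (cos (w2 * of_real x)) + norm ((p * w1) * sin (w2 * of_real x))) * (N2 * (N1 * (B * ?m)))"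
        by (intro comb) (simp_all add: e c)
      also have "\<dots> \<le> N3 * (N2 * (N1 * (B * ?m)))"
      proof (intro mult_right_mono N2m)
        have "norm (cos (w2 * of_real x)) + norm ((p * w1) * sin (w2 * of_real x)) \<le> E2 + norm (p * w1) * E2"
          unfolding norm_mult[of "p * w1"] by (intro add_mono mult_left_mono E2 x) auto
        then show "norm (cos (w2 * of_real x)) + norm ((p * w1) * sin (w2 * of_real x)) \<le> N3"
          unfolding N3_def using E12 E1(1) by linarith
      qed
      finally have "norm (- e * cos (w2 * of_real x) + - c * (p * w1) * sin (w2 * of_real x)) \<le> N3 * (N2 * (N1 * (B * ?m)))"
        by (simp only: mult.assoc)
      then have y2b: "norm (y2 x) \<le> ?R"
        unfolding y2_def by (rule order_trans[OF norm_triangle_ineq add_mono[OF Yb(3)[OF x]]])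
      have "norm (T1 (y1 x) + T2 (y2 x)) \<le> norm (y1 x) * J1 + norm (y2 x) * J2"
        by (rule order_trans[OF norm_triangle_ineq add_mono[OF J1(2) J2(2)]])
      also have "\<dots> \<le> ?R * J1 + ?R * J2"
        using J1(1) J2(1) y1b y2b by (intro add_mono mult_right_mono) auto
      also have "\<dots> = C * ?m" by (simp add: C_def algebra_simps)
      finally show ?thesis .
    qed
    ultimately show ?thesis by blast
  qed
  then show ?thesis by (rule that)
qed

text \<open>A singular boundary matrix has a nonzero kernel vector (e, c), and the corresponding
  homogeneous solution is an eigenfunction.\<close>

lemma in_Spec_if_char_det_0:
  assumes w: "w1\<^sup>2 = z / b" "w2\<^sup>2 = z / cnj b" "w1 \<noteq> 0" "w2 \<noteq> 0"
    and D: "char_det w1 w2 = 0"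
  shows "z \<in> Spec Dom_D (AD_op (A4 a d))"
proof -
  let ?m11 = "cos w1 - cos w2" and ?m22 = "w1 * w2 * (cos w1 - cos w2)"
  let ?m12 = "q * w2 * sin w1 - p * w1 * sin w2" and ?m21 = "q * w2 * sin w2 - p * w1 * sin w1"
  have "\<exists>e c. (e \<noteq> 0 \<or> c \<noteq> 0) \<and> e * ?m11 + c * ?m12 = 0 \<and> e * ?m21 + c * ?m22 = 0"
  proof (cases "?m11 = 0 \<and> ?m12 = 0")
    case True
    show ?thesis
    proof (cases "?m21 = 0 \<and> ?m22 = 0")
      case True
      then show ?thesis using \<open>?m11 = 0 \<and> ?m12 = 0\<close> by (intro exI[of _ 1] exI[of _ 0]) simp
    next
      case False
      then show ?thesis using True by (intro exI[of _ ?m22] exI[of _ "- ?m21"]) (auto simp: mult.commute)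
    qed
  next
    case False
    then show ?thesis using D
      by (intro exI[of _ ?m12] exI[of _ "- ?m11"]) (auto simp: char_det_def algebra_simps)
  qed
  then obtain e c where ec: "e \<noteq> 0 \<or> c \<noteq> 0" and s1: "e * ?m11 + c * ?m12 = 0" and s2: "e * ?m21 + c * ?m22 = 0"
    by blast
  define y1 where "y1 x = e * cos (w1 * of_real x) + c * (q * w2) * sin (w1 * of_real x)" for x :: real
  define y1' where "y1' x = - e * w1 * sin (w1 * of_real x) + c * (q * w2) * w1 * cos (w1 * of_real x)" for x :: real
  define y2 where "y2 x = - e * cos (w2 * of_real x) + - c * (p * w1) * sin (w2 * of_real x)" for x :: real
  define y2' where "y2' x = - (- e) * w2 * sin (w2 * of_real x) + - c * (p * w1) * w2 * cos (w2 * of_real x)" for x :: real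
  have "second_primitive y1 y1' (\<lambda>x. - w1\<^sup>2 * y1 x)" "second_primitive y2 y2' (\<lambda>x. - w2\<^sup>2 * y2 x)"
    unfolding y1_def y1'_def y2_def y2'_def by (rule second_primitive_sin_cos)+
  then have p: "second_primitive y1 y1' (\<lambda>x. - P1 0 / b - z / b * y1 x)" "second_primitive y2 y2' (\<lambda>x. - P2 0 / cnj b - z / cnj b * y2 x)"
    by (simp_all add: w linear_0[OF linear_P(1)] linear_0[OF linear_P(2)])
  have sol: "bvp_solution (A4 a d) z (\<lambda>x. 0) (\<lambda>x. T1 (y1 x) + T2 (y2 x)) (\<lambda>x. T1 (y1' x) + T2 (y2' x))"
  proof (rule bvp_solution_of_components[OF _ p])
    show "(\<lambda>x. 0) \<in> L2" by (simp add: L2_continuous)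
    show "y1 0 + y2 0 = 0" "p * y1' 0 + q * y2' 0 = 0" by (simp_all add: y1_def y2_def y1'_def y2'_def)
    have "y1 1 + y2 1 = e * ?m11 + c * ?m12"
      by (simp add: y1_def y2_def algebra_simps)
    then show "y1 1 + y2 1 = 0" by (simp add: s1)
    have "p * y1' 1 + q * y2' 1 = e * ?m21 + c * ((p * q) * ?m22)"
      by (simp add: y1'_def y2'_def algebra_simps)
    then show "p * y1' 1 + q * y2' 1 = 0" using s2 by (simp add: pq)
  qed
  \<comment> \<open>The eigenfunction is not zero, since the Cauchy data of \<open>y1\<close> at 0
    are e and \<open>c * q * w1 * w2\<close>.\<close>
  have "\<exists>x\<in>{0..1}. y1 x \<noteq> 0"
  proof (rule ccontr)
    assume "\<not> (\<exists>x\<in>{0..1}. y1 x \<noteq> 0)"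
    then have 0: "\<And>x. x \<in> {0..1} \<Longrightarrow> y1 x = 0" by blast
    from 0[of 0] have "e = 0" by (simp add: y1_def)
    have "(y1 has_vector_derivative y1' 0) (at 0 within {0..1})"
      using second_primitiveD(1)[OF p(1), of 0] by simp
    moreover have "(y1 has_vector_derivative 0) (at 0 within {0..1})"
      by (rule has_vector_derivative_transform[OF _ _ has_vector_derivative_const[of 0]]) (use 0 in auto)
    moreover have "at (0::real) within {0..1} \<noteq> bot"
      by (simp add: trivial_limit_within islimpt_Icc)
    ultimately have "y1' 0 = 0" by (rule vector_derivative_unique_within[rotated])
    moreover have "q \<noteq> 0" using pq by auto
    ultimately have "c = 0" using w by (simp add: y1'_def)
    with ec \<open>e = 0\<close> show False by simp
  qed
  then obtain x where x: "x \<in> {0..1}" "y1 x \<noteq> 0" by blast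
  have "P1 (T1 (y1 x) + T2 (y2 x)) \<noteq> 0"
    using x by (simp add: linear_add[OF linear_P(1)] P_T)
  then have "T1 (y1 x) + T2 (y2 x) \<noteq> 0"
    using linear_0[OF linear_P(1)] by metis
  then show ?thesis
    by (rule in_Spec_if_eigenfunction[OF sol x(1)])
qed

text \<open>At z = 0 both frequencies vanish and the determinant says nothing; the constant function
  (0, 1) meets the Dirichlet and the Neumann conditions.\<close>

lemma zero_in_Spec: "0 \<in> Spec Dom_D (AD_op (A4 a d))"
proof (rule in_Spec_if_eigenfunction)
  show "bvp_solution (A4 a d) 0 (\<lambda>x. 0) (\<lambda>x. vector [0, 1]) (\<lambda>x. 0)"
    unfolding bvp_solution_def
  proof (intro conjI bexI[of _ "\<lambda>x. 0"])
    show "second_primitive (\<lambda>x. vector [0, 1]) (\<lambda>x. 0) (\<lambda>x. 0 :: complex ^ 2)"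
      by (simp add: second_primitive_def)
    have "0 *s (vector [0, 1] :: complex ^ 2) = 0"
      by (simp add: vec_eq_iff)
    then show "ae_eq (\<lambda>x. A4 a d *v (- 0) - 0 *s (vector [0, 1] :: complex ^ 2)) (\<lambda>x. 0)"
      by (simp add: ae_eq_def)
  qed (auto simp: L2_continuous)
  show "(vector [0, 1] :: complex ^ 2) \<noteq> 0"
    by (simp add: vec_eq_iff) (metis vector_2(2) zero_neq_one)
  show "(0::real) \<in> {0..1}" by simp
qed

definition "\<alpha> = Re (1 / s)"
definition "\<beta> = Im (1 / s)"
text \<open>Since p has modulus 1, this is the cosine of the argument of
  \<open>p\<^sup>2 * cnj b\<close>.\<close>

definition "\<kappa> = Re (p\<^sup>2 * cnj b) / norm b"

text \<open>The frequencies are X + iY and X - iY with X = \<alpha>\<zeta> and Y = \<beta>\<zeta>,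
  so the addition theorems express the products of their sines and of their cosines by sin^2 X and
  sinh^2 Y alone.\<close>

lemma char_det_eq:
  "char_det (\<zeta> / s) (\<zeta> / cnj s) = 2 * (\<zeta>\<^sup>2 / norm b) *
     ((1 - of_real \<kappa>) * (sin (of_real \<alpha> * \<zeta>))\<^sup>2 - (1 + of_real \<kappa>) * (sinh (of_real \<beta> * \<zeta>))\<^sup>2)"
proof -
  define w1 w2 where "w1 = \<zeta> / s" "w2 = \<zeta> / cnj s"
  have nb: "s * cnj s = of_real (norm b)"
  proof -
    have "norm b = norm s ^ 2" using s by (metis b_def norm_power)
    then show ?thesis by (metis complex_norm_square of_real_power)
  qed
  have nb0: "of_real (norm b) \<noteq> (0 :: complex)" using b_nz by simp
  have w12: "w1 * w2 = \<zeta>\<^sup>2 / norm b"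
    unfolding w1_w2_def by (simp add: nb[symmetric] power2_eq_square)
  have "1 / s = of_real \<alpha> + \<i> * of_real \<beta>"
    by (simp add: \<alpha>_def \<beta>_def complex_eq_iff)
  moreover from this have "cnj (1 / s) = cnj (of_real \<alpha> + \<i> * of_real \<beta>)" by (rule arg_cong)
  then have "1 / cnj s = of_real \<alpha> - \<i> * of_real \<beta>" by simp
  moreover have "w1 = \<zeta> * (1 / s)" "w2 = \<zeta> * (1 / cnj s)" by (simp_all add: w1_w2_def)
  ultimately have w: "w1 = of_real \<alpha> * \<zeta> + \<i> * (of_real \<beta> * \<zeta>)" "w2 = of_real \<alpha> * \<zeta> - \<i> * (of_real \<beta> * \<zeta>)"
    by (simp_all only: distrib_left right_diff_distrib mult.commute mult.left_commute)
  let ?X = "of_real \<alpha> * \<zeta>" and ?Y = "of_real \<beta> * \<zeta>"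
  have t1: "cosh ?Y * cosh ?Y = 1 + sinh ?Y * sinh ?Y"
    using cosh_square_eq[of ?Y] by (simp add: power2_eq_square)
  have t2: "cos ?X * cos ?X = 1 - sin ?X * sin ?X"
    using sin_cos_squared_add[of ?X] by (simp add: power2_eq_square algebra_simps)
  have si: "sin (\<i> * ?Y) = \<i> * sinh ?Y" "cos (\<i> * ?Y) = cosh ?Y"
    by (simp_all add: sinh_conv_sin cosh_conv_cos)
  have ss: "sin w1 * sin w2 = sin ?X * sin ?X + sinh ?Y * sinh ?Y"
  proof -
    have "sin w1 * sin w2 = (sin ?X * sin ?X) * (cosh ?Y * cosh ?Y) + (cos ?X * cos ?X) * (sinh ?Y * sinh ?Y)"
      unfolding w sin_add sin_diff si by (simp add: algebra_simps)
    then show ?thesis unfolding t1 t2 by (simp add: algebra_simps)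
  qed
  have cc: "cos w1 * cos w2 = 1 - sin ?X * sin ?X + sinh ?Y * sinh ?Y"
  proof -
    have "cos w1 * cos w2 = (cos ?X * cos ?X) * (cosh ?Y * cosh ?Y) + (sin ?X * sin ?X) * (sinh ?Y * sinh ?Y)"
      unfolding w cos_add cos_diff si by (simp add: algebra_simps)
    then show ?thesis unfolding t1 t2 by (simp add: algebra_simps)
  qed
  \<comment> \<open>Apart from the common factor \<zeta>^2 the two summands are complex conjugates,
    which is where the real number \<kappa> enters.\<close>
  have k: "p\<^sup>2 * w1\<^sup>2 + q\<^sup>2 * w2\<^sup>2 = 2 * of_real \<kappa> * (w1 * w2)"
  proof -
    have sq: "w1\<^sup>2 = \<zeta>\<^sup>2 / b" "w2\<^sup>2 = \<zeta>\<^sup>2 / cnj b"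
      using s by (simp_all add: w1_w2_def power_divide b_def flip: complex_cnj_power)
    have "p\<^sup>2 * w1\<^sup>2 + q\<^sup>2 * w2\<^sup>2 = \<zeta>\<^sup>2 * (p\<^sup>2 * cnj b + cnj (p\<^sup>2 * cnj b)) / (b * cnj b)"
      unfolding sq using b_nz by (simp add: q_def field_simps)
    also have "p\<^sup>2 * cnj b + cnj (p\<^sup>2 * cnj b) = 2 * of_real (Re (p\<^sup>2 * cnj b))"
      by (simp only: complex_add_cnj of_real_mult of_real_numeral)
    also have "b * cnj b = of_real (norm b) * of_real (norm b)"
      by (simp add: complex_norm_square[symmetric] power2_eq_square)
    finally show ?thesis using nb0 by (simp add: w12 \<kappa>_def field_simps)
  qed
  \<comment> \<open>The squared sines carry the coefficient \<open>p * q\<close>; comparing it with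
    1 completes the squared cosines and isolates a summand that vanishes by
    \<open>pq\<close>.\<close>
  have "char_det w1 w2 = w1 * w2 * ((cos w1 * cos w1 + sin w1 * sin w1) + (cos w2 * cos w2 + sin w2 * sin w2) - 2 * (cos w1 * cos w2))
     - (p\<^sup>2 * w1\<^sup>2 + q\<^sup>2 * w2\<^sup>2) * (sin w1 * sin w2)
     + (p * q - 1) * (w1 * w2 * (sin w1 * sin w1 + sin w2 * sin w2))"
    unfolding char_det_def by (simp add: algebra_simps power2_eq_square del: sin_cos_squared_add3)
  also have "\<dots> = w1 * w2 * (2 - 2 * (cos w1 * cos w2) - 2 * of_real \<kappa> * (sin w1 * sin w2))"
    unfolding k pq sin_cos_squared_add3 by (simp add: algebra_simps)
  also have "\<dots> = 2 * (w1 * w2) * ((1 - of_real \<kappa>) * (sin ?X)\<^sup>2 - (1 + of_real \<kappa>) * (sinh ?Y)\<^sup>2)"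
    unfolding cc ss by (simp add: algebra_simps power2_eq_square)
  finally show ?thesis unfolding w12 by (simp only: w1_w2_def)
qed

text \<open>Away from 0 a nonzero determinant gives a bounded inverse and a zero one an
  eigenfunction, so the spectrum consists of eigenvalues. At \<zeta> = 0 both sides of the
  equivalence are true.\<close>

lemma in_Spec_iff:
  "\<zeta>\<^sup>2 \<in> Spec Dom_D (AD_op (A4 a d)) \<longleftrightarrow>
     (1 - of_real \<kappa>) * (sin (of_real \<alpha> * \<zeta>))\<^sup>2 = (1 + of_real \<kappa>) * (sinh (of_real \<beta> * \<zeta>))\<^sup>2"
proof (cases "\<zeta> = 0")
  case True
  then show ?thesis using zero_in_Spec by simp
next
  case False
  define w1 w2 where "w1 = \<zeta> / s" "w2 = \<zeta> / cnj s"
  have w: "w1\<^sup>2 = \<zeta>\<^sup>2 / b" "w2\<^sup>2 = \<zeta>\<^sup>2 / cnj b" "w1 \<noteq> 0" "w2 \<noteq> 0"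
    using s b_nz False by (simp_all add: w1_w2_def power_divide b_def flip: complex_cnj_power)
  have "\<zeta>\<^sup>2 \<in> Spec Dom_D (AD_op (A4 a d)) \<longleftrightarrow> char_det w1 w2 = 0"
  proof
    assume "char_det w1 w2 = 0"
    then show "\<zeta>\<^sup>2 \<in> Spec Dom_D (AD_op (A4 a d))"
      by (rule in_Spec_if_char_det_0[OF w])
  next
    assume S: "\<zeta>\<^sup>2 \<in> Spec Dom_D (AD_op (A4 a d))"
    show "char_det w1 w2 = 0"
    proof (rule ccontr)
      assume D: "char_det w1 w2 \<noteq> 0"
      obtain C where "\<And>h. h \<in> L2 \<Longrightarrow> \<exists>u u'. bvp_solution (A4 a d) (\<zeta>\<^sup>2) h u u' \<and>
        (\<forall>x\<in>{0..1}. norm (u x) \<le> C * (\<integral>x. norm (h x) \<partial>unit_measure))"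
        by (rule bvp_solution_exists[OF w D]) blast
      then have "\<zeta>\<^sup>2 \<notin> Spec Dom_D (AD_op (A4 a d))"
        by (rule notin_Spec_if_bvp_solvable) (assumption | rule bvp_solution_components[OF _ w D])+
      with S show False by simp
    qed
  qed
  also have "\<dots> \<longleftrightarrow> (1 - of_real \<kappa>) * (sin (of_real \<alpha> * \<zeta>))\<^sup>2 = (1 + of_real \<kappa>) * (sinh (of_real \<beta> * \<zeta>))\<^sup>2"
    unfolding w1_w2_def char_det_eq using False b_nz by simp
  finally show ?thesis .
qed

end

section \<open>The size of \<kappa> and the resulting description of the spectrum\<close>

context elliptic_matrix
begin

lemma Im_p: "Im p \<noteq> 0"
  using b_Im by (simp add: p_def)

lemma norm_p: "norm p = 1"
proof -
  have "norm p * norm p = 1"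
    using arg_cong[OF pq, of norm] by (simp add: norm_mult q_def)
  then show ?thesis
    using norm_ge_zero[of p] by (auto simp: square_eq_1_iff simp del: norm_ge_zero)
qed

text \<open>The relations p^2 = (a - d) p - 1 and b cnj(b) = ad + 1 reduce the product to degree one
  in p; the quantity of the case distinction surfaces as the coefficient of the only nonreal
  term.\<close>

lemma p_square_cnj_b: "p\<^sup>2 * cnj b = of_real (a\<^sup>2 - a * d - 1) * p - of_real a"
proof -
  have "p * cnj b = of_real a * cnj b - b * cnj b"
    by (simp add: p_def algebra_simps)
  also have "\<dots> = of_real a * (cnj b - of_real d) - 1"
    unfolding b_prod by (simp add: algebra_simps)
  also have "\<dots> = of_real a * p - 1" by (simp add: q_eq(3))
  finally have 1: "p * cnj b = of_real a * p - 1" .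
  have "p\<^sup>2 * cnj b = p * (p * cnj b)" by (simp add: power2_eq_square)
  also have "\<dots> = of_real a * p * p - p" unfolding 1 by (simp add: algebra_simps)
  also have "of_real a * p * p = of_real a * (p * (of_real a - of_real d) - 1)"
  proof -
    have "p * p = p * (p + q) - p * q" by (simp add: algebra_simps)
    also have "p + q = of_real a - of_real d" by (simp add: p_def q_eq(2))
    finally show ?thesis by (simp add: pq)
  qed
  finally show ?thesis by (simp add: algebra_simps power2_eq_square)
qed

lemma norm_p_square_cnj_b: "norm (p\<^sup>2 * cnj b) = norm b"
  by (simp add: norm_mult norm_power norm_p)

text \<open>The imaginary part of \<open>p\<^sup>2 * cnj b\<close> is (a^2 - ad - 1) Im p, so it is
  nonzero and the real part is strictly smaller than the modulus.\<close>

lemma abs_\<kappa>_less_1: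
  assumes "a\<^sup>2 - a * d - 1 \<noteq> 0"
  shows "\<bar>\<kappa>\<bar> < 1"
proof -
  let ?w = "p\<^sup>2 * cnj b"
  have Im: "Im ?w \<noteq> 0"
    unfolding p_square_cnj_b using assms Im_p by simp
  have "\<bar>Re ?w\<bar> < norm ?w"
  proof -
    have "(Re ?w)\<^sup>2 < (norm ?w)\<^sup>2"
      using Im by (simp only: cmod_power2) simp
    then show ?thesis using power2_less_imp_less[of "\<bar>Re ?w\<bar>" "norm ?w"] by simp
  qed
  then show ?thesis
    unfolding norm_p_square_cnj_b \<kappa>_def using b_nz by (simp add: divide_less_eq)
qed

text \<open>The hypothesis reads a (a - d) = 1, so a has the sign of a - d; and
  \<open>p\<^sup>2 * cnj b\<close> is now - a, whence \<kappa> is minus that sign.\<close>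

lemma \<kappa>_degenerate:
  assumes "a\<^sup>2 - a * d - 1 = 0"
  shows "a - d < 0 \<Longrightarrow> \<kappa> = 1" "a - d > 0 \<Longrightarrow> \<kappa> = -1"
proof -
  have w: "p\<^sup>2 * cnj b = - of_real a" unfolding p_square_cnj_b assms by simp
  have nb: "norm b = \<bar>a\<bar>" using norm_p_square_cnj_b unfolding w by simp
  have aad: "a * (a - d) = 1" using assms by (simp add: algebra_simps power2_eq_square)
  have \<kappa>: "\<kappa> = - a / \<bar>a\<bar>" unfolding \<kappa>_def w nb by simp
  show "\<kappa> = 1" if "a - d < 0"
    using aad that zero_less_mult_iff[of a "a - d"] by (simp add: \<kappa>)
  show "\<kappa> = - 1" if "a - d > 0"
    using aad that zero_less_mult_iff[of a "a - d"] by (simp add: \<kappa>)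
qed

text \<open>2\<alpha>\<beta> is the imaginary part of 1/b, and b is not real.\<close>

lemma \<alpha>_\<beta>_nz: "\<alpha> \<noteq> 0" "\<beta> \<noteq> 0"
proof -
  have "Im ((1 / s)\<^sup>2) = 2 * \<alpha> * \<beta>"
    unfolding \<alpha>_def \<beta>_def power2_eq_square times_complex.sel by simp
  moreover have "(1 / s)\<^sup>2 = 1 / b" using s by (simp add: power_divide b_def)
  moreover have "Im (1 / b) \<noteq> 0" using b_Im by (simp add: Im_divide)
  ultimately show "\<alpha> \<noteq> 0" "\<beta> \<noteq> 0" by auto
qed

lemma Spec_eq:
  "Spec Dom_D (AD_op (A4 a d)) = (\<lambda>\<zeta>. \<zeta>\<^sup>2) ` {\<zeta>. of_real (1 - \<kappa>) * (sin (of_real \<alpha> * \<zeta>))\<^sup>2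
     = of_real (1 + \<kappa>) * (sinh (of_real \<beta> * \<zeta>))\<^sup>2}"
proof (intro equalityI subsetI)
  fix z assume "z \<in> Spec Dom_D (AD_op (A4 a d))"
  then show "z \<in> (\<lambda>\<zeta>. \<zeta>\<^sup>2) ` {\<zeta>. of_real (1 - \<kappa>) * (sin (of_real \<alpha> * \<zeta>))\<^sup>2
     = of_real (1 + \<kappa>) * (sinh (of_real \<beta> * \<zeta>))\<^sup>2}"
    using in_Spec_iff[of "csqrt z"] by (intro image_eqI[of _ _ "csqrt z"]) auto
qed (auto simp: in_Spec_iff)

end

theorem theorem24:
  fixes a d :: real and s :: complex
  assumes "\<bar>a - d\<bar> < 2"
    and "s\<^sup>2 = b_plus a d"
  shows
    "(a\<^sup>2 - a * d - 1 = 0 \<and> - 2 < a - d \<and> a - d < 0 \<longrightarrow>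
        Spec Dom_D (AD_op (A4 a d)) =
          {complex_of_real (- ((of_int k)\<^sup>2 * pi\<^sup>2 / (Im (1 / s))\<^sup>2)) | k :: int. True} \<and>
        Spec Dom_D (AD_op (A4 a d)) \<subseteq> complex_of_real ` {..0}) \<and>
     (a\<^sup>2 - a * d - 1 = 0 \<and> 0 < a - d \<and> a - d < 2 \<longrightarrow>
        Spec Dom_D (AD_op (A4 a d)) =
          {complex_of_real ((of_int k)\<^sup>2 * pi\<^sup>2 / (Re (1 / s))\<^sup>2) | k :: int. True} \<and>
        Spec Dom_D (AD_op (A4 a d)) \<subseteq> complex_of_real ` {0..}) \<and>
     (a\<^sup>2 - a * d - 1 \<noteq> 0 \<longrightarrow>
        infinite (Spec Dom_D (AD_op (A4 a d))) \<and>
        finite (Spec Dom_D (AD_op (A4 a d)) \<inter> \<real>))"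
proof -
  interpret elliptic_matrix a d s by unfold_locales (fact assms)+
  let ?S = "Spec Dom_D (AD_op (A4 a d))"
  let ?Z = "{\<zeta> :: complex. of_real (1 - \<kappa>) * (sin (of_real \<alpha> * \<zeta>))\<^sup>2 = of_real (1 + \<kappa>) * (sinh (of_real \<beta> * \<zeta>))\<^sup>2}"
  note ab = \<alpha>_\<beta>_nz
  have "?S = {complex_of_real (- ((of_int k)\<^sup>2 * pi\<^sup>2 / (Im (1 / s))\<^sup>2)) | k :: int. True} \<and>
      ?S \<subseteq> complex_of_real ` {..0}" if "a\<^sup>2 - a * d - 1 = 0" "a - d < 0"
  proof -
    \<comment> \<open>Here \<kappa> = 1, so only sinh(\<beta>\<zeta>) = 0 remains: the zeros are
      purely imaginary and their squares are nonpositive.\<close>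
    have Z: "?Z = range (\<lambda>k::int. \<i> * of_real (of_int k * pi / \<beta>))"
    proof -
      have "\<zeta> \<in> ?Z \<longleftrightarrow> (\<exists>k::int. of_real \<beta> * \<zeta> = \<i> * of_real (of_int k * pi))" for \<zeta>
      proof -
        have "\<zeta> \<in> ?Z \<longleftrightarrow> sin (\<i> * (of_real \<beta> * \<zeta>)) = 0"
          using \<kappa>_degenerate(1)[OF that] by (simp add: sinh_conv_sin)
        also have "\<dots> \<longleftrightarrow> (\<exists>k::int. \<i> * (of_real \<beta> * \<zeta>) = of_real (of_int k * pi))"
          by (simp add: sin_eq_0 mult_ac)
        also have "\<dots> \<longleftrightarrow> (\<exists>k::int. of_real \<beta> * \<zeta> = \<i> * of_real (of_int k * pi))"
        proof
          assume "\<exists>k::int. \<i> * (of_real \<beta> * \<zeta>) = of_real (of_int k * pi)"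
          then obtain k :: int where k: "\<i> * (of_real \<beta> * \<zeta>) = of_real (of_int k * pi)" by blast
          \<comment> \<open>The sign from the square of the imaginary unit is absorbed by replacing
            k with - k.\<close>
          have "of_real \<beta> * \<zeta> = - (\<i> * (\<i> * (of_real \<beta> * \<zeta>)))"
            by (simp flip: mult.assoc)
          also have "\<dots> = \<i> * of_real (of_int (- k) * pi)" unfolding k by simp
          finally have "of_real \<beta> * \<zeta> = \<i> * of_real (of_int (- k) * pi)" .
          then show "\<exists>k::int. of_real \<beta> * \<zeta> = \<i> * of_real (of_int k * pi)" by blast
        next
          assume "\<exists>k::int. of_real \<beta> * \<zeta> = \<i> * of_real (of_int k * pi)"
          then obtain k :: int where "of_real \<beta> * \<zeta> = \<i> * of_real (of_int k * pi)" by blast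
          then have "\<i> * (of_real \<beta> * \<zeta>) = of_real (of_int (- k) * pi)"
            by (simp flip: mult.assoc)
          then show "\<exists>k::int. \<i> * (of_real \<beta> * \<zeta>) = of_real (of_int k * pi)" by blast
        qed
        finally show ?thesis .
      qed
      then show ?thesis
        using ab by (auto simp: field_simps image_iff)
    qed
    have "?S = range (\<lambda>k::int. complex_of_real (- ((of_int k)\<^sup>2 * pi\<^sup>2 / (Im (1 / s))\<^sup>2)))"
      unfolding Spec_eq Z image_image \<beta>_def[symmetric]
      by (intro image_cong refl) (simp add: power_mult_distrib power_divide)
    moreover from this have "?S \<subseteq> complex_of_real ` {..0}"
      by (simp only:) (intro image_subsetI image_eqI[OF refl]; simp)
    ultimately show ?thesis by blast
  qed
  moreover have "?S = {complex_of_real ((of_int k)\<^sup>2 * pi\<^sup>2 / (Re (1 / s))\<^sup>2) | k :: int. True} \<and>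
      ?S \<subseteq> complex_of_real ` {0..}" if "a\<^sup>2 - a * d - 1 = 0" "0 < a - d"
  proof -
    \<comment> \<open>Here \<kappa> = -1 and only sin(\<alpha>\<zeta>) = 0 remains, with real
      zeros.\<close>
    have Z: "?Z = range (\<lambda>k::int. of_real (of_int k * pi / \<alpha>))"
    proof -
      have "\<zeta> \<in> ?Z \<longleftrightarrow> (\<exists>k::int. of_real \<alpha> * \<zeta> = of_real (of_int k * pi))" for \<zeta>
        using \<kappa>_degenerate(2)[OF that] by (simp add: sin_eq_0 mult_ac)
      then show ?thesis
        using ab by (auto simp: field_simps image_iff)
    qed
    have "?S = range (\<lambda>k::int. complex_of_real ((of_int k)\<^sup>2 * pi\<^sup>2 / (Re (1 / s))\<^sup>2))"
      unfolding Spec_eq Z image_image \<alpha>_def[symmetric]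
      by (intro image_cong refl) (simp add: power_mult_distrib power_divide)
    moreover from this have "?S \<subseteq> complex_of_real ` {0..}"
      by (simp only:) (intro image_subsetI image_eqI[OF refl]; simp)
    ultimately show ?thesis by blast
  qed
  moreover have "infinite ?S \<and> finite (?S \<inter> \<real>)" if "a\<^sup>2 - a * d - 1 \<noteq> 0"
  proof
    have \<kappa>: "1 - \<kappa> > 0" "1 + \<kappa> > 0" using abs_\<kappa>_less_1[OF that] by auto
    show "infinite ?S"
      unfolding Spec_eq by (rule infinite_squares_sin_sinh[OF \<kappa> ab])
    have "finite {\<zeta>\<in>?Z. \<zeta>\<^sup>2 \<in> \<real>}"
      by (rule finite_real_squares_sin_sinh[OF \<kappa> ab])
    then have "finite ((\<lambda>\<zeta>. \<zeta>\<^sup>2) ` {\<zeta>\<in>?Z. \<zeta>\<^sup>2 \<in> \<real>})" by (rule finite_imageI)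
    then show "finite (?S \<inter> \<real>)"
      by (rule rev_finite_subset) (auto simp: Spec_eq)
  qed
  ultimately show ?thesis by blast
qed

end
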